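(* There is a universal constant $c>0$ such that the following holds for every integer $n\geq2$ and every $\epsilon>0$. Let $K\subset\mathbb{R}^n$ be a convex body with $0\in\mathrm{int}(K)$, such that for all $2$-dimensional linear planes $E\subset\mathbb{R}^n$, $d_{BM}(K\cap E,B^2)<1+\epsilon$. Then $$d_{BM}(K,B^n)<1+c\,n^{2n^2}\sqrt{\epsilon}.$$
   Context: A convex body in a finite-dimensional real vector space is a compact convex set with non-empty interior; $K\cap E$ is regarded as a convex body in the $2$-dimensional space $E$. $B^m$ is the Euclidean unit ball in $\mathbb{R}^m$. For convex bodies $K\subset V$, $L\subset W$ in real vector spaces of the same finite dimension, the (affine, multiplicative) Banach--Mazur distance is $$d_{BM}(K,L)=\inf\{\lambda>0:\ K\subset TL\subset\lambda K+z\ \text{for some affine map } T:W\to V \text{ and some } z\in V\}.$$ *)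

theory Defs
  imports "HOL-Analysis.Analysis" "HOL-Analysis.Finite_Function_Topology"
begin

text \<open>
  The constant in the theorem must not depend on the dimension, so \<open>n\<close> has to be quantified inside
  the formula and cannot be a type index. All the spaces \<open>\<real>\<^sup>n\<close> are therefore realised inside
  the one normed space \<^typ>\<open>nat \<Rightarrow>\<^sub>0 real\<close> of finitely supported real sequences,
  \<open>\<real>\<^sup>n\<close> being the subspace of the sequences supported in \<open>{..<n}\<close>.
  The library norm of that type is the \<open>l\<^sup>1\<close> norm. It is used here only through the topology it
  induces on finite-dimensional subspaces, which is the usual one (see
  \<open>homeomorphic_map_coord_space\<close>); the Euclidean ball is defined through coordinates.
\<close>

definition coord_space :: "nat \<Rightarrow> (nat \<Rightarrow>\<^sub>0 real) set" where
  "coord_space n = {x. Poly_Mapping.keys x \<subseteq> {..<n}}"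

definition euclidean_unit_ball :: "nat \<Rightarrow> (nat \<Rightarrow>\<^sub>0 real) set" where
  "euclidean_unit_ball m =
     {x \<in> coord_space m. sqrt (\<Sum>i<m. (Poly_Mapping.lookup x i)\<^sup>2) \<le> 1}"

text \<open>
  In the next definitions \<open>V\<close> and \<open>W\<close> are linear subspaces playing the role of the ambient vector
  spaces; interiors are taken relative to \<open>V\<close>.
\<close>

definition convex_body_in :: "'a::real_normed_vector set \<Rightarrow> 'a set \<Rightarrow> bool" where
  "convex_body_in V K \<longleftrightarrow>
     K \<subseteq> V \<and> compact K \<and> convex K \<and> (top_of_set V) interior_of K \<noteq> {}"

definition affine_map_between ::
  "'b::real_vector set \<Rightarrow> 'a::real_vector set \<Rightarrow> ('b \<Rightarrow> 'a) \<Rightarrow> bool" where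
  "affine_map_between W V T \<longleftrightarrow>
     T ` W \<subseteq> V \<and>
     (\<forall>x\<in>W. \<forall>y\<in>W. \<forall>t::real.
        T ((1 - t) *\<^sub>R x + t *\<^sub>R y) = (1 - t) *\<^sub>R T x + t *\<^sub>R T y)"

definition banach_mazur_dist ::
  "'a::real_vector set \<Rightarrow> 'a set \<Rightarrow> 'b::real_vector set \<Rightarrow> 'b set \<Rightarrow> real" where
  "banach_mazur_dist V K W L =
     Inf {r::real. r > 0 \<and>
            (\<exists>T z. affine_map_between W V T \<and> z \<in> V \<and>
                   K \<subseteq> T ` L \<and> T ` L \<subseteq> (\<lambda>x. r *\<^sub>R x + z) ` K)}"

lemma mem_coord_space_iff: "x \<in> coord_space n \<longleftrightarrow> (\<forall>i\<ge>n. Poly_Mapping.lookup x i = 0)"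
  unfolding coord_space_def by (auto simp: in_keys_iff subset_iff) (meson not_le)+

lemma lookup_scaleR_poly_mapping: "Poly_Mapping.lookup (r *\<^sub>R x) i = r *\<^sub>R Poly_Mapping.lookup x i"
  for x :: "'a \<Rightarrow>\<^sub>0 'b::real_vector"
proof -
  have "finite {i. r *\<^sub>R Poly_Mapping.lookup x i \<noteq> 0}"
    by (rule finite_subset[OF _ finite_keys[of x]]) (auto simp: in_keys_iff)
  then show ?thesis by (simp add: scaleR_poly_mapping_def)
qed

lemma subspace_coord_space: "subspace (coord_space n)"
  by (auto simp: subspace_def mem_coord_space_iff lookup_add lookup_scaleR_poly_mapping)

lemma dim_coord_space: "dim (coord_space n) = n"
proof -
  let ?e = "\<lambda>i::nat. Poly_Mapping.single i (1::real)"
  have inj: "inj_on ?e {..<n}" by (rule inj_onI) (metis lookup_single_eq lookup_single_not_eq zero_neq_one)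
  have lk: "Poly_Mapping.lookup (\<Sum>i<n. c i *\<^sub>R ?e i) j = (if j < n then c j else 0)" for c j
    by (simp add: lookup_sum lookup_scaleR_poly_mapping lookup_single when_def if_distrib cong: if_cong)
  have ind: "independent (?e ` {..<n})"
  proof (rule independent_if_scalars_zero)
    fix f x assume 0: "(\<Sum>x\<in>?e ` {..<n}. f x *\<^sub>R x) = 0" and x: "x \<in> ?e ` {..<n}"
    have "(\<Sum>i<n. f (?e i) *\<^sub>R ?e i) = 0" using 0 by (simp add: sum.reindex[OF inj] o_def)
    then have z: "Poly_Mapping.lookup (\<Sum>i<n. f (?e i) *\<^sub>R ?e i) j = 0" for j by simp
    obtain j where "x = ?e j" "j < n" using x by auto
    then show "f x = 0" using lk[of "\<lambda>i. f (?e i)" j] z[of j] by simp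
  qed auto
  have sub: "?e ` {..<n} \<subseteq> coord_space n" by (auto simp: mem_coord_space_iff lookup_single when_def)
  have "coord_space n \<subseteq> span (?e ` {..<n})"
  proof
    fix x assume x: "x \<in> coord_space n"
    have eq: "x = (\<Sum>i<n. Poly_Mapping.lookup x i *\<^sub>R ?e i)"
      by (rule poly_mapping_eqI) (use x lk in \<open>auto simp: mem_coord_space_iff\<close>)
    have "(\<Sum>i<n. Poly_Mapping.lookup x i *\<^sub>R ?e i) \<in> span (?e ` {..<n})"
      by (intro span_sum span_scale span_base imageI)
    then show "x \<in> span (?e ` {..<n})"
      by (simp only: eq[symmetric])
  qed
  then show ?thesis using dim_unique[OF sub _ ind] card_image[OF inj] by simp
qed

lemma norm_coord_space: "x \<in> coord_space n \<Longrightarrow> norm x = (\<Sum>i<n. \<bar>Poly_Mapping.lookup x i\<bar>)"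
  unfolding norm_poly_mapping_def dist_poly_mapping_def
  by (auto simp: coord_space_def in_keys_iff intro!: sum.mono_neutral_left)

lemma homeomorphic_map_coord_space: "homeomorphic_map (top_of_set (coord_space n)) (Euclidean_space n) Poly_Mapping.lookup"
proof (rule homeomorphic_maps_imp_map)
  let ?g = "\<lambda>f::nat\<Rightarrow>real. \<Sum>i<n. Poly_Mapping.single i (f i)"
  have single: "Poly_Mapping.single i r = r *\<^sub>R Poly_Mapping.single i 1" for i :: nat and r :: real
    by (rule poly_mapping_eqI) (simp add: lookup_scaleR_poly_mapping lookup_single when_def)
  have lk: "Poly_Mapping.lookup (?g f) j = (if j < n then f j else 0)" for f j
    by (simp add: lookup_sum lookup_single when_def)
  have top: "topspace (Euclidean_space n) = {x. \<forall>i\<ge>n. x i = 0}"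
    by (rule topspace_Euclidean_space)
  have 1: "continuous_map (top_of_set (coord_space n)) (Euclidean_space n) Poly_Mapping.lookup"
    unfolding Euclidean_space_def continuous_map_in_subtopology
  proof
    have "continuous_on (coord_space n) (\<lambda>x. Poly_Mapping.lookup x k)" for k
    proof (rule linear_continuous_on)
      show "bounded_linear (\<lambda>x::nat \<Rightarrow>\<^sub>0 real. Poly_Mapping.lookup x k)"
      proof
        have "\<bar>Poly_Mapping.lookup x k\<bar> \<le> norm x" for x :: "nat \<Rightarrow>\<^sub>0 real"
        proof -
          define N where "N = Suc (Max (insert k (Poly_Mapping.keys x)))"
          have "x \<in> coord_space N" "k < N"
            by (auto simp: coord_space_def N_def less_Suc_eq_le)
          then show ?thesis unfolding norm_coord_space[OF \<open>x \<in> coord_space N\<close>]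
            by (intro member_le_sum) auto
        qed
        then show "\<exists>K. \<forall>x::nat \<Rightarrow>\<^sub>0 real. norm (Poly_Mapping.lookup x k) \<le> norm x * K"
          by (intro exI[of _ 1]) auto
      qed (auto simp: lookup_add lookup_scaleR_poly_mapping)
    qed
    then show "continuous_map (top_of_set (coord_space n)) (powertop_real UNIV) Poly_Mapping.lookup"
      by (simp add: continuous_map_componentwise_UNIV)
  qed (auto simp: mem_coord_space_iff)
  have "continuous_map (Euclidean_space n) euclidean ?g"
    unfolding Euclidean_space_def
  proof (intro continuous_map_from_subtopology)
    have "continuous_on UNIV ?g"
      by (subst single) (intro continuous_intros continuous_on_product_coordinates)
    then show "continuous_map (powertop_real UNIV) euclidean ?g"
      by (simp add: euclidean_product_topology)
  qed
  moreover have "?g ` topspace (Euclidean_space n) \<subseteq> coord_space n"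
    by (auto simp: mem_coord_space_iff lk)
  ultimately have 2: "continuous_map (Euclidean_space n) (top_of_set (coord_space n)) ?g"
    by (auto simp: continuous_map_in_subtopology)
  show "homeomorphic_maps (top_of_set (coord_space n)) (Euclidean_space n) Poly_Mapping.lookup ?g"
    unfolding homeomorphic_maps_def
    by (intro conjI 1 2) (auto simp: top mem_coord_space_iff lk fun_eq_iff intro!: poly_mapping_eqI)
qed
end

(*
A planar ellipse around the origin is the set k + l(x) - q(x) >= 0 with l linear and q quadratic. If all planar
sections of K were ellipses, the data (l, q) of the planes through a fixed direction p, normalised by q(p) = 1,
would fit together to functions L and Q on the whole space. On every line through the origin the two end points of
K determine L/Q and k/Q, so on an arbitrary plane (l, q) is (L, Q) up to a scalar function phi = q/Q; if phi is
constant on planes, then L is linear and Q satisfies the parallelogram law, and K is the ellipsoid given by L and Q.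

For epsilon-ellipses all this holds with errors. The constant terms fix phi unless the origin is close to the
boundary of K; there L is the more precise datum: first it is shown to be additive up to O(sqrt epsilon), with the
help of planes almost tangent to K or of convexity, and then phi is read off from L on planes transversal to the
tangent directions. This is where sqrt epsilon arises. All constants are powers of R = 2 n^(n+2), the radius
of K after a linear change of coordinates found by Gaussian elimination, and R^143 = O(n^(2 n^2)).
*)

theory Submission
  imports Defs
begin

subsection \<open>Chords and quadratic functions\<close>

text \<open>No linear change of coordinates can keep 0 away from the boundary of K by a controlled
  distance. Therefore the reference direction is a point p that is the centre of a unit ball in K,
  and every estimate has to survive 0 on the boundary. A slack of 4 h^2 in k + l - q fixes k up to
  O(h^2) through the product of the two chord ends, but l only through their difference, after
  division by the chord length. Chords shorter than h leave an error O(h), and h = sqrt \<epsilon>.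
  Comparing scales through L works only at vectors where L is bounded away from 0. The other vectors
  are reached because the defect of Q from the quadratic identity is exactly affine in shifts along
  p: its values at two far shifts are extrapolated back to shift 0. All this needs h R^140 <= 1.
  Otherwise the crude bound 2 n R <= R^3 <= R^143 h is enough, whence 143 = 140 + 3. The exponent of
  n in R^143 is linear in n and is beaten by 2 n^2, so powers of R can be spent freely.\<close>

definition quadratic_form :: "('a::real_vector \<Rightarrow> real) \<Rightarrow> bool" where
  "quadratic_form q \<longleftrightarrow> (\<forall>x y s t. q (s *\<^sub>R x + t *\<^sub>R y) =
     s\<^sup>2 * q x + s * t * (q (x + y) - q x - q y) + t\<^sup>2 * q y)"

lemma quadratic_formD:
  "quadratic_form q \<Longrightarrow> q (s *\<^sub>R x + t *\<^sub>R y) =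
     s\<^sup>2 * q x + s * t * (q (x + y) - q x - q y) + t\<^sup>2 * q y"
  by (auto simp: quadratic_form_def)

lemma quadratic_form_scale: "quadratic_form q \<Longrightarrow> q (s *\<^sub>R x) = s\<^sup>2 * q x"
  using quadratic_formD[of q s x 0 0] by simp

lemma quadratic_form_0: "quadratic_form q \<Longrightarrow> q 0 = 0"
  using quadratic_form_scale[of q 0 0] by simp

lemma quadratic_form_parallelogram:
  "quadratic_form q \<Longrightarrow> q (x + y) + q (x - y) = 2 * q x + 2 * q y"
  using quadratic_formD[of q 1 x "-1" y] by simp

text \<open>\<open>k + l z - q z\<close> is modelled on one minus the squared distance to the
  centre, in coordinates that make the section nearly round; hence the upper bound 1. The slack
  \<open>4 * h\<^sup>2\<close> is at least \<open>1 - (1 - 2 * h\<^sup>2)\<^sup>2\<close>, from a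
  concentric disc of radius \<open>1 - 2 * h\<^sup>2\<close> inside the section. The last clause
  bounds the semi-axes by \<open>2 * R\<close>.\<close>

definition near_quadric ::
  "'a::real_normed_vector set \<Rightarrow> real \<Rightarrow> real \<Rightarrow> 'a set \<Rightarrow> real \<Rightarrow> ('a \<Rightarrow> real) \<Rightarrow> ('a \<Rightarrow> real) \<Rightarrow> bool" where
  "near_quadric K R h U k l q \<longleftrightarrow> linear l \<and> quadratic_form q \<and>
     (\<forall>z\<in>U. (z \<in> K \<longrightarrow> 0 \<le> k + l z - q z) \<and> (4 * h\<^sup>2 \<le> k + l z - q z \<longrightarrow> z \<in> K) \<and>
        k + l z - q z \<le> 1 \<and> (norm z)\<^sup>2 \<le> 4 * R\<^sup>2 * q z)"

lemma chord_end_exists: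
  fixes K :: "'a::real_normed_vector set"
  assumes "compact K" "0 \<in> K" "z \<noteq> 0"
  shows "\<exists>A\<ge>0. A *\<^sub>R z \<in> K \<and> (\<forall>\<sigma>>A. \<sigma> *\<^sub>R z \<notin> K)"
proof -
  let ?S = "(\<lambda>\<sigma>. \<sigma> *\<^sub>R z) -` K"
  obtain B where B: "\<And>x. x \<in> K \<Longrightarrow> norm x \<le> B"
    using compact_imp_bounded[OF assms(1)] bounded_iff by blast
  have "closed ?S"
    by (intro closed_vimage compact_imp_closed assms continuous_intros)
  moreover have "bounded ?S"
    unfolding bounded_iff
  proof (intro exI ballI)
    fix \<sigma> assume "\<sigma> \<in> ?S"
    then have "\<bar>\<sigma>\<bar> * norm z \<le> B" using B[of "\<sigma> *\<^sub>R z"] by simp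
    then show "norm \<sigma> \<le> B / norm z" using assms(3) by (simp add: field_simps)
  qed
  ultimately have "compact ?S" by (simp add: compact_eq_bounded_closed)
  moreover have "0 \<in> ?S" using assms by simp
  ultimately obtain A where "A \<in> ?S" "\<forall>t\<in>?S. t \<le> A"
    using compact_attains_sup[of ?S] by blast
  then have "0 \<le> A" "A *\<^sub>R z \<in> K" "\<forall>\<sigma>>A. \<sigma> *\<^sub>R z \<notin> K"
    using \<open>0 \<in> ?S\<close> by (auto simp: not_le[symmetric])
  then show ?thesis by blast
qed

definition chord_ends :: "'a::real_vector set \<Rightarrow> 'a \<Rightarrow> real \<Rightarrow> real \<Rightarrow> bool" where
  "chord_ends K z A B \<longleftrightarrow> 0 \<le> A \<and> 0 \<le> B \<and> A *\<^sub>R z \<in> K \<and> (- B) *\<^sub>R z \<in> K \<and>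
     (\<forall>\<sigma>>A. \<sigma> *\<^sub>R z \<notin> K) \<and> (\<forall>\<sigma>>B. (- \<sigma>) *\<^sub>R z \<notin> K)"

lemma chord_ends_exist:
  fixes K :: "'a::real_normed_vector set"
  assumes "compact K" "0 \<in> K" "z \<noteq> 0"
  shows "\<exists>A B. chord_ends K z A B"
proof -
  obtain A where "A \<ge> 0" "A *\<^sub>R z \<in> K" "\<forall>\<sigma>>A. \<sigma> *\<^sub>R z \<notin> K"
    using chord_end_exists[OF assms] by blast
  moreover obtain B where "B \<ge> 0" "B *\<^sub>R (- z) \<in> K" "\<forall>\<sigma>>B. \<sigma> *\<^sub>R (- z) \<notin> K"
    using chord_end_exists[OF assms(1,2), of "- z"] assms(3) by auto
  ultimately have "chord_ends K z A B" by (simp add: chord_ends_def)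
  then show ?thesis by blast
qed

text \<open>The two ends pin down a quadratic function on the line well unless the chord is shorter than
  \<open>h\<close>; in that case the inclusion \<open>{\<Phi> \<ge> 4 h\<^sup>2} \<subseteq> K\<close> forces the linear term to be \<open>O(h)\<close> as well.\<close>

lemma near_quadric_chord:
  assumes N: "near_quadric K R h U k l q" and z: "z \<in> U" and U: "subspace U" and h: "0 < h"
    and c: "chord_ends K z A B"
  shows "0 \<le> k - q z * (A * B)" "k - q z * (A * B) \<le> 4 * h\<^sup>2"
    "\<bar>l z - q z * (A - B)\<bar> \<le> (4 + 2 * q z) * h"
proof -
  define f where "f \<sigma> = k + \<sigma> * l z - \<sigma>\<^sup>2 * q z" for \<sigma>
  have l: "l (\<sigma> *\<^sub>R z) = \<sigma> * l z" and q: "q (\<sigma> *\<^sub>R z) = \<sigma>\<^sup>2 * q z" for \<sigma>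
    using N by (auto simp: near_quadric_def linear_scale quadratic_form_scale)
  have sU: "\<sigma> *\<^sub>R z \<in> U" for \<sigma> using U z by (simp add: subspace_scale)
  have fK: "\<sigma> *\<^sub>R z \<in> K \<Longrightarrow> 0 \<le> f \<sigma>" and Kf: "4 * h\<^sup>2 \<le> f \<sigma> \<Longrightarrow> \<sigma> *\<^sub>R z \<in> K" for \<sigma>
    using N sU[of \<sigma>] unfolding near_quadric_def f_def l[symmetric] q[symmetric] by blast+
  have c': "0 \<le> A" "0 \<le> B" "A *\<^sub>R z \<in> K" "(- B) *\<^sub>R z \<in> K"
    "\<And>\<sigma>. \<sigma> > A \<Longrightarrow> \<sigma> *\<^sub>R z \<notin> K" "\<And>\<sigma>. \<sigma> > B \<Longrightarrow> (- \<sigma>) *\<^sub>R z \<notin> K"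
    using c unfolding chord_ends_def by blast+
  have f1: "0 \<le> f A" "0 \<le> f (- B)" using fK c' by blast+
  have cont: "(f \<longlongrightarrow> f x) (at_right x)" "((\<lambda>s. f (- s)) \<longlongrightarrow> f (- x)) (at_right x)" for x
    unfolding f_def by (intro tendsto_intros)+
  \<comment> \<open>Points just beyond an end are outside \<open>K\<close>, so \<open>f\<close> is
    below the slack there; the bound at the end itself is a limit from the right.\<close>
  have f2: "f A \<le> 4 * h\<^sup>2"
  proof (rule tendsto_upperbound[OF cont(1)])
    show "\<forall>\<^sub>F s in at_right A. f s \<le> 4 * h\<^sup>2"
      using eventually_at_right_less[of A]
      by eventually_elim (use Kf c'(5) in \<open>meson less_imp_le linorder_not_less\<close>)
  qed simp
  have f3: "f (- B) \<le> 4 * h\<^sup>2"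
  proof (rule tendsto_upperbound[OF cont(2)])
    show "\<forall>\<^sub>F s in at_right B. f (- s) \<le> 4 * h\<^sup>2"
      using eventually_at_right_less[of B]
      by eventually_elim (use Kf c'(6) in \<open>meson less_imp_le linorder_not_less\<close>)
  qed simp
  \<comment> \<open>Interpolation of \<open>f\<close> at \<open>A\<close> and \<open>- B\<close>,
    cleared of the denominator \<open>A + B\<close>. The constant term is a weighted mean of the two
    values, whereas the linear term needs their difference divided by the chord length.\<close>
  have e1: "(k - q z * (A * B)) * (A + B) = B * f A + A * f (- B)"
    and e2: "(l z - q z * (A - B)) * (A + B) = f A - f (- B)"
    by (auto simp: f_def algebra_simps power2_eq_square)
  have b: "0 \<le> B * f A + A * f (- B)" "B * f A + A * f (- B) \<le> 4 * h\<^sup>2 * (A + B)"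
    using mult_left_mono[OF f2 c'(2)] mult_left_mono[OF f3 c'(1)] f1 c' by (auto simp: algebra_simps)
  have k1: "0 \<le> k - q z * (A * B) \<and> k - q z * (A * B) \<le> 4 * h\<^sup>2"
  proof (cases "A + B = 0")
    case True
    then have "A = 0" "B = 0" using c' by auto
    then show ?thesis using f1 f2 by (simp add: f_def)
  next
    case False
    then have "A + B > 0" using c' by auto
    then show ?thesis using b unfolding e1[symmetric] by (simp add: zero_le_mult_iff)
  qed
  then show "0 \<le> k - q z * (A * B)" "k - q z * (A * B) \<le> 4 * h\<^sup>2" by auto
  have qz: "0 \<le> q z"
  proof -
    have "0 \<le> (norm z)\<^sup>2" "(norm z)\<^sup>2 \<le> 4 * R\<^sup>2 * q z" using N z by (auto simp: near_quadric_def)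
    then have "0 \<le> 4 * R\<^sup>2 * q z" by linarith
    moreover have "q z = 0" if "R = 0"
      using that \<open>(norm z)\<^sup>2 \<le> 4 * R\<^sup>2 * q z\<close> N by (simp add: near_quadric_def quadratic_form_0)
    ultimately show ?thesis by (cases "R = 0") (auto simp: zero_le_mult_iff)
  qed
  show "\<bar>l z - q z * (A - B)\<bar> \<le> (4 + 2 * q z) * h"
  proof (cases "A + B \<ge> h")
    case True
    have "\<bar>l z - q z * (A - B)\<bar> * h \<le> \<bar>l z - q z * (A - B)\<bar> * (A + B)"
      using True by (intro mult_left_mono) auto
    also have "\<dots> = \<bar>f A - f (- B)\<bar>" using c' by (simp add: e2[symmetric] abs_mult)
    also have "\<dots> \<le> 4 * h * h" using f1 f2 f3 by (simp add: power2_eq_square)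
    finally have "\<bar>l z - q z * (A - B)\<bar> \<le> 4 * h" using h by simp
    also have "\<dots> \<le> (4 + 2 * q z) * h" using h qz by simp
    finally show ?thesis .
  next
    case False
    have k0: "0 \<le> k" using k1 mult_nonneg_nonneg[OF qz mult_nonneg_nonneg[OF c'(1,2)]] by linarith
    \<comment> \<open>Both ends have parameters of modulus below \<open>h\<close>, so the points at
      \<open>h\<close> and \<open>- h\<close> are outside \<open>K\<close>. The upper bound on
      \<open>f\<close> at these two points controls \<open>l z\<close> from both sides.\<close>
    have n: "h *\<^sub>R z \<notin> K" "(- h) *\<^sub>R z \<notin> K" using False c'(1,2,5,6) by auto
    have "f h < 4 * h\<^sup>2" "f (- h) < 4 * h\<^sup>2" using Kf[of h] Kf[of "- h"] n by (meson linorder_not_less)+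
    then have "h * l z < h * ((4 + q z) * h)" "h * (- l z) < h * ((4 + q z) * h)"
      using k0 by (auto simp: f_def algebra_simps power2_eq_square)
    then have "l z < (4 + q z) * h" "- l z < (4 + q z) * h"
      using h by (simp_all only: mult_less_cancel_left_pos)
    then have "\<bar>l z\<bar> \<le> (4 + q z) * h" by linarith
    moreover have "\<bar>q z * (A - B)\<bar> \<le> q z * h"
      using False c' qz by (auto simp: abs_mult intro!: mult_left_mono)
    ultimately show ?thesis by (auto simp: algebra_simps)
  qed
qed

text \<open>The mean of \<open>k + l - q\<close> over \<open>w + y\<close> and \<open>w - y\<close>
  is its value at \<open>w\<close> minus \<open>q y\<close>. It is nonnegative, and the value at
  \<open>w\<close> is at most 1, so \<open>q y \<le> 1\<close> on the sphere of radius
  \<open>r\<close>.\<close>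

lemma near_quadric_upper:
  assumes N: "near_quadric K R h U k l q" and U: "subspace U" and w: "w \<in> U" and r: "0 < r"
    and b: "\<And>x. x \<in> U \<Longrightarrow> norm x \<le> r \<Longrightarrow> w + x \<in> K" and x: "x \<in> U"
  shows "q x \<le> (norm x)\<^sup>2 / r\<^sup>2"
proof (cases "x = 0")
  case True
  then show ?thesis using N by (simp add: near_quadric_def quadratic_form_0)
next
  case False
  define y where "y = (r / norm x) *\<^sub>R x"
  have y: "y \<in> U" "norm y = r" using False r x U by (auto simp: y_def subspace_scale)
  have K: "w + y \<in> K" "w - y \<in> K" using b[of y] b[of "- y"] y U by (auto simp: subspace_neg)
  have yU: "w + y \<in> U" "w - y \<in> U" using U w y by (auto simp: subspace_add subspace_diff)
  have lq: "linear l" "quadratic_form q" using N by (auto simp: near_quadric_def)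
  have "0 \<le> k + l (w + y) - q (w + y)" "0 \<le> k + l (w - y) - q (w - y)" "k + l w - q w \<le> 1"
    using N K yU w by (auto simp: near_quadric_def)
  moreover have "l (w + y) + l (w - y) = 2 * l w" using lq(1) by (simp add: linear_add linear_diff)
  moreover have "q (w + y) + q (w - y) = 2 * q w + 2 * q y" using lq(2) by (rule quadratic_form_parallelogram)
  ultimately have "q y \<le> 1" by linarith
  then have "(r / norm x)\<^sup>2 * q x \<le> 1" using lq by (simp add: y_def quadratic_form_scale)
  then have "r\<^sup>2 * q x / (norm x)\<^sup>2 \<le> 1" by (simp add: power_divide)
  then have "q x * r\<^sup>2 \<le> (norm x)\<^sup>2" using False by (simp add: divide_le_eq_1 mult.commute)
  moreover have "0 < r\<^sup>2" using r by simp
  ultimately show ?thesis by (simp only: pos_le_divide_eq)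
qed

subsection \<open>Planar sections through a fixed direction\<close>

text \<open>\<open>K\<close> is the body after the change of coordinates. The unit ball sits around
  \<open>p\<close>, while 0 may be arbitrarily close to the boundary. The number 32 is the value of
  2 n^(n+2) at n = 2; it lets numerical factors be absorbed into powers of \<open>R\<close>. The
  exponent 140 exceeds every power of \<open>R\<close> that a smallness argument needs.\<close>

locale near_quadric_sections =
  fixes V K :: "'a::real_normed_vector set" and p :: 'a and R h :: real
  assumes V: "subspace V" and KV: "K \<subseteq> V" and compact_K: "compact K" and convex_K: "convex K"
    and zero_K: "0 \<in> K" and p_V: "p \<in> V" and norm_p: "1 \<le> norm p"
    and ball_K: "\<And>x. x \<in> V \<Longrightarrow> norm (x - p) \<le> 1 \<Longrightarrow> x \<in> K"
    and K_bound: "\<And>x. x \<in> K \<Longrightarrow> norm x \<le> R"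
    and R: "32 \<le> R" and h: "0 < h" and hR: "h * R ^ 140 \<le> 1"
    and sections: "\<And>x y. x \<in> V \<Longrightarrow> y \<in> V \<Longrightarrow> \<exists>k l q. near_quadric K R h (span {x, y}) k l q"
begin

lemma R_pos: "0 < R" and R_ge_1: "1 \<le> R"
  using R by auto

lemma R_power_mono: "i \<le> j \<Longrightarrow> R ^ i \<le> R ^ j"
  by (rule power_increasing[OF _ R_ge_1])

lemma absorb: "c \<le> 32 ^ j \<Longrightarrow> 0 \<le> c \<Longrightarrow> c * R ^ i \<le> R ^ (i + j)"
proof -
  assume "c \<le> 32 ^ j" "0 \<le> c"
  moreover have "(32::real) ^ j \<le> R ^ j" using R by (intro power_mono) auto
  ultimately have "c * R ^ i \<le> R ^ j * R ^ i" using R_pos by (intro mult_right_mono) auto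
  then show ?thesis by (simp add: power_add mult.commute)
qed

lemma h_small: "j \<le> 140 \<Longrightarrow> h * R ^ j \<le> 1"
  using mult_left_mono[OF R_power_mono[of j 140], of h] h hR by linarith

lemma h_le_1: "h \<le> 1"
  using h_small[of 0] by simp

lemma h_square_le: "h\<^sup>2 \<le> h"
  using h h_le_1 by (simp add: power2_eq_square mult_left_le)

text \<open>The choice is made for the plane as a set and not for a spanning pair, so that all pairs
  spanning the same plane share their data.\<close>

definition kap :: "'a set \<Rightarrow> real" where
  "kap U = fst (SOME d. near_quadric K R h U (fst d) (fst (snd d)) (snd (snd d)))"
definition lam :: "'a set \<Rightarrow> 'a \<Rightarrow> real" where
  "lam U = fst (snd (SOME d. near_quadric K R h U (fst d) (fst (snd d)) (snd (snd d))))"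
definition qf :: "'a set \<Rightarrow> 'a \<Rightarrow> real" where
  "qf U = snd (snd (SOME d. near_quadric K R h U (fst d) (fst (snd d)) (snd (snd d))))"

lemma chosen_section: "x \<in> V \<Longrightarrow> y \<in> V \<Longrightarrow>
   near_quadric K R h (span {x, y}) (kap (span {x, y})) (lam (span {x, y})) (qf (span {x, y}))"
  unfolding kap_def lam_def qf_def
  using someI_ex[of "\<lambda>d. near_quadric K R h (span {x, y}) (fst d) (fst (snd d)) (snd (snd d))"]
    sections[of x y] by auto

text \<open>Planes are represented as \<open>span {x, y}\<close>, so degenerate ones are allowed; this spares all case
  distinctions on linear dependence.\<close>

definition planes :: "'a set set" where
  "planes = {span {x, y} | x y. x \<in> V \<and> y \<in> V}"

lemma span_planes: "x \<in> V \<Longrightarrow> y \<in> V \<Longrightarrow> span {x, y} \<in> planes"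
  by (auto simp: planes_def)

lemma planeD:
  assumes "U \<in> planes"
  shows "near_quadric K R h U (kap U) (lam U) (qf U)" "subspace U" "U \<subseteq> V"
proof -
  obtain x y where U: "U = span {x, y}" "x \<in> V" "y \<in> V" using assms by (auto simp: planes_def)
  show "near_quadric K R h U (kap U) (lam U) (qf U)" using chosen_section U by simp
  show "subspace U" by (simp add: U)
  show "U \<subseteq> V" using span_minimal[of "{x, y}" V] U V by auto
qed

lemma lam_linear: "U \<in> planes \<Longrightarrow> linear (lam U)"
  and qf_quadratic: "U \<in> planes \<Longrightarrow> quadratic_form (qf U)"
  using planeD(1)[of U] by (auto simp: near_quadric_def)

lemma section_nonneg: "U \<in> planes \<Longrightarrow> z \<in> U \<Longrightarrow> z \<in> K \<Longrightarrow> 0 \<le> kap U + lam U z - qf U z"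
  and section_mem: "U \<in> planes \<Longrightarrow> z \<in> U \<Longrightarrow> 4 * h\<^sup>2 \<le> kap U + lam U z - qf U z \<Longrightarrow> z \<in> K"
  and section_le_1: "U \<in> planes \<Longrightarrow> z \<in> U \<Longrightarrow> kap U + lam U z - qf U z \<le> 1"
  and qf_lower: "U \<in> planes \<Longrightarrow> z \<in> U \<Longrightarrow> (norm z)\<^sup>2 \<le> 4 * R\<^sup>2 * qf U z"
  using planeD(1)[of U] by (auto simp: near_quadric_def)

lemma qf_nonneg: "U \<in> planes \<Longrightarrow> z \<in> U \<Longrightarrow> 0 \<le> qf U z"
  using qf_lower[of U z] R_pos by (smt (verit) mult_nonneg_nonpos mult_pos_neg zero_less_power zero_le_power2)

lemma kap_bounds: "U \<in> planes \<Longrightarrow> 0 \<le> kap U \<and> kap U \<le> 1"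
  using section_nonneg[of U 0] section_le_1[of U 0] zero_K planeD(2)[of U]
  by (simp add: subspace_0 linear_0[OF lam_linear] quadratic_form_0[OF qf_quadratic])

section \<open>Normalised data of the planes through \<open>p\<close>\<close>

definition pl :: "'a \<Rightarrow> 'a set" where "pl z = span {p, z}"

lemma pl_plane: "z \<in> V \<Longrightarrow> pl z \<in> planes" and p_pl: "p \<in> pl z" and z_pl: "z \<in> pl z"
  using p_V by (auto simp: pl_def span_planes span_base)

text \<open>Moving \<open>z\<close> along \<open>p\<close> keeps the plane, hence also the chosen
  data. This is what makes \<open>L\<close> and \<open>Q\<close> behave exactly, without error,
  along lines in direction \<open>p\<close>.\<close>

lemma pl_shift: "t \<noteq> 0 \<Longrightarrow> pl (s *\<^sub>R p + t *\<^sub>R z) = pl z"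
proof -
  assume t: "t \<noteq> 0"
  have "z = (1 / t) *\<^sub>R (s *\<^sub>R p + t *\<^sub>R z) - (s / t) *\<^sub>R p" using t by (simp add: algebra_simps)
  also have "\<dots> \<in> span {p, s *\<^sub>R p + t *\<^sub>R z}" by (intro span_diff span_scale span_base) auto
  finally have 1: "z \<in> span {p, s *\<^sub>R p + t *\<^sub>R z}" .
  have 2: "s *\<^sub>R p + t *\<^sub>R z \<in> span {p, z}" by (intro span_add span_scale span_base) auto
  show ?thesis unfolding pl_def
    by (intro span_eq[THEN iffD2] conjI) (use 1 2 in \<open>auto intro: span_base\<close>)
qed

lemma pl_add: "pl (z + t *\<^sub>R p) = pl z" and pl_scale: "t \<noteq> 0 \<Longrightarrow> pl (t *\<^sub>R z) = pl z"
  using pl_shift[of 1 t z] pl_shift[of t 0 z] by (auto simp: add.commute)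

text \<open>Planes through \<open>p\<close> cut the unit ball around \<open>p\<close> in a full
  disc, which bounds their quadratic part from above. A general plane may meet \<open>K\<close> in a
  very small section and has no such bound.\<close>

lemma pl_upper: "z \<in> V \<Longrightarrow> x \<in> pl z \<Longrightarrow> qf (pl z) x \<le> (norm x)\<^sup>2"
proof -
  assume z: "z \<in> V" and x: "x \<in> pl z"
  have "p + y \<in> K" if "y \<in> pl z" "norm y \<le> 1" for y
    using that ball_K[of "p + y"] planeD(3)[OF pl_plane[OF z]] p_V V by (auto simp: subspace_add subset_iff)
  then show ?thesis
    using near_quadric_upper[OF planeD(1,2)[OF pl_plane[OF z]] p_pl, of 1 x] x by simp
qed

lemma norm_p_le: "norm p \<le> R"
  using K_bound[of p] ball_K[of p] p_V by simp

definition mu :: "'a \<Rightarrow> real" where "mu z = qf (pl z) p"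

lemma mu_bounds: assumes "z \<in> V" shows "1 \<le> 4 * R\<^sup>2 * mu z" "mu z \<le> R\<^sup>2" "0 < mu z"
proof -
  have "1 \<le> (norm p)\<^sup>2" using norm_p by simp
  then show 1: "1 \<le> 4 * R\<^sup>2 * mu z" using qf_lower[OF pl_plane[OF assms] p_pl] by (simp add: mu_def)
  show "mu z \<le> R\<^sup>2" using pl_upper[OF assms p_pl] norm_p_le
    by (simp add: mu_def) (meson norm_ge_zero order_trans power_mono)
  show "0 < mu z" using 1 R_pos by (smt (verit) mult_nonneg_nonpos zero_le_power2)
qed

definition Q :: "'a \<Rightarrow> real" where "Q z = qf (pl z) z / mu z"
definition L :: "'a \<Rightarrow> real" where "L z = lam (pl z) z / mu z"
text \<open>For an exact ellipsoid \<open>nu\<close> and \<open>kp\<close> would not depend on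
  \<open>z\<close>, being the linear coefficient in direction \<open>p\<close> and the constant term
  after normalisation. \<open>nu_lam0\<close> and \<open>kp_del\<close> bound how much they
  vary.\<close>

definition nu :: "'a \<Rightarrow> real" where "nu z = lam (pl z) p / mu z"
definition kp :: "'a \<Rightarrow> real" where "kp z = kap (pl z) / mu z"

lemma inverse_mu_le: "z \<in> V \<Longrightarrow> 1 / mu z \<le> 4 * R\<^sup>2"
  using mu_bounds[of z] by (simp add: divide_le_eq)

lemma Q_lower: "z \<in> V \<Longrightarrow> (norm z)\<^sup>2 \<le> 4 * R ^ 4 * Q z"
proof -
  assume z: "z \<in> V"
  have "(norm z)\<^sup>2 \<le> 4 * R\<^sup>2 * qf (pl z) z" using qf_lower[OF pl_plane[OF z] z_pl] .
  also have "\<dots> = 4 * R\<^sup>2 * (mu z * Q z)" using mu_bounds(3)[OF z] by (simp add: Q_def)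
  also have "\<dots> \<le> 4 * R\<^sup>2 * (R\<^sup>2 * Q z)"
    using mu_bounds[OF z] qf_nonneg[OF pl_plane[OF z] z_pl]
    by (intro mult_left_mono mult_right_mono) (auto simp: Q_def)
  also have "\<dots> = 4 * R ^ 4 * Q z" by (simp add: power4_eq_xxxx power2_eq_square)
  finally show ?thesis .
qed

lemma Q_nonneg: "z \<in> V \<Longrightarrow> 0 \<le> Q z"
  using qf_nonneg[OF pl_plane z_pl] mu_bounds(3) by (simp add: Q_def less_imp_le)

lemma Q_pos: "z \<in> V \<Longrightarrow> z \<noteq> 0 \<Longrightarrow> 0 < Q z"
  using Q_lower[of z] Q_nonneg[of z] by (cases "Q z = 0") auto

lemma Q_upper: "z \<in> V \<Longrightarrow> Q z \<le> 4 * R\<^sup>2 * (norm z)\<^sup>2"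
proof -
  assume z: "z \<in> V"
  have "Q z = (1 / mu z) * qf (pl z) z" by (simp add: Q_def)
  also have "\<dots> \<le> (4 * R\<^sup>2) * (norm z)\<^sup>2"
    using inverse_mu_le[OF z] pl_upper[OF z z_pl] qf_nonneg[OF pl_plane[OF z] z_pl]
    by (intro mult_mono) auto
  finally show ?thesis .
qed

lemma Q_0: "Q 0 = 0" and L_0: "L 0 = 0"
  using quadratic_form_0[OF qf_quadratic[OF pl_plane]] linear_0[OF lam_linear[OF pl_plane]] V
  by (auto simp: Q_def L_def subspace_0)

lemma Q_scale: "z \<in> V \<Longrightarrow> Q (t *\<^sub>R z) = t\<^sup>2 * Q z"
  by (cases "t = 0") (auto simp: Q_0, simp add: Q_def mu_def pl_scale quadratic_form_scale[OF qf_quadratic[OF pl_plane]])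

lemma L_scale: "z \<in> V \<Longrightarrow> L (t *\<^sub>R z) = t * L z"
  by (cases "t = 0") (auto simp: L_0, simp add: L_def mu_def pl_scale linear_scale[OF lam_linear[OF pl_plane]])

lemma L_minus: "z \<in> V \<Longrightarrow> L (- z) = - L z"
  using L_scale[of z "-1"] by auto

lemma mu_shift: "mu (z + t *\<^sub>R p) = mu z" and nu_shift: "nu (z + t *\<^sub>R p) = nu z"
  and kp_shift: "kp (z + t *\<^sub>R p) = kp z"
  by (simp_all add: mu_def nu_def kp_def pl_add)

text \<open>No error term occurs, since all points \<open>z + t *\<^sub>R p\<close> lie in the one
  plane \<open>pl z\<close>. The slope \<open>nu z\<close>, however, depends on
  \<open>z\<close>.\<close>

lemma L_shift: "z \<in> V \<Longrightarrow> L (z + t *\<^sub>R p) = L z + t * nu z"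
  by (simp add: L_def nu_def mu_shift pl_add linear_add[OF lam_linear[OF pl_plane]]
      linear_scale[OF lam_linear[OF pl_plane]] add_divide_distrib)

lemma Q_shift: "z \<in> V \<Longrightarrow> Q (z + t *\<^sub>R p) = Q z + t * (Q (z + p) - Q z - 1) + t\<^sup>2"
proof -
  assume z: "z \<in> V"
  have 1: "mu (z + p) = mu z" "pl (z + p) = pl z" using mu_shift[of z 1] pl_add[of z 1] by auto
  have "qf (pl z) (z + t *\<^sub>R p) =
     qf (pl z) z + t * (qf (pl z) (z + p) - qf (pl z) z - mu z) + t\<^sup>2 * mu z"
    using quadratic_formD[OF qf_quadratic[OF pl_plane[OF z]], of 1 z t p] by (simp add: mu_def)
  then show ?thesis using mu_bounds(3)[OF z]
    by (simp add: Q_def mu_shift pl_add 1 add_divide_distrib diff_divide_distrib right_diff_distrib)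
qed

section \<open>Chord ends, and the comparison of \<open>K\<close> with a single function\<close>

definition al :: "'a \<Rightarrow> real" where "al z = fst (SOME d. chord_ends K z (fst d) (snd d))"
definition be :: "'a \<Rightarrow> real" where "be z = snd (SOME d. chord_ends K z (fst d) (snd d))"

text \<open>At 0 every multiple lies in \<open>K\<close>, so no chord ends exist and
  \<open>al 0\<close>, \<open>be 0\<close> are unspecified. The ends are measured in multiples of
  \<open>z\<close>, not in length.\<close>

lemma chord: "z \<noteq> 0 \<Longrightarrow> chord_ends K z (al z) (be z)"
  unfolding al_def be_def using chord_ends_exist[OF compact_K zero_K, of z]
    someI_ex[of "\<lambda>d. chord_ends K z (fst d) (snd d)"] by auto

lemma al_be_nonneg: "z \<noteq> 0 \<Longrightarrow> 0 \<le> al z" "z \<noteq> 0 \<Longrightarrow> 0 \<le> be z"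
  using chord[of z] by (auto simp: chord_ends_def)

lemma al_be_le: "z \<noteq> 0 \<Longrightarrow> al z * norm z \<le> R" "z \<noteq> 0 \<Longrightarrow> be z * norm z \<le> R"
  using chord[of z] K_bound[of "al z *\<^sub>R z"] K_bound[of "(- be z) *\<^sub>R z"]
  by (auto simp: chord_ends_def)

lemma plane_chord:
  assumes "U \<in> planes" "z \<in> U" "z \<noteq> 0"
  shows "0 \<le> kap U - qf U z * (al z * be z)" "kap U - qf U z * (al z * be z) \<le> 4 * h\<^sup>2"
    "\<bar>lam U z - qf U z * (al z - be z)\<bar> \<le> (4 + 2 * qf U z) * h"
  using near_quadric_chord[OF planeD(1)[OF assms(1)] assms(2) planeD(2)[OF assms(1)] h chord[OF assms(3)]] .

text \<open>For an exact quadric \<open>al p\<close> and \<open>- be p\<close> are the roots of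
  \<open>t\<^sup>2 - lam0 * t - del\<close>, so \<open>del\<close> is k / q(p) and
  \<open>lam0\<close> is l(p) / q(p). Being defined by the chord alone, they serve as common
  reference values for all planes through \<open>p\<close>; a small \<open>del\<close> means that 0
  is near an end of the chord.\<close>

definition del :: real where "del = al p * be p"
definition lam0 :: real where "lam0 = al p - be p"

lemma p_nz: "p \<noteq> 0" using norm_p by auto

lemma kp_chord_aux:
  assumes z: "z \<in> V" and x: "x \<in> pl z" "x \<noteq> 0"
  shows "0 \<le> kp z - qf (pl z) x / mu z * (al x * be x)"
    "kp z - qf (pl z) x / mu z * (al x * be x) \<le> 16 * R\<^sup>2 * h\<^sup>2"
proof -
  note * = plane_chord[OF pl_plane[OF z] x]
  note m = mu_bounds(3)[OF z] inverse_mu_le[OF z]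
  have e: "kp z - qf (pl z) x / mu z * (al x * be x) = (1 / mu z) * (kap (pl z) - qf (pl z) x * (al x * be x))"
    using m by (simp add: kp_def field_simps)
  show "0 \<le> kp z - qf (pl z) x / mu z * (al x * be x)" unfolding e using * m by (intro mult_nonneg_nonneg) auto
  have "kp z - qf (pl z) x / mu z * (al x * be x) \<le> (4 * R\<^sup>2) * (4 * h\<^sup>2)"
    unfolding e using * m by (intro mult_mono) auto
  then show "kp z - qf (pl z) x / mu z * (al x * be x) \<le> 16 * R\<^sup>2 * h\<^sup>2" by simp
qed

lemma kp_del: "z \<in> V \<Longrightarrow> 0 \<le> kp z - del" "z \<in> V \<Longrightarrow> kp z - del \<le> 16 * R\<^sup>2 * h\<^sup>2"
  using kp_chord_aux[OF _ p_pl p_nz, of z] mu_bounds(3)[of z] by (auto simp: del_def mu_def)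

lemma kp_chord: assumes "z \<in> V" "z \<noteq> 0"
  shows "0 \<le> kp z - Q z * (al z * be z)" "kp z - Q z * (al z * be z) \<le> 16 * R\<^sup>2 * h\<^sup>2"
  using kp_chord_aux[OF assms(1) z_pl assms(2)] by (auto simp: Q_def)

lemma nu_lam0: assumes "z \<in> V" shows "\<bar>nu z - lam0\<bar> \<le> 18 * R\<^sup>2 * h"
proof -
  note * = plane_chord(3)[OF pl_plane[OF assms] p_pl p_nz]
  note m = mu_bounds(3)[OF assms] inverse_mu_le[OF assms]
  have "nu z - lam0 = (1 / mu z) * (lam (pl z) p - qf (pl z) p * (al p - be p))"
    using m by (simp add: nu_def lam0_def mu_def[symmetric] field_simps)
  then have "\<bar>nu z - lam0\<bar> = (1 / mu z) * \<bar>lam (pl z) p - qf (pl z) p * (al p - be p)\<bar>"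
    using m by (simp add: abs_mult)
  also have "\<dots> \<le> (1 / mu z) * ((4 + 2 * mu z) * h)"
    using * m by (intro mult_left_mono) (auto simp: mu_def)
  also have "\<dots> = (4 * (1 / mu z) + 2) * h" using m by (simp add: field_simps)
  also have "\<dots> \<le> (4 * (4 * R\<^sup>2) + 2 * R\<^sup>2) * h"
    using m h R_power_mono[of 0 2] by (intro mult_right_mono add_mono mult_left_mono) auto
  finally show ?thesis by simp
qed

lemma L_chord: assumes "z \<in> V" "norm z = 1" shows "\<bar>L z - Q z * (al z - be z)\<bar> \<le> 24 * R\<^sup>2 * h"
proof -
  have z: "z \<noteq> 0" using assms by auto
  note * = plane_chord(3)[OF pl_plane[OF assms(1)] z_pl z]
  note m = mu_bounds(3)[OF assms(1)] inverse_mu_le[OF assms(1)]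
  have "L z - Q z * (al z - be z) = (1 / mu z) * (lam (pl z) z - qf (pl z) z * (al z - be z))"
    using m by (simp add: L_def Q_def field_simps)
  then have "\<bar>L z - Q z * (al z - be z)\<bar> = (1 / mu z) * \<bar>lam (pl z) z - qf (pl z) z * (al z - be z)\<bar>"
    using m by (simp add: abs_mult)
  also have "\<dots> \<le> (4 * R\<^sup>2) * ((4 + 2 * 1) * h)"
    using * m h pl_upper[OF assms(1) z_pl] assms(2)
    by (intro mult_mono order_trans[OF *] mult_right_mono) auto
  finally show ?thesis by simp
qed

text \<open>\<open>near_quadric\<close> contains no direct bound on the linear part. It comes from
  the chord: for a unit vector both ends are at most \<open>R\<close>, and \<open>L z\<close> is
  close to \<open>Q z\<close> times their difference.\<close>

lemma L_bound: assumes "z \<in> V" shows "\<bar>L z\<bar> \<le> 5 * R ^ 3 * norm z"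
proof -
  have unit: "\<bar>L z\<bar> \<le> 5 * R ^ 3" if z: "z \<in> V" "norm z = 1" for z
  proof -
    have "z \<noteq> 0" using z by auto
    then have "\<bar>al z - be z\<bar> \<le> R" using al_be_nonneg[of z] al_be_le[of z] z by auto
    then have "\<bar>Q z * (al z - be z)\<bar> \<le> (4 * R\<^sup>2) * R"
      using Q_upper[OF z(1)] Q_nonneg[OF z(1)] z(2) unfolding abs_mult by (intro mult_mono) auto
    then have "\<bar>Q z * (al z - be z)\<bar> \<le> 4 * R ^ 3" by (simp add: power3_eq_cube power2_eq_square)
    moreover have "24 * R\<^sup>2 * h \<le> 24 * R\<^sup>2 * 1" using h_le_1 by (intro mult_left_mono) auto
    moreover have "24 * R\<^sup>2 \<le> R ^ 3" using absorb[of 24 1 2] by simp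
    ultimately show ?thesis using L_chord[OF z] by linarith
  qed
  show ?thesis
  proof (cases "z = 0")
    case False
    have "L ((1 / norm z) *\<^sub>R z) = L z / norm z" using L_scale[OF assms, of "1 / norm z"] by simp
    moreover have "\<bar>L ((1 / norm z) *\<^sub>R z)\<bar> \<le> 5 * R ^ 3"
      using False assms V by (intro unit) (auto simp: subspace_scale)
    ultimately show ?thesis using False by (simp add: abs_divide divide_le_eq)
  qed (simp add: L_0)
qed

lemma value_nonneg: assumes "z \<in> K" shows "0 \<le> kp z + L z - Q z"
proof -
  have z: "z \<in> V" using assms KV by auto
  have "kp z + L z - Q z = (1 / mu z) * (kap (pl z) + lam (pl z) z - qf (pl z) z)"
    by (simp add: kp_def L_def Q_def diff_divide_distrib add_divide_distrib)
  then show ?thesis using mu_bounds(3)[OF z] section_nonneg[OF pl_plane[OF z] z_pl assms] by simp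
qed

lemma value_mem: assumes z: "z \<in> V" and b: "16 * R\<^sup>2 * h\<^sup>2 \<le> kp z + L z - Q z" shows "z \<in> K"
proof (rule section_mem[OF pl_plane[OF z] z_pl])
  have e: "kap (pl z) + lam (pl z) z - qf (pl z) z = mu z * (kp z + L z - Q z)"
    using mu_bounds(3)[OF z] by (simp add: kp_def L_def Q_def algebra_simps)
  have "4 * h\<^sup>2 * 1 \<le> 4 * h\<^sup>2 * (4 * R\<^sup>2 * mu z)" using mu_bounds(1)[OF z] by (intro mult_left_mono) auto
  also have "\<dots> = mu z * (16 * R\<^sup>2 * h\<^sup>2)" by simp
  also have "\<dots> \<le> mu z * (kp z + L z - Q z)" using b mu_bounds(3)[OF z] by (intro mult_left_mono) auto
  finally show "4 * h\<^sup>2 \<le> kap (pl z) + lam (pl z) z - qf (pl z) z" unfolding e by simp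
qed

text \<open>Membership in \<open>K\<close> is thereby governed, up to O(h^2), by one function on the
  whole space. What is missing is that \<open>L\<close> and \<open>Q\<close> are nearly a linear and
  a quadratic form; they are homogeneous, but come from different planes.\<close>

lemma sandwich_mem: "x \<in> K \<Longrightarrow> - (16 * R\<^sup>2 * h\<^sup>2) \<le> del + L x - Q x"
  and sandwich_not_mem: "x \<in> V \<Longrightarrow> x \<notin> K \<Longrightarrow> del + L x - Q x \<le> 16 * R\<^sup>2 * h\<^sup>2"
  using value_nonneg[of x] kp_del[of x] value_mem[of x] KV by force+

section \<open>The scale of an arbitrary plane relative to \<open>Q\<close>\<close>

definition phi :: "'a set \<Rightarrow> 'a \<Rightarrow> real" where "phi U z = qf U z / Q z"

lemma plane_V: "U \<in> planes \<Longrightarrow> z \<in> U \<Longrightarrow> z \<in> V"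
  using planeD(3) by blast

text \<open>This includes \<open>z = 0\<close>, where \<open>phi U 0 = 0\<close> by division by
  zero.\<close>

lemma qf_phi: "U \<in> planes \<Longrightarrow> z \<in> U \<Longrightarrow> qf U z = phi U z * Q z"
  using Q_pos[OF plane_V, of U z] quadratic_form_0[OF qf_quadratic, of U] by (cases "z = 0") (auto simp: phi_def Q_0)

lemma phi_scale: "U \<in> planes \<Longrightarrow> z \<in> U \<Longrightarrow> t \<noteq> 0 \<Longrightarrow> phi U (t *\<^sub>R z) = phi U z"
  by (simp add: phi_def Q_scale[OF plane_V] quadratic_form_scale[OF qf_quadratic])

text \<open>The semi-axis bound holds in every plane and bounds \<open>qf U\<close> below, while
  \<open>Q\<close> is bounded above because it stems from planes through \<open>p\<close>. No
  general upper bound on \<open>phi\<close> is available.\<close>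

lemma phi_lower: assumes "U \<in> planes" "z \<in> U" "z \<noteq> 0" shows "1 \<le> 16 * R ^ 4 * phi U z"
proof -
  have z: "z \<in> V" using plane_V assms by blast
  have "4 * R\<^sup>2 * (norm z)\<^sup>2 \<le> 4 * R\<^sup>2 * (4 * R\<^sup>2 * qf U z)" using qf_lower[OF assms(1,2)]
    by (intro mult_left_mono) auto
  then have "Q z \<le> 16 * R ^ 4 * qf U z"
    using Q_upper[OF z] by (simp add: power4_eq_xxxx power2_eq_square)
  then show ?thesis using Q_pos[OF z assms(3)] by (simp add: phi_def le_divide_eq)
qed

lemma phi_pos: "U \<in> planes \<Longrightarrow> z \<in> U \<Longrightarrow> z \<noteq> 0 \<Longrightarrow> 0 < phi U z"
  using phi_lower[of U z] R_pos by (smt (verit) mult_nonneg_nonpos zero_less_power)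

lemma phi_nonneg: "U \<in> planes \<Longrightarrow> z \<in> U \<Longrightarrow> 0 \<le> phi U z"
  using qf_nonneg[of U z] Q_nonneg[OF plane_V] by (simp add: phi_def)

text \<open>Both \<open>lam U z\<close> and \<open>L z\<close> are read off the same chord: each is
  close to the respective quadratic value times \<open>al z - be z\<close>. The additive error is
  turned into a multiple of \<open>phi U z\<close> with the help of
  \<open>phi_lower\<close>.\<close>

lemma lam_phi: assumes "U \<in> planes" "z \<in> U"
  shows "\<bar>lam U z - phi U z * L z\<bar> \<le> 100 * R ^ 4 * phi U z * h * norm z"
proof -
  have unit: "\<bar>lam U z - phi U z * L z\<bar> \<le> 100 * R ^ 4 * phi U z * h" if zU: "z \<in> U" "norm z = 1" for z
  proof -
    have z: "z \<in> V" "z \<noteq> 0" using zU assms plane_V by auto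
    define f where "f = phi U z"
    define D where "D = al z - be z"
    have q: "qf U z = f * Q z" using qf_phi[OF assms(1) zU(1)] by (simp add: f_def)
    have f: "0 < f" "1 \<le> 16 * R ^ 4 * f" using phi_pos phi_lower assms zU z by (auto simp: f_def)
    have "f * \<bar>L z - Q z * D\<bar> \<le> f * (24 * R\<^sup>2 * h)"
      using L_chord[OF z(1) zU(2)] f by (intro mult_left_mono) (auto simp: D_def)
    moreover have "f * L z - f * Q z * D = f * (L z - Q z * D)" by (simp add: algebra_simps)
    ultimately have "\<bar>f * L z - f * Q z * D\<bar> \<le> 24 * R\<^sup>2 * f * h"
      using f(1) by (simp add: abs_mult mult_ac)
    moreover have "\<bar>lam U z - f * Q z * D\<bar> \<le> (4 + 2 * (f * Q z)) * h"
      using plane_chord(3)[OF assms(1) zU(1) z(2)] by (simp add: q D_def)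
    moreover have "(4 + 2 * (f * Q z)) * h \<le> (4 * (16 * R ^ 4 * f) + 2 * (f * (4 * R\<^sup>2))) * h"
      using f Q_upper[OF z(1)] zU h by (intro mult_right_mono add_mono mult_left_mono) (auto simp: mult_ac)
    moreover have "(4 * (16 * R ^ 4 * f) + 2 * (f * (4 * R\<^sup>2))) * h + 24 * R\<^sup>2 * f * h \<le> 100 * R ^ 4 * f * h"
    proof -
      have "32 * R\<^sup>2 * (f * h) \<le> 36 * R ^ 4 * (f * h)"
        using R_power_mono[of 2 4] f h by (intro mult_right_mono mult_mono) auto
      then show ?thesis by (simp add: algebra_simps)
    qed
    ultimately show ?thesis unfolding f_def[symmetric] by linarith
  qed
  show ?thesis
  proof (cases "z = 0")
    case False
    define u where "u = (1 / norm z) *\<^sub>R z"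
    have u: "u \<in> U" "norm u = 1" "u \<in> V" using False assms planeD(2) plane_V
      by (auto simp: u_def subspace_scale)
    have z: "z = norm z *\<^sub>R u" using False by (simp add: u_def)
    have "phi U z = phi U u" using phi_scale[OF assms(1) u(1), of "norm z"] False z by simp
    moreover have "lam U z = norm z * lam U u"
      using linear_scale[OF lam_linear[OF assms(1)], of "norm z" u] z by simp
    moreover have "L z = norm z * L u" using L_scale[OF u(3), of "norm z"] z by simp
    ultimately have "lam U z - phi U z * L z = norm z * (lam U u - phi U u * L u)"
      by (simp add: algebra_simps)
    then have "\<bar>lam U z - phi U z * L z\<bar> = norm z * \<bar>lam U u - phi U u * L u\<bar>"
      by (simp add: abs_mult)
    also have "\<dots> \<le> norm z * (100 * R ^ 4 * phi U u * h)" using unit[OF u(1,2)] by (intro mult_left_mono) auto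
    finally show ?thesis using \<open>phi U z = phi U u\<close> by (simp add: algebra_simps)
  qed (simp add: L_0 linear_0[OF lam_linear[OF assms(1)]])
qed

text \<open>As in \<open>lam_phi\<close>, with the product of the chord ends in place of their
  difference. The left constant does not depend on \<open>z\<close>, so \<open>phi U\<close> is
  nearly constant on the plane as soon as \<open>del\<close> is not too small.\<close>

lemma kap_phi: assumes "U \<in> planes" "z \<in> U" "z \<noteq> 0"
  shows "\<bar>kap U - phi U z * del\<bar> \<le> 80 * R ^ 4 * phi U z * h\<^sup>2"
proof -
  have z: "z \<in> V" using assms plane_V by auto
  define f where "f = phi U z"
  define D where "D = al z * be z"
  have f: "0 < f" "1 \<le> 16 * R ^ 4 * f" using phi_pos phi_lower assms by (auto simp: f_def)
  have q: "qf U z = f * Q z" using qf_phi[OF assms(1,2)] by (simp add: f_def)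
  have "\<bar>del - Q z * D\<bar> \<le> 16 * R\<^sup>2 * h\<^sup>2"
    using kp_del[OF z] kp_chord[OF z assms(3)] by (simp add: D_def)
  then have "f * \<bar>del - Q z * D\<bar> \<le> f * (16 * R\<^sup>2 * h\<^sup>2)" using f by (intro mult_left_mono) auto
  moreover have "f * del - f * Q z * D = f * (del - Q z * D)" by (simp add: algebra_simps)
  ultimately have "\<bar>f * del - f * Q z * D\<bar> \<le> 16 * R\<^sup>2 * f * h\<^sup>2"
    using f(1) by (simp add: abs_mult mult_ac)
  moreover have "\<bar>kap U - f * Q z * D\<bar> \<le> 4 * h\<^sup>2"
    using plane_chord(1,2)[OF assms] by (simp add: q D_def)
  moreover have "4 * h\<^sup>2 * 1 \<le> 4 * h\<^sup>2 * (16 * R ^ 4 * f)" using f by (intro mult_left_mono) auto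
  moreover have "R\<^sup>2 * (f * h\<^sup>2) \<le> R ^ 4 * (f * h\<^sup>2)"
    using R_power_mono[of 2 4] f h by (intro mult_right_mono) auto
  ultimately show ?thesis unfolding f_def[symmetric] by (simp add: algebra_simps)
qed

subsection \<open>Near-quadratic and near-additive behaviour\<close>

text \<open>The defect of \<open>Q\<close> from the identity of \<open>quadratic_form\<close>. The
  case 1, -1 is the parallelogram law; general coefficients are needed later, when \<open>Q\<close>
  is expanded in coordinates.\<close>

definition Gam :: "real \<Rightarrow> real \<Rightarrow> 'a \<Rightarrow> 'a \<Rightarrow> real" where
  "Gam a b x y = Q (a *\<^sub>R x + b *\<^sub>R y) - a\<^sup>2 * Q x - a * b * (Q (x + y) - Q x - Q y) - b\<^sup>2 * Q y"

text \<open>\<open>qf U\<close> satisfies the quadratic identity exactly, so the defect of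
  \<open>f * Q\<close> is that of the difference. Only the four points occurring in
  \<open>Gam\<close> have to share the scale \<open>f\<close>, which leaves room to choose
  them.\<close>

lemma Gam_plane:
  assumes U: "U \<in> planes" and xy: "x \<in> U" "y \<in> U" and f: "1 \<le> 16 * R ^ 4 * f" and ab: "\<bar>a\<bar> \<le> 1" "\<bar>b\<bar> \<le> 1"
    and d: "\<bar>qf U x - f * Q x\<bar> \<le> t" "\<bar>qf U y - f * Q y\<bar> \<le> t" "\<bar>qf U (x + y) - f * Q (x + y)\<bar> \<le> t"
      "\<bar>qf U (a *\<^sub>R x + b *\<^sub>R y) - f * Q (a *\<^sub>R x + b *\<^sub>R y)\<bar> \<le> t"
  shows "\<bar>Gam a b x y\<bar> \<le> R ^ 6 * t"
proof -
  have t: "0 \<le> t" using d by linarith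
  have f0: "0 < f" using f R_pos by (smt (verit) mult_nonneg_nonpos zero_less_power)
  define e where "e z = qf U z - f * Q z" for z
  have "f * Gam a b x y = - e (a *\<^sub>R x + b *\<^sub>R y) + a * a * e x + a * b * (e (x + y) - e x - e y) + b * b * e y"
    using quadratic_formD[OF qf_quadratic[OF U], of a x b y]
    by (simp add: Gam_def e_def power2_eq_square algebra_simps)
  moreover have "\<bar>a * a\<bar> \<le> 1" "\<bar>a * b\<bar> \<le> 1" "\<bar>b * b\<bar> \<le> 1" using mult_le_one[OF ab(1) _ ab(1)] mult_le_one[OF ab(1) _ ab(2)] mult_le_one[OF ab(2) _ ab(2)]
    by (simp_all add: abs_mult)
  then have "\<bar>a * a * e x\<bar> \<le> 1 * t" "\<bar>b * b * e y\<bar> \<le> 1 * t" "\<bar>a * b * (e (x + y) - e x - e y)\<bar> \<le> 1 * (3 * t)"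
    unfolding abs_mult[of "_ * _" "e _"] abs_mult[of "a * b"] using d by (intro mult_mono; auto simp: e_def)+
  ultimately have "\<bar>f * Gam a b x y\<bar> \<le> 6 * t" using d(4) unfolding e_def[symmetric] by linarith
  then have "f * \<bar>Gam a b x y\<bar> \<le> 6 * t" using f0 by (simp add: abs_mult)
  then have "16 * R ^ 4 * (f * \<bar>Gam a b x y\<bar>) \<le> 16 * R ^ 4 * (6 * t)" by (intro mult_left_mono) auto
  moreover have "1 * \<bar>Gam a b x y\<bar> \<le> (16 * R ^ 4 * f) * \<bar>Gam a b x y\<bar>" using f by (intro mult_right_mono) auto
  moreover have "96 * R ^ 4 * t \<le> R ^ 6 * t" using absorb[of 96 2 4] t by (intro mult_right_mono) auto
  ultimately show ?thesis by (simp add: mult_ac)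
qed

lemma h_square_absorb: "j \<le> 140 \<Longrightarrow> c * R ^ i \<le> R ^ j \<Longrightarrow> c * R ^ i * h\<^sup>2 \<le> 1"
proof -
  assume j: "j \<le> 140" and c: "c * R ^ i \<le> R ^ j"
  have "c * R ^ i * h\<^sup>2 \<le> R ^ j * h\<^sup>2" using c by (intro mult_right_mono) auto
  also have "\<dots> \<le> R ^ j * h" using h_square_le R_pos by (intro mult_left_mono) auto
  finally show ?thesis using h_small[OF j] by (simp add: mult.commute)
qed

text \<open>If \<open>0\<close> is deep inside \<open>K\<close>, the constant terms fix the scaling of the sections.\<close>

lemma deep_phi:
  assumes del: "1 / 2 \<le> del" and U: "U \<in> planes" and w: "w \<in> U" "w \<noteq> 0" and z: "z \<in> U"
  shows "\<bar>qf U z - phi U w * Q z\<bar> \<le> R ^ 9 * h * (norm z)\<^sup>2 \<and> \<bar>lam U z - phi U w * L z\<bar> \<le> R ^ 11 * h * norm z"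
proof -
  have small: "320 * R ^ 4 * h\<^sup>2 \<le> 1" using absorb[of 320 2 4] by (intro h_square_absorb[of 6]) auto
  \<comment> \<open>By \<open>kap_phi\<close>, \<open>kap U\<close> is at least
    \<open>phi U z * del\<close> minus a quarter of \<open>phi U z\<close>, hence at least a quarter
    of it; and \<open>kap U \<le> 1\<close>.\<close>
  have le4: "phi U z \<le> 4" if z: "z \<in> U" "z \<noteq> 0" for z
  proof -
    have "phi U z * (1 / 2) \<le> phi U z * del" using del phi_nonneg[OF U z(1)] by (intro mult_left_mono) auto
    moreover have "phi U z * (80 * R ^ 4 * h\<^sup>2) \<le> phi U z * (1 / 4)"
      using small phi_nonneg[OF U z(1)] by (intro mult_left_mono) auto
    moreover have "phi U z * del - kap U \<le> 80 * R ^ 4 * phi U z * h\<^sup>2" using kap_phi[OF U z] by linarith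
    moreover have "phi U z * (80 * R ^ 4 * h\<^sup>2) = 80 * R ^ 4 * phi U z * h\<^sup>2" by simp
    ultimately show ?thesis using kap_bounds[OF U] by linarith
  qed
  have kap: "\<bar>kap U - phi U z * del\<bar> \<le> 320 * R ^ 4 * h\<^sup>2" if z: "z \<in> U" "z \<noteq> 0" for z
  proof -
    have "80 * R ^ 4 * h\<^sup>2 * phi U z \<le> 80 * R ^ 4 * h\<^sup>2 * 4" using le4[OF z] R_pos by (intro mult_left_mono) auto
    then show ?thesis using kap_phi[OF U z] by (simp add: mult_ac)
  qed
  have zV: "z \<in> V" using plane_V U z by blast
  show ?thesis
  proof (cases "z = 0")
    case True
    then show ?thesis using quadratic_form_0[OF qf_quadratic[OF U]] linear_0[OF lam_linear[OF U]] by (simp add: Q_0 L_0)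
  next
    case False
    define e where "e = phi U z - phi U w"
    have "\<bar>e * del\<bar> \<le> 640 * R ^ 4 * h\<^sup>2" using kap[OF z False] kap[OF w] by (simp add: e_def left_diff_distrib)
    moreover have "\<bar>e\<bar> * (1 / 2) \<le> \<bar>e\<bar> * del" using del by (intro mult_left_mono) auto
    ultimately have "\<bar>e\<bar> \<le> 1280 * R ^ 4 * h\<^sup>2" using del by (simp add: abs_mult)
    also have "\<dots> \<le> 1280 * R ^ 4 * h" using h_square_le R_pos by (intro mult_left_mono) auto
    finally have e: "\<bar>e\<bar> \<le> 1280 * R ^ 4 * h" .
    have "qf U z - phi U w * Q z = e * Q z" by (simp add: qf_phi[OF U z] e_def left_diff_distrib)
    then have "\<bar>qf U z - phi U w * Q z\<bar> \<le> (1280 * R ^ 4 * h) * (4 * R\<^sup>2 * (norm z)\<^sup>2)"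
      unfolding \<open>_ = e * Q z\<close> abs_mult using e Q_upper[OF zV] Q_nonneg[OF zV] h R_pos by (intro mult_mono) auto
    also have "\<dots> = (5120 * R ^ 6) * (h * (norm z)\<^sup>2)" by (simp add: power_add[symmetric])
    also have "\<dots> \<le> R ^ 9 * (h * (norm z)\<^sup>2)" using absorb[of 5120 3 6] h by (intro mult_right_mono) auto
    finally have 1: "\<bar>qf U z - phi U w * Q z\<bar> \<le> R ^ 9 * h * (norm z)\<^sup>2" by (simp add: mult_ac)
    have "\<bar>e * L z\<bar> \<le> (1280 * R ^ 4 * h) * (5 * R ^ 3 * norm z)"
      unfolding abs_mult using e L_bound[OF zV] h R_pos by (intro mult_mono) auto
    also have "\<dots> = (6400 * R ^ 7) * (h * norm z)" by (simp add: power_add[symmetric])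
    also have "\<dots> \<le> R ^ 10 * (h * norm z)" using absorb[of 6400 3 7] h by (intro mult_right_mono) auto
    finally have 2: "\<bar>e * L z\<bar> \<le> R ^ 10 * (h * norm z)" .
    have "100 * R ^ 4 * phi U z * h * norm z = phi U z * (100 * R ^ 4 * h * norm z)" by simp
    also have "\<dots> \<le> 4 * (100 * R ^ 4 * h * norm z)" using le4[OF z False] h R_pos by (intro mult_right_mono) auto
    also have "\<dots> = (400 * R ^ 4) * (h * norm z)" by simp
    also have "\<dots> \<le> R ^ 10 * (h * norm z)" using absorb[of 400 6 4] h by (intro mult_right_mono) auto
    finally have 3: "\<bar>lam U z - phi U z * L z\<bar> \<le> R ^ 10 * (h * norm z)" using lam_phi[OF U z] by linarith
    have "2 * R ^ 10 * (h * norm z) \<le> R ^ 11 * (h * norm z)" using absorb[of 2 1 10] h by (intro mult_right_mono) auto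
    then have "\<bar>lam U z - phi U w * L z\<bar> \<le> R ^ 11 * (h * norm z)"
      using 2 3 by (simp add: e_def algebra_simps)
    then show ?thesis using 1 by (simp add: mult_ac)
  qed
qed

lemma norm_combination_le: "\<bar>a\<bar> \<le> 1 \<Longrightarrow> \<bar>b\<bar> \<le> 1 \<Longrightarrow> norm (a *\<^sub>R x + b *\<^sub>R y) \<le> norm x + norm (y :: 'a)"
  by (rule order_trans[OF norm_triangle_ineq]) (auto intro!: add_mono mult_left_le_one_le)

lemma deep_Gam:
  assumes del: "1 / 2 \<le> del" and x: "x \<in> V" "norm x \<le> 1" and y: "y \<in> V" "norm y \<le> 1"
    and ab: "\<bar>a\<bar> \<le> 1" "\<bar>b\<bar> \<le> 1"
  shows "\<bar>Gam a b x y\<bar> \<le> R ^ 16 * h"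
proof (cases "x = 0 \<and> y = 0")
  case True
  then show ?thesis using h R_pos by (simp add: Gam_def Q_0)
next
  case False
  define U where "U = span {x, y}"
  have U: "U \<in> planes" "x \<in> U" "y \<in> U" using x y by (auto simp: U_def span_planes span_base)
  obtain w where w: "w \<in> U" "w \<noteq> 0" using False U by blast
  have e: "\<bar>qf U z - phi U w * Q z\<bar> \<le> 4 * R ^ 9 * h" if "z \<in> U" "norm z \<le> 2" for z
  proof -
    have "(norm z)\<^sup>2 \<le> 2\<^sup>2" using that by (intro power_mono) auto
    then have "R ^ 9 * h * (norm z)\<^sup>2 \<le> R ^ 9 * h * 4" using h R_pos by (intro mult_left_mono) auto
    then show ?thesis using deep_phi[OF del U(1) w that(1)] by simp
  qed
  have "\<bar>Gam a b x y\<bar> \<le> R ^ 6 * (4 * R ^ 9 * h)"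
  proof (rule Gam_plane[OF U phi_lower[OF U(1) w] ab])
    show "\<bar>qf U x - phi U w * Q x\<bar> \<le> 4 * R ^ 9 * h" "\<bar>qf U y - phi U w * Q y\<bar> \<le> 4 * R ^ 9 * h"
      using x y U by (auto intro!: e)
    show "\<bar>qf U (x + y) - phi U w * Q (x + y)\<bar> \<le> 4 * R ^ 9 * h"
      using x y U norm_triangle_ineq[of x y] planeD(2)[OF U(1)] by (intro e) (auto simp: subspace_add)
    show "\<bar>qf U (a *\<^sub>R x + b *\<^sub>R y) - phi U w * Q (a *\<^sub>R x + b *\<^sub>R y)\<bar> \<le> 4 * R ^ 9 * h"
      using x y U norm_combination_le[OF ab, of x y] planeD(2)[OF U(1)]
      by (intro e) (auto simp: subspace_add subspace_scale)
  qed
  also have "\<dots> = (4 * R ^ 15) * h" by (simp add: power_add[symmetric])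
  also have "\<dots> \<le> R ^ 16 * h" using absorb[of 4 1 15] h by (intro mult_right_mono) auto
  finally show ?thesis .
qed

text \<open>On the plane spanned by \<open>x\<close> and \<open>y\<close> the exactly linear
  \<open>lam U\<close> is within O(h) of a fixed multiple of \<open>L\<close>, and that multiple is
  bounded below by \<open>phi_lower\<close>.\<close>

lemma deep_L_additive:
  assumes del: "1 / 2 \<le> del" and x: "x \<in> V" "norm x \<le> 1" and y: "y \<in> V" "norm y \<le> 1"
  shows "\<bar>L (x + y) - L x - L y\<bar> \<le> R ^ 17 * h"
proof (cases "x = 0 \<and> y = 0")
  case True
  then show ?thesis using h R_pos by (simp add: L_0)
next
  case False
  define U where "U = span {x, y}"
  have U: "U \<in> planes" "x \<in> U" "y \<in> U" "x + y \<in> U" using x y by (auto simp: U_def span_planes span_base span_add)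
  obtain w where w: "w \<in> U" "w \<noteq> 0" using False U by blast
  define f where "f = phi U w"
  have f: "1 \<le> 16 * R ^ 4 * f" "0 < f" using phi_lower[OF U(1) w] phi_pos[OF U(1) w] by (auto simp: f_def)
  have e: "\<bar>lam U z - f * L z\<bar> \<le> R ^ 11 * h * n" if "z \<in> U" "norm z \<le> n" for z n
  proof -
    have "R ^ 11 * h * norm z \<le> R ^ 11 * h * n" using that(2) R_pos h by (intro mult_left_mono) auto
    then show ?thesis using deep_phi[OF del U(1) w that(1)] by (simp add: f_def)
  qed
  have "f * (L (x + y) - L x - L y) = - (lam U (x + y) - f * L (x + y)) + (lam U x - f * L x) + (lam U y - f * L y)"
    by (simp add: linear_add[OF lam_linear[OF U(1)]] algebra_simps)
  also have "\<bar>\<dots>\<bar> \<le> 4 * R ^ 11 * h"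
    using e[OF U(2) x(2)] e[OF U(3) y(2)] e[OF U(4), of 2] norm_triangle_ineq[of x y] x y by simp
  finally have "f * \<bar>L (x + y) - L x - L y\<bar> \<le> 4 * R ^ 11 * h" using f by (simp add: abs_mult)
  then have "16 * R ^ 4 * (f * \<bar>L (x + y) - L x - L y\<bar>) \<le> 16 * R ^ 4 * (4 * R ^ 11 * h)"
    by (intro mult_left_mono) auto
  moreover have "1 * \<bar>L (x + y) - L x - L y\<bar> \<le> (16 * R ^ 4 * f) * \<bar>L (x + y) - L x - L y\<bar>"
    using f by (intro mult_right_mono) auto
  moreover have "16 * R ^ 4 * (4 * R ^ 11 * h) = (64 * R ^ 15) * h" by (simp add: power_add[symmetric])
  moreover have "(64 * R ^ 15) * h \<le> R ^ 17 * h" using absorb[of 64 2 15] h by (intro mult_right_mono) auto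
  ultimately show ?thesis by (simp add: mult_ac)
qed

section \<open>Origin near the boundary: additivity of \<open>L\<close>\<close>

lemma lam0_bounds: assumes "del < 1 / 2" shows "1 / 2 \<le> lam0" "lam0 \<le> R"
proof -
  \<comment> \<open>The forward end is at least 1 because \<open>p\<close> is in \<open>K\<close>. A
    small product \<open>del\<close> then makes the backward end short, so that \<open>L\<close> is
    steep in direction \<open>p\<close>.\<close>
  have pK: "1 *\<^sub>R p \<in> K" using ball_K[of p] p_V by simp
  then have "1 \<le> al p" using chord[OF p_nz] unfolding chord_ends_def by (meson not_le)
  moreover have "0 \<le> be p" using al_be_nonneg p_nz by auto
  ultimately have "be p * 1 \<le> be p * al p" by (intro mult_left_mono) auto
  then have "be p \<le> 1 / 2" using assms by (simp add: del_def mult.commute)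
  then show "1 / 2 \<le> lam0" using \<open>1 \<le> al p\<close> by (simp add: lam0_def)
  have "al p * 1 \<le> al p * norm p" using norm_p al_be_nonneg(1)[OF p_nz] by (intro mult_left_mono) auto
  then show "lam0 \<le> R" using al_be_le(1)[OF p_nz] \<open>0 \<le> be p\<close> by (simp add: lam0_def)
qed

lemma nu_bounds: assumes "del < 1 / 2" "z \<in> V" shows "1 / 4 \<le> nu z" "nu z \<le> 2 * R"
proof -
  have "72 * R\<^sup>2 \<le> R ^ 4" using absorb[of 72 2 2] by simp
  then have "h * (72 * R\<^sup>2) \<le> h * R ^ 4" using h by (intro mult_left_mono) auto
  moreover have "18 * R\<^sup>2 * h = h * (72 * R\<^sup>2) / 4" by simp
  ultimately have "18 * R\<^sup>2 * h \<le> 1 / 4" using h_small[of 4] by linarith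
  then have "\<bar>nu z - lam0\<bar> \<le> 1 / 4" using nu_lam0[OF assms(2)] by linarith
  then show "1 / 4 \<le> nu z" "nu z \<le> 2 * R" using lam0_bounds[OF assms(1)] R_ge_1 by linarith+
qed

text \<open>Since 160 is twice 80, the error in \<open>kap_phi\<close> is at most half of
  \<open>phi U z * del\<close>. So \<open>kap U\<close> lies between 1/2 and 3/2 of that product for
  every nonzero \<open>z\<close> in the plane, and two scales differ at most by the factor
  3.\<close>

lemma kap_comparable:
  assumes d: "160 * R ^ 4 * h\<^sup>2 \<le> del" and U: "U \<in> planes" and z: "z1 \<in> U" "z1 \<noteq> 0" "z2 \<in> U" "z2 \<noteq> 0"
  shows "phi U z1 \<le> 3 * phi U z2"
proof -
  have b: "phi U z * del / 2 \<le> kap U \<and> kap U \<le> 3 * (phi U z * del / 2)" if z: "z \<in> U" "z \<noteq> 0" for z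
  proof -
    have "phi U z * (160 * R ^ 4 * h\<^sup>2) \<le> phi U z * del" using d phi_nonneg[OF U z(1)] by (intro mult_left_mono) auto
    moreover have "phi U z * (160 * R ^ 4 * h\<^sup>2) = 2 * (80 * R ^ 4 * phi U z * h\<^sup>2)" by simp
    ultimately show ?thesis using kap_phi[OF U z] unfolding abs_le_iff by linarith
  qed
  have "0 < 160 * R ^ 4 * h\<^sup>2" using R_pos h by simp
  then have "0 < del" using d by linarith
  have "phi U z1 * del / 2 \<le> 3 * (phi U z2 * del / 2)" using b[OF z(1,2)] b[OF z(3,4)] by linarith
  then have "phi U z1 * del \<le> (3 * phi U z2) * del" by simp
  then show ?thesis using \<open>0 < del\<close> by (simp only: mult_le_cancel_right_pos)
qed

text \<open>When \<open>del\<close> is not tiny, the plane through them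
  (possibly almost tangent to \<open>K\<close>) sees \<open>0\<close> as a deep point, so its constant term bounds the distortion of
  scale. When \<open>del = O(h\<^sup>2)\<close>, convexity is used: at distance \<open>h\<close> from \<open>0\<close>, a shift of
  relative size \<open>O(h)\<close> in the direction of \<open>p\<close> moves both points into \<open>K\<close>, hence also their midpoint.\<close>

lemma near_zero_add_1:
  assumes d: "160 * R ^ 4 * h\<^sup>2 \<le> del"
    and u: "u1 \<in> V" "norm u1 \<le> 11 * R ^ 4" "\<bar>L u1\<bar> \<le> 180 * R ^ 5 * h"
      "u2 \<in> V" "norm u2 \<le> 11 * R ^ 4" "\<bar>L u2\<bar> \<le> 180 * R ^ 5 * h"
  shows "\<bar>L (u1 + u2)\<bar> \<le> R ^ 14 * h"
proof (cases "u1 + u2 = 0")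
  case True
  then show ?thesis using R_pos h by (simp add: L_0)
next
  case False
  define U where "U = span {u1, u2}"
  have U: "U \<in> planes" "u1 \<in> U" "u2 \<in> U" "u1 + u2 \<in> U"
    using u by (auto simp: U_def span_planes span_base span_add)
  define f where "f = phi U (u1 + u2)"
  have f: "0 < f" using phi_pos[OF U(1,4) False] by (simp add: f_def)
  have l: "\<bar>lam U u\<bar> \<le> 3 * f * (R ^ 11 * h)" if uU: "u \<in> U" "norm u \<le> 11 * R ^ 4" "\<bar>L u\<bar> \<le> 180 * R ^ 5 * h" for u
  proof (cases "u = 0")
    case True
    then show ?thesis using f R_pos h linear_0[OF lam_linear[OF U(1)]] by simp
  next
    case False
    have p: "0 \<le> phi U u" using phi_nonneg[OF U(1) uU(1)] .
    have "phi U u * \<bar>L u\<bar> \<le> phi U u * (180 * R ^ 5 * h)" using uU p by (intro mult_left_mono) auto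
    moreover have "100 * R ^ 4 * phi U u * h * norm u \<le> 100 * R ^ 4 * phi U u * h * (11 * R ^ 4)"
      using uU p R_pos h by (intro mult_left_mono) auto
    moreover have "\<bar>lam U u\<bar> \<le> \<bar>phi U u * L u\<bar> + 100 * R ^ 4 * phi U u * h * norm u"
      using lam_phi[OF U(1) uU(1)] by linarith
    moreover have "\<bar>phi U u * L u\<bar> = phi U u * \<bar>L u\<bar>" using p by (simp add: abs_mult)
    ultimately have "\<bar>lam U u\<bar> \<le> phi U u * (180 * R ^ 5 * h) + 100 * R ^ 4 * phi U u * h * (11 * R ^ 4)"
      by linarith
    also have "\<dots> = phi U u * ((180 * R ^ 5 + 1100 * R ^ 8) * h)" by (simp add: algebra_simps power_add[symmetric])
    also have "\<dots> \<le> phi U u * (R ^ 11 * h)"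
    proof (intro mult_left_mono mult_right_mono p)
      show "180 * R ^ 5 + 1100 * R ^ 8 \<le> R ^ 11"
        using R_power_mono[of 5 8] absorb[of 1280 3 8] by simp
    qed (use h in auto)
    also have "\<dots> \<le> (3 * f) * (R ^ 11 * h)"
      using kap_comparable[OF d U(1) uU(1) False U(4)] \<open>u1 + u2 \<noteq> 0\<close> R_pos h
      by (intro mult_right_mono) (auto simp: f_def)
    finally show ?thesis .
  qed
  \<comment> \<open>\<open>lam U\<close> is exactly additive. Because both summands are already O(h)
    relative to the scale, knowing the scale only up to a factor 3 does no harm.\<close>
  have "\<bar>lam U (u1 + u2)\<bar> \<le> 6 * f * (R ^ 11 * h)"
    using l[OF U(2) u(2,3)] l[OF U(3) u(5,6)] linear_add[OF lam_linear[OF U(1)], of u1 u2] by linarith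
  moreover have "\<bar>lam U (u1 + u2) - f * L (u1 + u2)\<bar> \<le> 100 * R ^ 4 * f * h * (22 * R ^ 4)"
    using norm_triangle_ineq[of u1 u2] u f R_pos h
    by (intro order_trans[OF lam_phi[OF U(1,4), folded f_def]] mult_left_mono) auto
  ultimately have "\<bar>f * L (u1 + u2)\<bar> \<le> f * ((6 * R ^ 11 + 2200 * R ^ 8) * h)"
    by (simp add: algebra_simps power_add[symmetric])
  then have "f * \<bar>L (u1 + u2)\<bar> \<le> f * ((6 * R ^ 11 + 2200 * R ^ 8) * h)" using f by (simp add: abs_mult)
  then have "\<bar>L (u1 + u2)\<bar> \<le> (6 * R ^ 11 + 2200 * R ^ 8) * h" using f by simp
  also have "\<dots> \<le> R ^ 14 * h"
    using R_power_mono[of 8 11] absorb[of 2206 3 11] h by (intro mult_right_mono) auto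
  finally show ?thesis .
qed

lemma near_zero_add_2:
  assumes del: "del < 1 / 2" and d: "del \<le> 160 * R ^ 4 * h\<^sup>2"
    and u: "u1 \<in> V" "norm u1 \<le> 11 * R ^ 4" "- (180 * R ^ 5 * h) \<le> L u1"
      "u2 \<in> V" "norm u2 \<le> 11 * R ^ 4" "- (180 * R ^ 5 * h) \<le> L u2"
  shows "- (R ^ 14 * h) \<le> L (u1 + u2)"
proof -
  \<comment> \<open>The shift by \<open>c * h\<close> along \<open>p\<close> raises \<open>L\<close>
    by at least \<open>600 * R ^ 10 * h\<close>, since the slope is at least 1/4. At distance of
    order \<open>h\<close> from 0 this outweighs the quadratic term
    \<open>576 * R ^ 10 * h\<^sup>2\<close>, the deficit of \<open>L u\<close>, and the
    slack.\<close>
  define c where "c = 2400 * R ^ 10"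
  have c0: "0 < c" using R_pos by (simp add: c_def)
  have "c \<le> R ^ 13" using absorb[of 2400 3 10] by (simp add: c_def)
  then have "h * c \<le> h * R ^ 13" using h by (intro mult_left_mono) auto
  then have ch: "c * h \<le> 1" using h_small[of 13] by (simp add: mult.commute)
  have inK: "h *\<^sub>R (u + (c * h) *\<^sub>R p) \<in> K"
    if u: "u \<in> V" "norm u \<le> 11 * R ^ 4" "- (180 * R ^ 5 * h) \<le> L u" for u
  proof -
    define z where "z = u + (c * h) *\<^sub>R p"
    have z: "z \<in> V" using u V p_V by (auto simp: z_def subspace_add subspace_scale)
    have "(c * h) * norm p \<le> 1 * R" using norm_p_le c0 h ch by (intro mult_mono) auto
    then have "norm z \<le> 11 * R ^ 4 + 1 * R"
      using u(2) c0 h unfolding z_def by (intro order_trans[OF norm_triangle_ineq] add_mono) auto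
    also have "\<dots> \<le> 12 * R ^ 4" using R_power_mono[of 1 4] by simp
    finally have "(norm z)\<^sup>2 \<le> (12 * R ^ 4)\<^sup>2" by (intro power_mono) auto
    then have "4 * R\<^sup>2 * (norm z)\<^sup>2 \<le> 4 * R\<^sup>2 * (12 * R ^ 4)\<^sup>2" by (intro mult_left_mono) auto
    also have "\<dots> = 576 * R ^ 10" by (simp add: power_mult_distrib power_add[symmetric] flip: power_mult)
    finally have Qz: "Q z \<le> 576 * R ^ 10" using Q_upper[OF z] by linarith
    have "(c * h) * (1 / 4) \<le> (c * h) * nu u" using nu_bounds[OF del u(1)] c0 h by (intro mult_left_mono) auto
    then have Lz: "600 * R ^ 10 * h - 180 * R ^ 5 * h \<le> L z"
    proof -
      have "L z = L u + (c * h) * nu u" using L_shift[OF u(1), of "c * h"] by (simp add: z_def)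
      moreover have "(c * h) * (1 / 4) = 600 * R ^ 10 * h" by (simp add: c_def)
      ultimately show ?thesis using u(3) \<open>(c * h) * (1 / 4) \<le> (c * h) * nu u\<close> by linarith
    qed
    have k0: "0 \<le> kp (h *\<^sub>R z)"
    proof -
      have hz: "h *\<^sub>R z \<in> V" using z V by (simp add: subspace_scale)
      show ?thesis unfolding kp_def using mu_bounds(3)[OF hz] kap_bounds[OF pl_plane[OF hz]] by simp
    qed
    have "h\<^sup>2 * (16 * R\<^sup>2) \<le> h\<^sup>2 * (24 * R ^ 10 - 180 * R ^ 5)"
    proof (intro mult_left_mono)
      have "R\<^sup>2 \<le> R ^ 5" "196 * R ^ 5 \<le> R ^ 10" using R_power_mono[of 2 5] absorb[of 196 5 5] by auto
      moreover have "0 \<le> R ^ 5" using R_pos by simp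
      ultimately show "16 * R\<^sup>2 \<le> 24 * R ^ 10 - 180 * R ^ 5" by linarith
    qed auto
    also have "\<dots> = h * (600 * R ^ 10 * h - 180 * R ^ 5 * h) - h\<^sup>2 * (576 * R ^ 10)"
      by (simp add: algebra_simps power2_eq_square)
    also have "\<dots> \<le> h * L z - h\<^sup>2 * Q z"
      using Lz Qz h by (intro diff_mono mult_left_mono) auto
    also have "\<dots> \<le> kp (h *\<^sub>R z) + L (h *\<^sub>R z) - Q (h *\<^sub>R z)"
      using k0 by (simp add: L_scale[OF z] Q_scale[OF z])
    finally show ?thesis unfolding z_def[symmetric] using z V
      by (intro value_mem) (auto simp: subspace_scale mult_ac)
  qed
  define v where "v = u1 + u2"
  \<comment> \<open>The midpoint of the two points just placed in \<open>K\<close>. As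
    \<open>kp w\<close> is O(h^2), nonnegativity at \<open>w\<close> becomes a lower bound of order
    \<open>h\<close> for \<open>L v\<close> after division by \<open>h / 2\<close>.\<close>
  define w where "w = (h / 2) *\<^sub>R (v + (2 * (c * h)) *\<^sub>R p)"
  have v: "v \<in> V" using u V by (simp add: v_def subspace_add)
  have v': "v + (2 * (c * h)) *\<^sub>R p \<in> V" using v V p_V by (simp add: subspace_add subspace_scale)
  have "w = (1 / 2) *\<^sub>R (h *\<^sub>R (u1 + (c * h) *\<^sub>R p)) + (1 / 2) *\<^sub>R (h *\<^sub>R (u2 + (c * h) *\<^sub>R p))"
    by (simp add: w_def v_def algebra_simps flip: scaleR_add_left)
  also have "\<dots> \<in> K" by (intro convexD[OF convex_K] inK u) auto
  finally have w: "w \<in> K" .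
  then have wV: "w \<in> V" using KV by auto
  have "R\<^sup>2 \<le> R ^ 4" using R_power_mono[of 2 4] by simp
  then have "16 * R\<^sup>2 * h\<^sup>2 \<le> 16 * R ^ 4 * h\<^sup>2" by (intro mult_right_mono) auto
  then have "kp w \<le> 176 * R ^ 4 * h\<^sup>2" using kp_del[OF wV] d by linarith
  moreover have "L w = h / 2 * (L v + 2 * (c * h) * nu v)"
    unfolding w_def by (simp add: L_scale[OF v'] L_shift[OF v])
  moreover have "2 * (c * h) * nu v \<le> 2 * (c * h) * (2 * R)" using nu_bounds[OF del v] c0 h by (intro mult_left_mono) auto
  then have "h / 2 * (L v + 2 * (c * h) * nu v) \<le> h / 2 * (L v + 2 * (c * h) * (2 * R))"
    using h by (intro mult_left_mono) auto
  ultimately have "0 \<le> 176 * R ^ 4 * h\<^sup>2 + h / 2 * (L v + 2 * (c * h) * (2 * R))"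
    using value_nonneg[OF w] Q_nonneg[OF wV] by linarith
  also have "\<dots> = h / 2 * ((352 * R ^ 4 + 9600 * R ^ 11) * h + L v)"
    using power_add[of R 1 10] by (simp add: c_def field_simps power2_eq_square)
  finally have "0 \<le> (352 * R ^ 4 + 9600 * R ^ 11) * h + L v"
    using h by (meson half_gt_zero linorder_not_le mult_pos_neg)
  moreover have "(352 * R ^ 4 + 9600 * R ^ 11) * h \<le> R ^ 14 * h"
    using R_power_mono[of 4 11] absorb[of 9952 3 11] h by (intro mult_right_mono) auto
  ultimately show ?thesis by (simp add: v_def)
qed

text \<open>Each argument is moved along \<open>p\<close> to a point \<open>u x\<close> where
  \<open>L\<close> is O(h), a nearly tangent direction. \<open>L\<close> changes exactly linearly
  along \<open>p\<close>, with a slope within O(h) of \<open>lam0\<close>; so it remains to show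
  that \<open>L\<close> is still O(h) at \<open>u x + u y\<close>.\<close>

lemma shallow_L_additive:
  assumes del: "del < 1 / 2" and x: "x \<in> V" "norm x \<le> 1" and y: "y \<in> V" "norm y \<le> 1"
  shows "\<bar>L (x + y) - L x - L y\<bar> \<le> R ^ 17 * h"
proof -
  define T where "T x = L x / lam0" for x
  define u where "u x = x - T x *\<^sub>R p" for x
  note l0 = lam0_bounds[OF del]
  have T: "\<bar>T x\<bar> \<le> 10 * R ^ 3" if "x \<in> V" "norm x \<le> 1" for x
  proof -
    have "R ^ 3 * norm x \<le> R ^ 3 * 1" using that R_pos by (intro mult_left_mono) auto
    then have "\<bar>L x\<bar> \<le> 5 * R ^ 3" using L_bound[OF that(1)] by simp
    also have "\<dots> \<le> 10 * R ^ 3 * lam0" using mult_left_mono[OF l0(1), of "10 * R ^ 3"] R_pos by simp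
    finally show ?thesis using l0 by (simp add: T_def abs_divide divide_le_eq)
  qed
  have u: "u x \<in> V" "norm (u x) \<le> 11 * R ^ 4" "\<bar>L (u x)\<bar> \<le> 180 * R ^ 5 * h" if "x \<in> V" "norm x \<le> 1" for x
  proof -
    show "u x \<in> V" using that V p_V by (simp add: u_def subspace_diff subspace_scale)
    have "norm (u x) \<le> 1 + 10 * R ^ 3 * R"
      unfolding u_def using that(2) T[OF that] norm_p_le R_pos
      by (intro order_trans[OF norm_triangle_ineq4] add_mono) (auto intro!: mult_mono)
    then show "norm (u x) \<le> 11 * R ^ 4" using R_power_mono[of 0 4] by (simp add: power_add[symmetric] power4_eq_xxxx power3_eq_cube)
    have "L (u x) = T x * (lam0 - nu x)"
      using L_shift[OF that(1), of "- T x"] l0 by (simp add: u_def T_def field_simps)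
    then have "\<bar>L (u x)\<bar> \<le> (10 * R ^ 3) * (18 * R\<^sup>2 * h)"
      unfolding \<open>L (u x) = _\<close> abs_mult using T[OF that] nu_lam0[OF that(1)] R_pos
      by (intro mult_mono) (auto simp: abs_minus_commute)
    then show "\<bar>L (u x)\<bar> \<le> 180 * R ^ 5 * h" by (simp add: power_add[symmetric])
  qed
  have main: "\<bar>L (u x + u y)\<bar> \<le> R ^ 14 * h"
  proof (cases "160 * R ^ 4 * h\<^sup>2 \<le> del")
    case True
    show ?thesis by (rule near_zero_add_1[OF True u[OF x] u[OF y]])
  next
    case False
    have m: "L (- z) = - L z" if "z \<in> V" for z using L_minus[OF that] .
    have ub: "\<bar>L (u x)\<bar> \<le> 180 * R ^ 5 * h" "\<bar>L (u y)\<bar> \<le> 180 * R ^ 5 * h" using u[OF x] u[OF y] by auto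
    have "- (R ^ 14 * h) \<le> L (u x + u y)"
      using False u[OF x] u[OF y] ub by (intro near_zero_add_2[OF del]) auto
    \<comment> \<open>Convexity yields lower bounds only. \<open>L\<close> is odd, so the lower
      bound at the negated points is the missing upper bound.\<close>
    moreover have "- (R ^ 14 * h) \<le> L (- u x + - u y)"
      using False u[OF x] u[OF y] ub V m by (intro near_zero_add_2[OF del]) (auto simp: subspace_neg)
    moreover have "L (- u x + - u y) = - L (u x + u y)"
      using m[of "u x + u y"] u[OF x] u[OF y] V by (simp add: subspace_add)
    ultimately show ?thesis by linarith
  qed
  define t where "t = T x + T y"
  have uV: "u x + u y \<in> V" using u[OF x] u[OF y] V by (simp add: subspace_add)
  have "x + y = (u x + u y) + t *\<^sub>R p" by (simp add: u_def t_def algebra_simps)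
  then have "L (x + y) = L (u x + u y) + t * nu (u x + u y)" using L_shift[OF uV, of t] by simp
  moreover have "t * lam0 = L x + L y" using l0 by (simp add: t_def T_def field_simps)
  ultimately have e: "L (x + y) - L x - L y = L (u x + u y) + t * (nu (u x + u y) - lam0)"
    by (simp add: algebra_simps)
  have "\<bar>t * (nu (u x + u y) - lam0)\<bar> \<le> (20 * R ^ 3) * (18 * R\<^sup>2 * h)"
    unfolding abs_mult using T[OF x] T[OF y] nu_lam0[OF uV] R_pos by (intro mult_mono) (auto simp: t_def)
  also have "\<dots> = (360 * R ^ 5) * h" by (simp add: power_add[symmetric])
  also have "\<dots> \<le> R ^ 14 * h" using absorb[of 360 9 5] h by (intro mult_right_mono) auto
  finally have "\<bar>L (x + y) - L x - L y\<bar> \<le> 2 * R ^ 14 * h" using main unfolding e by linarith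
  also have "\<dots> \<le> R ^ 17 * h" using absorb[of 2 3 14] h by (intro mult_right_mono) auto
  finally show ?thesis .
qed

lemma L_additive:
  assumes "x \<in> V" "norm x \<le> 1" "y \<in> V" "norm y \<le> 1"
  shows "\<bar>L (x + y) - L x - L y\<bar> \<le> R ^ 17 * h"
  using deep_L_additive[OF _ assms] shallow_L_additive[OF _ assms] by (cases "del < 1 / 2") auto

section \<open>Origin near the boundary: reading the scale of a plane off \<open>L\<close>\<close>

lemma power_merge: "R ^ i * (R ^ j * x) = R ^ (i + j) * x" for x :: real
  by (simp add: power_add)

lemma L_additive_scaled:
  assumes "x \<in> V" "norm x \<le> n" "y \<in> V" "norm y \<le> n" "0 < n"
  shows "\<bar>L (x + y) - L x - L y\<bar> \<le> R ^ 17 * h * n"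
proof -
  have xy: "(1 / n) *\<^sub>R x \<in> V" "(1 / n) *\<^sub>R y \<in> V" "x + y \<in> V" using assms V by (auto simp: subspace_scale subspace_add)
  have "\<bar>L ((1 / n) *\<^sub>R x + (1 / n) *\<^sub>R y) - L ((1 / n) *\<^sub>R x) - L ((1 / n) *\<^sub>R y)\<bar> \<le> R ^ 17 * h"
    using assms xy by (intro L_additive) auto
  moreover have "L ((1 / n) *\<^sub>R x + (1 / n) *\<^sub>R y) - L ((1 / n) *\<^sub>R x) - L ((1 / n) *\<^sub>R y) =
      (L (x + y) - L x - L y) / n"
    using L_scale[OF xy(3), of "1 / n"] L_scale[OF assms(1), of "1 / n"] L_scale[OF assms(3), of "1 / n"]
    by (simp add: scaleR_add_right diff_divide_distrib)
  ultimately show ?thesis using assms(5) by (simp add: abs_divide divide_le_eq)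
qed

text \<open>A direction \<open>z\<close> with \<open>L z \<ge> 1\<close> points well into \<open>K\<close>: the point \<open>s z - t p\<close> is still in \<open>K\<close>
  for suitable \<open>s\<close> and \<open>t\<close>, and the cone from it over the ball around \<open>p\<close> contains a ball around a multiple of \<open>z\<close>.\<close>

lemma qf_upper_transversal:
  assumes del: "del < 1 / 2" and U: "U \<in> planes" and z: "z \<in> U" "norm z \<le> n" "1 \<le> L z"
    and n: "1 \<le> n" "2048 * R ^ 4 * n\<^sup>2 * h\<^sup>2 \<le> 1" and x: "x \<in> U"
  shows "qf U x \<le> R ^ 10 * n ^ 4 * (norm x)\<^sup>2"
proof -
  have zV: "z \<in> V" using plane_V U z by blast
  \<comment> \<open>The sizes make the quadratic term at \<open>v\<close> at most
    \<open>s / 2\<close> and the loss from the backward shift at most \<open>s / 8\<close>, against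
    a gain of at least \<open>s\<close> from \<open>L z \<ge> 1\<close>; the remainder exceeds the
    slack.\<close>
  define s where "s = 1 / (32 * R\<^sup>2 * n\<^sup>2)"
  define t where "t = s / (16 * R)"
  have s0: "0 < s" using R_pos n by (simp add: s_def)
  have t0: "0 < t" using s0 R_pos by (simp add: t_def)
  have "1 * 1 \<le> R\<^sup>2 * n\<^sup>2" using R_ge_1 n(1) by (intro mult_mono) auto
  then have s1: "s \<le> 1 / 32" by (simp add: s_def field_simps)
  have "s / (16 * R) \<le> s / 1" using s0 R by (intro divide_left_mono) auto
  then have t1: "t \<le> 1" using s1 by (simp add: t_def)
  define v where "v = s *\<^sub>R z + (- t) *\<^sub>R p"
  have sz: "s *\<^sub>R z \<in> V" using zV V by (simp add: subspace_scale)
  have v: "v \<in> V" unfolding v_def by (rule subspace_add[OF V sz subspace_scale[OF V p_V]])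
  have "v \<in> K"
  proof (rule value_mem[OF v])
    have "norm v \<le> s * n + t * R"
      unfolding v_def using z(2) norm_p_le s0 t0
      by (intro order_trans[OF norm_triangle_ineq] add_mono) auto
    then have "(norm v)\<^sup>2 \<le> (s * n + t * R)\<^sup>2" by (intro power_mono) auto
    also have "t * R = s / 16" using R_pos by (simp add: t_def)
    also have "(s * n + s / 16)\<^sup>2 \<le> (s * n + s * n)\<^sup>2"
    proof (intro power_mono add_left_mono)
      have "s * 1 \<le> s * n" using s0 n(1) by (intro mult_left_mono) auto
      then show "s / 16 \<le> s * n" using s0 by simp
    qed (use s0 n(1) in auto)
    also have "\<dots> = 4 * s\<^sup>2 * n\<^sup>2" by (simp add: power2_eq_square algebra_simps)
    finally have "4 * R\<^sup>2 * (norm v)\<^sup>2 \<le> 4 * R\<^sup>2 * (4 * s\<^sup>2 * n\<^sup>2)" by (intro mult_left_mono) auto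
    also have "\<dots> = s / 2" using R_pos n by (simp add: s_def power2_eq_square)
    finally have Qv: "Q v \<le> s / 2" using Q_upper[OF v] by linarith
    have "t * nu (s *\<^sub>R z) \<le> t * (2 * R)" using nu_bounds[OF del sz] t0 by (intro mult_left_mono) auto
    also have "\<dots> = s / 8" using R_pos by (simp add: t_def)
    finally have "s / 8 \<ge> t * nu (s *\<^sub>R z)" .
    moreover have "s * 1 \<le> s * L z" using z(3) s0 by (intro mult_left_mono) auto
    ultimately have Lv: "L v \<ge> s - s / 8"
      using L_shift[OF sz, of "- t"] L_scale[OF zV, of s] by (simp add: v_def)
    have "0 \<le> kp v" unfolding kp_def using mu_bounds(3)[OF v] kap_bounds[OF pl_plane[OF v]] by simp
    moreover have "16 * R\<^sup>2 * h\<^sup>2 \<le> s / 4"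
    proof -
      have "16 * R\<^sup>2 * h\<^sup>2 * (128 * R\<^sup>2 * n\<^sup>2) = 2048 * R ^ 4 * n\<^sup>2 * h\<^sup>2"
        by (simp add: power4_eq_xxxx power2_eq_square)
      then have "16 * R\<^sup>2 * h\<^sup>2 * (128 * R\<^sup>2 * n\<^sup>2) \<le> 1" using n(2) by linarith
      moreover have "0 < 128 * R\<^sup>2 * n\<^sup>2" using R_pos n by simp
      ultimately have "16 * R\<^sup>2 * h\<^sup>2 \<le> 1 / (128 * R\<^sup>2 * n\<^sup>2)" by (simp only: pos_le_divide_eq)
      then show ?thesis by (simp add: s_def)
    qed
    ultimately show "16 * R\<^sup>2 * h\<^sup>2 \<le> kp v + L v - Q v" using Qv Lv s0 by linarith
  qed
  \<comment> \<open>The weights 1 and \<open>t\<close>, normalised, cancel the component along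
    \<open>p\<close> in the combination of \<open>v\<close> and \<open>p\<close>. The centre
    \<open>w\<close> thus lies in \<open>U\<close>, although \<open>p\<close> itself may
    not.\<close>
  define w where "w = (1 / (1 + t)) *\<^sub>R (s *\<^sub>R z)"
  have ball: "w + y \<in> K" if y: "y \<in> U" "norm y \<le> t / 2" for y
  proof -
    define y' where "y' = ((1 + t) / t) *\<^sub>R y"
    have "norm y' = (1 + t) / t * norm y" using t0 by (simp add: y'_def)
    also have "\<dots> \<le> (1 + t) / t * (t / 2)" using y t0 by (intro mult_left_mono) auto
    also have "\<dots> \<le> 1" using t0 t1 by simp
    finally have "p + y' \<in> K"
      using y plane_V[OF U] V p_V by (intro ball_K) (auto simp: y'_def subspace_add subspace_scale)
    then have "(1 / (1 + t)) *\<^sub>R v + (t / (1 + t)) *\<^sub>R (p + y') \<in> K"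
      using t0 \<open>v \<in> K\<close> by (intro convexD[OF convex_K]) (auto simp: add_divide_distrib[symmetric])
    moreover have "(1 / (1 + t)) *\<^sub>R v + (t / (1 + t)) *\<^sub>R (p + y') = w + y"
      using t0 by (simp add: v_def y'_def w_def scaleR_add_right scaleR_diff_right)
    ultimately show ?thesis by simp
  qed
  have wU: "w \<in> U" using z planeD(2)[OF U] by (simp add: w_def subspace_scale)
  have "qf U x \<le> (norm x)\<^sup>2 / (t / 2)\<^sup>2"
    by (rule near_quadric_upper[OF planeD(1,2)[OF U] wU _ ball x]) (use t0 in auto)
  also have "t / 2 = 1 / (1024 * R ^ 3 * n\<^sup>2)" by (simp add: t_def s_def power3_eq_cube power2_eq_square)
  also have "(norm x)\<^sup>2 / (1 / (1024 * R ^ 3 * n\<^sup>2))\<^sup>2 = (4 * 512\<^sup>2) * R ^ 6 * (n ^ 4 * (norm x)\<^sup>2)"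
    by (simp add: power_divide power_mult_distrib flip: power_mult)
  also have "\<dots> \<le> R ^ 10 * (n ^ 4 * (norm x)\<^sup>2)"
    using absorb[of "4 * 512\<^sup>2" 4 6] by (intro mult_right_mono) auto
  finally show ?thesis by (simp add: mult_ac)
qed

text \<open>The combination \<open>w = L z2 *\<^sub>R z1 - L z1 *\<^sub>R z2\<close> has
  \<open>L w\<close> = O(h) by approximate additivity, hence small \<open>lam U w\<close>. On the
  other hand, exact linearity of \<open>lam U\<close> makes it nearly \<open>L z1 * L z2\<close>
  times the difference of the two scales, and this product is at least 1.\<close>

lemma shallow_phi:
  assumes del: "del < 1 / 2" and U: "U \<in> planes"
    and z1: "z1 \<in> U" "norm z1 \<le> R ^ 7" "1 \<le> L z1" and z2: "z2 \<in> U" "norm z2 \<le> R ^ 7" "1 \<le> L z2"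
  shows "\<bar>phi U z1 - phi U z2\<bar> \<le> R ^ 80 * h"
proof -
  have V12: "z1 \<in> V" "z2 \<in> V" using plane_V[OF U] z1 z2 by auto
  \<comment> \<open>The vector \<open>z1\<close> certifies that the plane is transversal, and only
    such planes have a bounded scale. The exponent collects \<open>R ^ 10\<close>,
    \<open>(R ^ 7) ^ 4\<close> and \<open>R ^ 4\<close> from \<open>Q_lower\<close>, plus one for
    the factor 4.\<close>
  have phi: "phi U z \<le> R ^ 43" if z: "z \<in> U" for z
  proof (cases "z = 0")
    case True
    then show ?thesis using R_pos by (simp add: phi_def Q_0)
  next
    case False
    have zV: "z \<in> V" using plane_V[OF U] z by auto
    have "1 \<le> R ^ 7" using R_power_mono[of 0 7] by simp
    have "2048 * R ^ 18 * h\<^sup>2 \<le> 1" using absorb[of 2048 4 18] by (intro h_square_absorb[of 22]) auto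
    moreover have "R ^ 4 * (R ^ 7)\<^sup>2 = R ^ 18" by (simp flip: power_mult power_add)
    ultimately have "2048 * R ^ 4 * (R ^ 7)\<^sup>2 * h\<^sup>2 \<le> 1" by (simp only: mult.assoc[of 2048 "R ^ 4"])
    with \<open>1 \<le> R ^ 7\<close> have "qf U z \<le> R ^ 10 * (R ^ 7) ^ 4 * (norm z)\<^sup>2"
      using qf_upper_transversal[OF del U z1] z by blast
    also have "\<dots> \<le> R ^ 10 * (R ^ 7) ^ 4 * (4 * R ^ 4 * Q z)"
      using Q_lower[OF zV] R_pos by (intro mult_left_mono) auto
    also have "\<dots> = (4 * R ^ 42) * Q z" by (simp add: mult_ac power_merge flip: power_mult power_add)
    also have "\<dots> \<le> R ^ 43 * Q z" using absorb[of 4 1 42] Q_nonneg[OF zV] by (intro mult_right_mono) auto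
    finally show ?thesis using Q_pos[OF zV False] by (simp add: phi_def divide_le_eq)
  qed
  have L5: "\<bar>L z\<bar> \<le> 5 * R ^ 10" if "z \<in> V" "norm z \<le> R ^ 7" for z
    using order_trans[OF L_bound[OF that(1)] mult_left_mono[OF that(2), of "5 * R ^ 3"]] R_pos
    by (simp add: mult.assoc flip: power_add)
  define u1 where "u1 = L z2 *\<^sub>R z1"
  define u2 where "u2 = (- L z1) *\<^sub>R z2"
  define w where "w = u1 + u2"
  have uV: "u1 \<in> V" "u2 \<in> V" using V12 V by (auto simp: u1_def u2_def subspace_scale subspace_neg)
  have "\<bar>L z2\<bar> * norm z1 \<le> 5 * R ^ 10 * R ^ 7" "\<bar>L z1\<bar> * norm z2 \<le> 5 * R ^ 10 * R ^ 7"
    using L5[OF V12(1) z1(2)] L5[OF V12(2) z2(2)] z1 z2 R_pos by (intro mult_mono; auto)+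
  then have un: "norm u1 \<le> 5 * R ^ 17" "norm u2 \<le> 5 * R ^ 17"
    by (auto simp: u1_def u2_def mult_ac power_merge simp flip: power_add)
  have wU: "w \<in> U" using z1 z2 planeD(2)[OF U] unfolding w_def u1_def u2_def
    by (intro subspace_add subspace_scale) auto
  have wn: "norm w \<le> 10 * R ^ 17" using norm_triangle_ineq[of u1 u2] un by (simp add: w_def)
  have "L u1 + L u2 = 0" using L_scale[OF V12(1), of "L z2"] L_scale[OF V12(2), of "- L z1"]
    by (simp add: u1_def u2_def)
  then have "\<bar>L w\<bar> \<le> R ^ 17 * h * (5 * R ^ 17)"
    using L_additive_scaled[OF uV(1) un(1) uV(2) un(2)] R_pos by (simp add: w_def)
  then have Lw: "\<bar>L w\<bar> \<le> 5 * R ^ 34 * h" by (simp add: mult_ac power_merge flip: power_add)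
  have p0: "0 \<le> phi U w" using phi_nonneg[OF U wU] .
  have "\<bar>lam U w\<bar> \<le> \<bar>phi U w * L w\<bar> + 100 * R ^ 4 * phi U w * h * norm w"
    using lam_phi[OF U wU] by linarith
  also have "\<dots> = phi U w * (\<bar>L w\<bar> + 100 * R ^ 4 * h * norm w)"
    using p0 by (simp add: abs_mult algebra_simps)
  also have "\<dots> \<le> R ^ 43 * (5 * R ^ 34 * h + 100 * R ^ 4 * h * (10 * R ^ 17))"
    using phi[OF wU] p0 Lw wn h R_pos by (intro mult_mono add_mono) (auto intro!: mult_nonneg_nonneg add_nonneg_nonneg)
  also have "\<dots> = (5 * R ^ 77 + 1000 * R ^ 64) * h" by (simp add: algebra_simps power_merge flip: power_add)
  finally have lw: "\<bar>lam U w\<bar> \<le> (5 * R ^ 77 + 1000 * R ^ 64) * h" .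
  have lz: "\<bar>lam U z - phi U z * L z\<bar> \<le> 100 * R ^ 54 * h" if z: "z \<in> U" "norm z \<le> R ^ 7" for z
  proof -
    have "100 * R ^ 4 * phi U z * h * norm z \<le> 100 * R ^ 4 * R ^ 43 * h * R ^ 7"
      using z phi[OF z(1)] phi_nonneg[OF U z(1)] h R_pos by (intro mult_mono) auto
    then show ?thesis using lam_phi[OF U z(1)] by (simp add: mult_ac power_merge flip: power_add)
  qed
  define e1 where "e1 = lam U z1 - phi U z1 * L z1"
  define e2 where "e2 = lam U z2 - phi U z2 * L z2"
  define e where "e = phi U z1 - phi U z2"
  have "lam U w = L z2 * lam U z1 - L z1 * lam U z2"
    using linear_add[OF lam_linear[OF U], of u1 u2] linear_scale[OF lam_linear[OF U], of "L z2" z1]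
      linear_scale[OF lam_linear[OF U], of "- L z1" z2] by (simp add: w_def u1_def u2_def)
  then have "L z1 * L z2 * e = lam U w - L z2 * e1 + L z1 * e2"
    by (simp add: e_def e1_def e2_def algebra_simps)
  moreover have "\<bar>L z2 * e1\<bar> \<le> 5 * R ^ 10 * (100 * R ^ 54 * h)" "\<bar>L z1 * e2\<bar> \<le> 5 * R ^ 10 * (100 * R ^ 54 * h)"
    unfolding abs_mult using L5[OF V12(1) z1(2)] L5[OF V12(2) z2(2)] lz[OF z1(1,2)] lz[OF z2(1,2)] R_pos
    by (intro mult_mono; auto simp: e1_def e2_def)+
  ultimately have "\<bar>L z1 * L z2 * e\<bar> \<le> (5 * R ^ 77 + 1000 * R ^ 64) * h + 1000 * R ^ 64 * h"
    using lw by (simp add: mult_ac power_merge flip: power_add)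
  also have "\<dots> = (5 * R ^ 77 + 2000 * R ^ 64) * h" by (simp add: algebra_simps)
  also have "\<dots> \<le> R ^ 80 * h"
    using absorb[of 2005 3 77] R_power_mono[of 64 77] h by (intro mult_right_mono) auto
  finally have "\<bar>L z1 * L z2\<bar> * \<bar>e\<bar> \<le> R ^ 80 * h" by (simp add: abs_mult)
  moreover have "1 * 1 \<le> L z1 * L z2" using z1 z2 by (intro mult_mono) auto
  then have "1 * \<bar>e\<bar> \<le> \<bar>L z1 * L z2\<bar> * \<bar>e\<bar>" by (intro mult_right_mono) auto
  ultimately show ?thesis by (simp add: e_def)
qed

section \<open>Origin near the boundary: the quadratic defect of \<open>Q\<close>\<close>

lemma shallow_Gam_transversal:
  assumes del: "del < 1 / 2" and V: "x \<in> V" "y \<in> V" and ab: "\<bar>a\<bar> \<le> 1" "\<bar>b\<bar> \<le> 1"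
    and n: "\<And>z. z \<in> {x, y, x + y, a *\<^sub>R x + b *\<^sub>R y} \<Longrightarrow> norm z \<le> R ^ 7 \<and> 1 \<le> \<bar>L z\<bar>"
  shows "\<bar>Gam a b x y\<bar> \<le> R ^ 103 * h"
proof -
  define U where "U = span {x, y}"
  have U: "U \<in> planes" "x \<in> U" "y \<in> U" "x + y \<in> U" "a *\<^sub>R x + b *\<^sub>R y \<in> U"
    using V by (auto simp: U_def span_planes span_base span_add span_scale)
  \<comment> \<open>\<open>phi U\<close> is even and \<open>L\<close> is odd, so the sign of
    \<open>L z\<close> can be made positive without changing the scale.\<close>
  define up where "up z = (if 1 \<le> L z then z else - z)" for z
  have up: "up z \<in> U" "norm (up z) \<le> R ^ 7" "1 \<le> L (up z)" "phi U (up z) = phi U z"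
    if "z \<in> U" "norm z \<le> R ^ 7" "1 \<le> \<bar>L z\<bar>" for z
    using that planeD(2)[OF U(1)] L_minus[OF plane_V[OF U(1) that(1)]] phi_scale[OF U(1) that(1), of "-1"]
    by (auto simp: up_def subspace_neg)
  have nx: "norm x \<le> R ^ 7" "1 \<le> \<bar>L x\<bar>" using n[of x] by auto
  have xnz: "x \<noteq> 0" using nx L_0 by auto
  have e: "\<bar>qf U z - phi U x * Q z\<bar> \<le> R ^ 97 * h" if z: "z \<in> U" "norm z \<le> R ^ 7" "1 \<le> \<bar>L z\<bar>" for z
  proof -
    have zV: "z \<in> V" using plane_V[OF U(1)] z by auto
    have "\<bar>phi U z - phi U x\<bar> \<le> R ^ 80 * h"
      using shallow_phi[OF del U(1) up(1-3)[OF z] up(1-3)[OF U(2) nx]] up(4)[OF z] up(4)[OF U(2) nx] by simp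
    moreover have "Q z \<le> 4 * R\<^sup>2 * (R ^ 7)\<^sup>2"
      using z by (intro order_trans[OF Q_upper[OF zV]] mult_left_mono power_mono) auto
    ultimately have "\<bar>phi U z - phi U x\<bar> * Q z \<le> (R ^ 80 * h) * (4 * R\<^sup>2 * (R ^ 7)\<^sup>2)"
      using Q_nonneg[OF zV] R_pos h by (intro mult_mono) auto
    also have "\<dots> = (4 * R ^ 96) * h" by (simp add: mult_ac power_merge flip: power_mult power_add)
    also have "\<dots> \<le> R ^ 97 * h" using absorb[of 4 1 96] h by (intro mult_right_mono) auto
    finally have "\<bar>(phi U z - phi U x) * Q z\<bar> \<le> R ^ 97 * h" using Q_nonneg[OF zV] by (simp add: abs_mult)
    then show ?thesis by (simp add: qf_phi[OF U(1) z(1)] left_diff_distrib)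
  qed
  have "\<bar>Gam a b x y\<bar> \<le> R ^ 6 * (R ^ 97 * h)"
    using U n by (intro Gam_plane[OF U(1-3) phi_lower[OF U(1,2) xnz] ab] e) auto
  then show ?thesis by (simp add: mult_ac power_merge flip: power_add)
qed

text \<open>The terms quadratic in \<open>t\<close> and \<open>s\<close> cancel because the leading
  coefficient of \<open>Q\<close> along \<open>p\<close> is 1 on every line. What is left is linear
  in \<open>(t, s)\<close>, which allows extrapolation from far shifts.\<close>

lemma Gam_shift:
  assumes "x \<in> V" "y \<in> V"
  shows "Gam a b (x + t *\<^sub>R p) (y + s *\<^sub>R p) = Gam a b x y +
    ((a * t + b * s) * (Q (a *\<^sub>R x + b *\<^sub>R y + p) - Q (a *\<^sub>R x + b *\<^sub>R y) - 1) - a\<^sup>2 * t * (Q (x + p) - Q x - 1)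
     - a * b * ((t + s) * (Q (x + y + p) - Q (x + y) - 1) - t * (Q (x + p) - Q x - 1) - s * (Q (y + p) - Q y - 1))
     - b\<^sup>2 * s * (Q (y + p) - Q y - 1))"
proof -
  have V': "x + y \<in> V" "a *\<^sub>R x + b *\<^sub>R y \<in> V" using assms V by (auto simp: subspace_add subspace_scale)
  have e: "a *\<^sub>R (x + t *\<^sub>R p) + b *\<^sub>R (y + s *\<^sub>R p) = (a *\<^sub>R x + b *\<^sub>R y) + (a * t + b * s) *\<^sub>R p"
    "(x + t *\<^sub>R p) + (y + s *\<^sub>R p) = (x + y) + (t + s) *\<^sub>R p"
    by (simp_all add: algebra_simps)
  show ?thesis
    unfolding Gam_def e Q_shift[OF assms(1)] Q_shift[OF assms(2)] Q_shift[OF V'(1)] Q_shift[OF V'(2)]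
    by (simp add: power2_eq_square algebra_simps)
qed

text \<open>A shift of size \<open>R ^ 5\<close> along \<open>p\<close> changes \<open>L\<close> by
  at least \<open>R ^ 5 / 4\<close>, more than the original value of at most
  \<open>10 * R ^ 3\<close> can compensate. The upper limit 6 leaves room for doubling a shift of
  size up to \<open>3 * R ^ 5\<close>.\<close>

lemma far_point:
  assumes del: "del < 1 / 2" and z: "z \<in> V" "norm z \<le> 2" and t: "R ^ 5 \<le> \<bar>t\<bar>" "\<bar>t\<bar> \<le> 6 * R ^ 5"
  shows "norm (z + t *\<^sub>R p) \<le> R ^ 7 \<and> 1 \<le> \<bar>L (z + t *\<^sub>R p)\<bar>"
proof
  have "\<bar>t\<bar> * norm p \<le> 6 * R ^ 5 * R" using t norm_p_le R_pos by (intro mult_mono) auto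
  then have "norm (z + t *\<^sub>R p) \<le> 2 + 6 * R ^ 5 * R"
    using z by (intro order_trans[OF norm_triangle_ineq] add_mono) auto
  also have "\<dots> = 2 + 6 * R ^ 6" using power_add[of R 5 1] by simp
  also have "\<dots> \<le> R ^ 7" using absorb[of 8 1 6] R_power_mono[of 0 6] by simp
  finally show "norm (z + t *\<^sub>R p) \<le> R ^ 7" .
  have "R ^ 5 * (1 / 4) \<le> \<bar>t\<bar> * nu z" using t nu_bounds[OF del z(1)] by (intro mult_mono) auto
  also have "\<dots> = \<bar>t * nu z\<bar>" using nu_bounds[OF del z(1)] by (simp add: abs_mult)
  finally have "R ^ 5 / 4 \<le> \<bar>t * nu z\<bar>" by simp
  moreover have "\<bar>L z\<bar> \<le> 10 * R ^ 3"
    using order_trans[OF L_bound[OF z(1)] mult_left_mono[OF z(2), of "5 * R ^ 3"]] R_pos by simp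
  moreover have "44 * R ^ 3 \<le> R ^ 5" "1 \<le> R ^ 3" using absorb[of 44 2 3] R_power_mono[of 0 3] by auto
  ultimately show "1 \<le> \<bar>L (z + t *\<^sub>R p)\<bar>" using L_shift[OF z(1), of t] by linarith
qed

lemma shallow_Gam_direction:
  assumes del: "del < 1 / 2" and x: "x \<in> V" "norm x \<le> 1" and y: "y \<in> V" "norm y \<le> 1"
    and ab: "\<bar>a\<bar> \<le> 1" "\<bar>b\<bar> \<le> 1"
    and ts: "R ^ 5 \<le> t" "t \<le> 2 * R ^ 5" "R ^ 5 \<le> s" "s \<le> 2 * R ^ 5" "t + s \<le> 3 * R ^ 5" "R ^ 5 \<le> \<bar>a * t + b * s\<bar>"
  shows "\<bar>Gam a b x y\<bar> \<le> R ^ 104 * h"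
proof -
  have *: "\<bar>Gam a b (x + (k * t) *\<^sub>R p) (y + (k * s) *\<^sub>R p)\<bar> \<le> R ^ 103 * h" if k: "1 \<le> k" "k \<le> 2" for k
  proof (rule shallow_Gam_transversal[OF del _ _ ab])
    show "x + (k * t) *\<^sub>R p \<in> V" "y + (k * s) *\<^sub>R p \<in> V" using x y V p_V by (auto simp: subspace_add subspace_scale)
    have T: "0 < R ^ 5" using R_pos by simp
    have ge: "R ^ 5 \<le> k * c" if "R ^ 5 \<le> c" for c
      using mult_mono[of 1 k "R ^ 5" c] k that T by auto
    have le: "k * c \<le> 6 * R ^ 5" if "0 \<le> c" "c \<le> 3 * R ^ 5" for c
      using mult_mono[of k 2 c "3 * R ^ 5"] k that by auto
    have xy: "x + y \<in> V" "norm (x + y) \<le> 2" "a *\<^sub>R x + b *\<^sub>R y \<in> V" "norm (a *\<^sub>R x + b *\<^sub>R y) \<le> 2"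
      using x y V norm_triangle_ineq[of x y] norm_combination_le[OF ab, of x y] by (auto simp: subspace_add subspace_scale)
    have abts: "\<bar>a * t + b * s\<bar> \<le> 3 * R ^ 5"
    proof -
      have "\<bar>a * t\<bar> \<le> 1 * t" "\<bar>b * s\<bar> \<le> 1 * s" unfolding abs_mult using ab ts T by (intro mult_mono; auto)+
      then show ?thesis using ts by linarith
    qed
    have abs_k: "\<bar>k * c\<bar> = k * \<bar>c\<bar>" for c using k by (simp add: abs_mult)
    have far: "norm (z + (k * c) *\<^sub>R p) \<le> R ^ 7 \<and> 1 \<le> \<bar>L (z + (k * c) *\<^sub>R p)\<bar>"
      if "z \<in> V" "norm z \<le> 2" "R ^ 5 \<le> \<bar>c\<bar>" "\<bar>c\<bar> \<le> 3 * R ^ 5" for z c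
      using that T by (intro far_point[OF del]; (simp only: abs_k)?; (intro ge le)?) auto
    have e: "(x + (k * t) *\<^sub>R p) + (y + (k * s) *\<^sub>R p) = (x + y) + (k * (t + s)) *\<^sub>R p"
      "a *\<^sub>R (x + (k * t) *\<^sub>R p) + b *\<^sub>R (y + (k * s) *\<^sub>R p) = (a *\<^sub>R x + b *\<^sub>R y) + (k * (a * t + b * s)) *\<^sub>R p"
      by (simp_all add: algebra_simps)
    show "norm z \<le> R ^ 7 \<and> 1 \<le> \<bar>L z\<bar>"
      if "z \<in> {x + (k * t) *\<^sub>R p, y + (k * s) *\<^sub>R p, (x + (k * t) *\<^sub>R p) + (y + (k * s) *\<^sub>R p),
        a *\<^sub>R (x + (k * t) *\<^sub>R p) + b *\<^sub>R (y + (k * s) *\<^sub>R p)}" for z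
      using that unfolding e
      by (elim insertE emptyE; hypsubst; intro far) (use x y xy ts T abts in auto)
  qed
  \<comment> \<open>By \<open>Gam_shift\<close> the defect is affine in the multiple of
    \<open>(t, s)\<close>, so its value at multiple 0 is twice the value at 1 minus the value at
    2.\<close>
  have "Gam a b x y = 2 * Gam a b (x + (1 * t) *\<^sub>R p) (y + (1 * s) *\<^sub>R p) - Gam a b (x + (2 * t) *\<^sub>R p) (y + (2 * s) *\<^sub>R p)"
    unfolding Gam_shift[OF x(1) y(1)] by (simp add: algebra_simps)
  then have "\<bar>Gam a b x y\<bar> \<le> (3 * R ^ 103) * h" using *[of 1] *[of 2] by linarith
  also have "\<dots> \<le> R ^ 104 * h" using absorb[of 3 1 103] h by (intro mult_right_mono) auto
  finally show ?thesis .
qed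

text \<open>For shifts \<open>(2, 1)\<close> or \<open>(1, 2)\<close> times \<open>R ^ 5\<close> the
  combination \<open>a * t + b * s\<close> must not be small. If the larger of
  \<open>\<bar>a\<bar>\<close>, \<open>\<bar>b\<bar>\<close> equals 1, one of the two choices works;
  \<open>Gam\<close> is homogeneous of degree 2 in \<open>(a, b)\<close>, which reduces everything
  to that case.\<close>

lemma Gam_bound:
  assumes x: "x \<in> V" "norm x \<le> 1" and y: "y \<in> V" "norm y \<le> 1" and ab: "\<bar>a\<bar> \<le> 1" "\<bar>b\<bar> \<le> 1"
  shows "\<bar>Gam a b x y\<bar> \<le> R ^ 104 * h"
proof (cases "del < 1 / 2")
  case False
  then have "\<bar>Gam a b x y\<bar> \<le> R ^ 16 * h" using assms by (intro deep_Gam) auto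
  also have "\<dots> \<le> R ^ 104 * h" using R_power_mono[of 16 104] h by (intro mult_right_mono) auto
  finally show ?thesis .
next
  case del: True
  have T: "0 < R ^ 5" using R_pos by simp
  have max1: "\<bar>Gam a b x y\<bar> \<le> R ^ 104 * h" if m: "max \<bar>a\<bar> \<bar>b\<bar> = 1" for a b
  proof -
    have ab: "\<bar>a\<bar> \<le> 1" "\<bar>b\<bar> \<le> 1" using m by auto
    have "1 \<le> \<bar>2 * a + b\<bar> \<or> 1 \<le> \<bar>a + 2 * b\<bar>" using m by linarith
    then show ?thesis
    proof
      assume "1 \<le> \<bar>2 * a + b\<bar>"
      then have "1 * R ^ 5 \<le> \<bar>2 * a + b\<bar> * R ^ 5" using T by (intro mult_right_mono) auto
      also have "\<dots> = \<bar>(2 * a + b) * R ^ 5\<bar>" using T by (simp add: abs_mult)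
      also have "(2 * a + b) * R ^ 5 = a * (2 * R ^ 5) + b * R ^ 5" by (simp add: algebra_simps)
      finally show ?thesis using T by (intro shallow_Gam_direction[OF del x y ab, of "2 * R ^ 5" "R ^ 5"]) auto
    next
      assume "1 \<le> \<bar>a + 2 * b\<bar>"
      then have "1 * R ^ 5 \<le> \<bar>a + 2 * b\<bar> * R ^ 5" using T by (intro mult_right_mono) auto
      also have "\<dots> = \<bar>(a + 2 * b) * R ^ 5\<bar>" using T by (simp add: abs_mult)
      also have "(a + 2 * b) * R ^ 5 = a * R ^ 5 + b * (2 * R ^ 5)" by (simp add: algebra_simps)
      finally show ?thesis using T by (intro shallow_Gam_direction[OF del x y ab, of "R ^ 5" "2 * R ^ 5"]) auto
    qed
  qed
  define r where "r = max \<bar>a\<bar> \<bar>b\<bar>"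
  show ?thesis
  proof (cases "r = 0")
    case True
    then have "a = 0" "b = 0" by (auto simp: r_def max_def split: if_splits)
    then show ?thesis using R_pos h by (simp add: Gam_def Q_0)
  next
    case False
    then have r: "0 < r" "r \<le> 1" using ab by (auto simp: r_def)
    define a' b' where "a' = a / r" and "b' = b / r"
    have e: "a = r * a'" "b = r * b'" using r by (auto simp: a'_def b'_def)
    have "max \<bar>a'\<bar> \<bar>b'\<bar> = 1" using r by (auto simp: a'_def b'_def max_def r_def abs_divide divide_le_cancel)
    then have g: "\<bar>Gam a' b' x y\<bar> \<le> R ^ 104 * h" by (rule max1)
    have "a *\<^sub>R x + b *\<^sub>R y = r *\<^sub>R (a' *\<^sub>R x + b' *\<^sub>R y)" by (simp add: e algebra_simps)
    moreover have "a' *\<^sub>R x + b' *\<^sub>R y \<in> V" using x y V by (simp add: subspace_add subspace_scale)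
    ultimately have "Q (a *\<^sub>R x + b *\<^sub>R y) = r\<^sup>2 * Q (a' *\<^sub>R x + b' *\<^sub>R y)" by (simp add: Q_scale)
    then have "Gam a b x y = r\<^sup>2 * Gam a' b' x y" unfolding Gam_def by (simp add: e power2_eq_square algebra_simps)
    then have "\<bar>Gam a b x y\<bar> = r\<^sup>2 * \<bar>Gam a' b' x y\<bar>" by (simp add: abs_mult)
    also have "\<dots> \<le> 1 * \<bar>Gam a' b' x y\<bar>" using r by (intro mult_right_mono) (auto simp: power_le_one)
    finally show ?thesis using g by simp
  qed
qed

end

subsection \<open>Approximate forms in coordinates\<close>

abbreviation (input) coeff :: "(nat \<Rightarrow>\<^sub>0 real) \<Rightarrow> nat \<Rightarrow> real" where "coeff \<equiv> Poly_Mapping.lookup"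

abbreviation (input) unit_vec :: "nat \<Rightarrow> (nat \<Rightarrow>\<^sub>0 real)" where "unit_vec i \<equiv> Poly_Mapping.single i 1"

abbreviation (input) lincomb :: "nat \<Rightarrow> (nat \<Rightarrow> real) \<Rightarrow> (nat \<Rightarrow> 'a::real_vector) \<Rightarrow> 'a" where
  "lincomb n c b \<equiv> \<Sum>i<n. c i *\<^sub>R b i"

abbreviation (input) quad_sum :: "nat \<Rightarrow> (nat \<Rightarrow> nat \<Rightarrow> real) \<Rightarrow> (nat \<Rightarrow>\<^sub>0 real) \<Rightarrow> real" where
  "quad_sum n B x \<equiv> \<Sum>i<n. \<Sum>j<n. coeff x i * coeff x j * B i j"

abbreviation (input) sq_sum :: "nat \<Rightarrow> (nat \<Rightarrow> real) \<Rightarrow> real" where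
  "sq_sum n c \<equiv> \<Sum>i<n. (c i)\<^sup>2"

abbreviation (input) ball_dist :: "nat \<Rightarrow> (nat \<Rightarrow>\<^sub>0 real) set \<Rightarrow> real" where
  "ball_dist n K \<equiv> banach_mazur_dist (coord_space n) K (coord_space n) (euclidean_unit_ball n)"

lemma coeff_scaleR [simp]: "coeff (r *\<^sub>R x) i = r * coeff x i"
  by (simp add: lookup_scaleR_poly_mapping)

lemma coeff_sum_unit_vec: "coeff (lincomb k c unit_vec) j = (if j < k then c j else 0)"
  by (simp add: lookup_sum lookup_single when_def if_distrib cong: if_cong)

lemma unit_vec_coord_space: "i < n \<Longrightarrow> unit_vec i \<in> coord_space n"
  by (auto simp: mem_coord_space_iff lookup_single when_def)

lemma sum_unit_vec_coord_space: "k \<le> n \<Longrightarrow> (lincomb k c unit_vec) \<in> coord_space n"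
  by (auto simp: mem_coord_space_iff coeff_sum_unit_vec)

lemma coord_space_expand: "x \<in> coord_space n \<Longrightarrow> x = lincomb n (coeff x) unit_vec"
  by (rule poly_mapping_eqI) (auto simp: coeff_sum_unit_vec mem_coord_space_iff)

lemma norm_sum_unit_vec_le:
  assumes x: "x \<in> coord_space n" and k: "k \<le> n"
  shows "norm (lincomb k (coeff x) unit_vec) \<le> norm x"
  unfolding norm_coord_space[OF x] norm_coord_space[OF sum_unit_vec_coord_space[OF k]] coeff_sum_unit_vec
  by (rule sum_mono) auto

lemma abs_coeff_le_norm: "x \<in> coord_space n \<Longrightarrow> \<bar>coeff x i\<bar> \<le> norm x"
proof (cases "i < n")
  case True
  assume "x \<in> coord_space n"
  then show ?thesis using True by (auto simp: norm_coord_space intro!: member_le_sum[where f="\<lambda>i. \<bar>coeff x i\<bar>"])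
qed (auto simp: mem_coord_space_iff)

lemma norm_unit_vec: "norm (unit_vec i) = 1"
proof -
  have "unit_vec i \<in> coord_space (Suc i)" by (rule unit_vec_coord_space) simp
  then show ?thesis by (simp add: norm_coord_space lookup_single when_def)
qed

context
  fixes f :: "(nat \<Rightarrow>\<^sub>0 real) \<Rightarrow> real" and n :: nat and e :: real
  assumes add: "\<And>u v. u \<in> coord_space n \<Longrightarrow> norm u \<le> 1 \<Longrightarrow> v \<in> coord_space n \<Longrightarrow> norm v \<le> 1 \<Longrightarrow>
      \<bar>f (u + v) - f u - f v\<bar> \<le> e"
    and scale: "\<And>t u. u \<in> coord_space n \<Longrightarrow> f (t *\<^sub>R u) = t * f u"
begin

text \<open>Partial coordinate sums do not increase the \<open>l\<^sup>1\<close> norm, so every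
  single addition stays inside the unit ball and costs one \<open>e\<close>.\<close>

lemma approx_linear_unit:
  assumes x: "x \<in> coord_space n" "norm x \<le> 1" and k: "k \<le> n"
  shows "\<bar>f (lincomb k (coeff x) unit_vec) - (\<Sum>i<k. coeff x i * f (unit_vec i))\<bar> \<le> real k * e"
  using k
proof (induction k)
  case 0
  show ?case using scale[of 0 0] by (simp add: mem_coord_space_iff)
next
  case (Suc k)
  let ?y = "\<lambda>k. \<Sum>i<k. coeff x i *\<^sub>R unit_vec i"
  have u: "unit_vec k \<in> coord_space n" using Suc.prems by (auto intro: unit_vec_coord_space)
  have "\<bar>f (?y k + coeff x k *\<^sub>R unit_vec k) - f (?y k) - f (coeff x k *\<^sub>R unit_vec k)\<bar> \<le> e"
  proof (rule add)
    show "?y k \<in> coord_space n" using Suc.prems by (intro sum_unit_vec_coord_space) auto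
    show "norm (?y k) \<le> 1" using norm_sum_unit_vec_le[OF x(1), of k] x(2) Suc.prems by auto
    show "norm (coeff x k *\<^sub>R unit_vec k) \<le> 1"
      using abs_coeff_le_norm[OF x(1), of k] x(2) by (simp add: norm_unit_vec)
  qed (use u in \<open>auto intro!: subspace_scale[OF subspace_coord_space]\<close>)
  then show ?case using Suc by (simp add: scale[OF u] algebra_simps)
qed

lemma approx_linear:
  assumes x: "x \<in> coord_space n"
  shows "\<bar>f x - (\<Sum>i<n. coeff x i * f (unit_vec i))\<bar> \<le> real n * e * norm x"
proof (cases "x = 0")
  case True
  then show ?thesis using scale[of 0 0] by (simp add: mem_coord_space_iff)
next
  case False
  define u where "u = (1 / norm x) *\<^sub>R x"
  have u: "u \<in> coord_space n" "norm u = 1" and xu: "x = norm x *\<^sub>R u"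
    using False x by (auto simp: u_def subspace_scale[OF subspace_coord_space])
  have "f x - (\<Sum>i<n. coeff x i * f (unit_vec i)) = norm x * (f u - (\<Sum>i<n. coeff u i * f (unit_vec i)))"
    using scale[OF u(1), of "norm x"] False by (simp add: u_def right_diff_distrib sum_distrib_left)
  moreover have "\<bar>f u - (\<Sum>i<n. coeff u i * f (unit_vec i))\<bar> \<le> real n * e"
    using approx_linear_unit[OF u(1) _ order_refl] u(2) coord_space_expand[OF u(1)] by simp
  then have "norm x * \<bar>f u - (\<Sum>i<n. coeff u i * f (unit_vec i))\<bar> \<le> norm x * (real n * e)"
    by (intro mult_left_mono) auto
  ultimately show ?thesis by (simp add: abs_mult mult_ac)
qed

end

section \<open>Approximately quadratic functions\<close>

locale approx_quadratic =
  fixes n :: nat and Q :: "(nat \<Rightarrow>\<^sub>0 real) \<Rightarrow> real" and e :: real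
  assumes scale: "\<And>t u. u \<in> coord_space n \<Longrightarrow> Q (t *\<^sub>R u) = t\<^sup>2 * Q u"
    and defect: "\<And>a b u v. \<bar>a\<bar> \<le> 1 \<Longrightarrow> \<bar>b\<bar> \<le> 1 \<Longrightarrow> u \<in> coord_space n \<Longrightarrow> norm u \<le> 1 \<Longrightarrow>
        v \<in> coord_space n \<Longrightarrow> norm v \<le> 1 \<Longrightarrow>
        \<bar>Q (a *\<^sub>R u + b *\<^sub>R v) - a\<^sup>2 * Q u - a * b * (Q (u + v) - Q u - Q v) - b\<^sup>2 * Q v\<bar> \<le> e"
begin

lemma Q0: "Q 0 = 0"
  using scale[of 0 0] by (simp add: mem_coord_space_iff)

definition C :: "(nat \<Rightarrow>\<^sub>0 real) \<Rightarrow> (nat \<Rightarrow>\<^sub>0 real) \<Rightarrow> real" where "C u v = Q (u + v) - Q u - Q v"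

lemma parallelogram_1:
  assumes "u \<in> coord_space n" "norm u \<le> 1" "v \<in> coord_space n" "norm v \<le> 1"
  shows "\<bar>Q (u + v) + Q (u - v) - 2 * Q u - 2 * Q v\<bar> \<le> e"
  using defect[of 1 "-1" u v] assms by (simp add: algebra_simps)

lemma parallelogram_2:
  assumes "u \<in> coord_space n" "norm u \<le> 2" "v \<in> coord_space n" "norm v \<le> 2"
  shows "\<bar>Q (u + v) + Q (u - v) - 2 * Q u - 2 * Q v\<bar> \<le> 4 * e"
proof -
  note S = subspace_coord_space[of n]
  define u' where "u' = (1 / 2) *\<^sub>R u"
  define v' where "v' = (1 / 2) *\<^sub>R v"
  have V: "u' \<in> coord_space n" "v' \<in> coord_space n" "norm u' \<le> 1" "norm v' \<le> 1"
    using assms S by (auto simp: u'_def v'_def subspace_scale)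
  have uv: "u = 2 *\<^sub>R u'" "v = 2 *\<^sub>R v'" by (auto simp: u'_def v'_def)
  have "u + v = 2 *\<^sub>R (u' + v')" "u - v = 2 *\<^sub>R (u' - v')" by (simp_all add: uv algebra_simps)
  then have "Q (u + v) + Q (u - v) - 2 * Q u - 2 * Q v = 4 * (Q (u' + v') + Q (u' - v') - 2 * Q u' - 2 * Q v')"
    using scale[of "u' + v'" 2] scale[of "u' - v'" 2] scale[of u' 2] scale[of v' 2] V S
    by (simp add: subspace_add subspace_diff uv)
  then show ?thesis using parallelogram_1[OF V(1,3,2,4)] by (simp add: abs_mult)
qed

text \<open>The Jordan-von Neumann argument with errors. The left side is half of (first minus
  second plus third) of the four parallelogram defects in the proof, minus the fourth, hence at most
  \<open>7 * e\<close>.\<close>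

lemma C_add:
  assumes x: "x \<in> coord_space n" "norm x \<le> 1" and y: "y \<in> coord_space n" "norm y \<le> 1"
    and z: "z \<in> coord_space n" "norm z \<le> 1"
  shows "\<bar>C (x + y) z - C x z - C y z\<bar> \<le> 10 * e"
proof -
  note S = subspace_coord_space[of n]
  have V: "x + z \<in> coord_space n" "x + y \<in> coord_space n" "y - z \<in> coord_space n"
    "norm (x + z) \<le> 2" "norm (x + y) \<le> 2" "norm (y - z) \<le> 2"
    using assms S norm_triangle_ineq[of x z] norm_triangle_ineq[of x y] norm_triangle_ineq4[of y z]
    by (auto simp: subspace_add subspace_diff)
  have "\<bar>Q (x + z + y) + Q (x + z - y) - 2 * Q (x + z) - 2 * Q y\<bar> \<le> 4 * e"
    using V y by (intro parallelogram_2) auto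
  moreover have "\<bar>Q (x + (y - z)) + Q (x - (y - z)) - 2 * Q x - 2 * Q (y - z)\<bar> \<le> 4 * e"
    using V x by (intro parallelogram_2) auto
  moreover have "\<bar>Q (x + y + z) + Q (x + y - z) - 2 * Q (x + y) - 2 * Q z\<bar> \<le> 4 * e"
    using V z by (intro parallelogram_2) auto
  moreover have "\<bar>Q (y + z) + Q (y - z) - 2 * Q y - 2 * Q z\<bar> \<le> e"
    using y z by (intro parallelogram_1) auto
  moreover have "x + z + y = x + y + z" "x + (y - z) = x + y - z" "x - (y - z) = x + z - y"
    by (auto simp: algebra_simps)
  ultimately show ?thesis unfolding C_def by (simp only:)
qed

definition B :: "nat \<Rightarrow> nat \<Rightarrow> real" where "B i j = C (unit_vec i) (unit_vec j) / 2"

lemma B_sym: "B i j = B j i" by (simp add: B_def C_def add.commute)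

lemma B_diag: "i < n \<Longrightarrow> B i i = Q (unit_vec i)"
  using scale[OF unit_vec_coord_space, of i 2] by (simp add: B_def C_def scaleR_2[symmetric] algebra_simps)

text \<open>Adding coordinate \<open>k\<close> creates the cross term of the partial sum with the
  new vector. Splitting it into single cross terms costs \<open>10 * e\<close> for each of
  \<open>k\<close> steps by \<open>C_add\<close>, and pulling the coefficients out of each costs one
  further \<open>e\<close>. Summing \<open>11 * k * e\<close> over the steps stays below
  \<open>11 * k\<^sup>2 * e\<close>.\<close>

lemma approx_quadratic_unit:
  assumes x: "x \<in> coord_space n" "norm x \<le> 1" and k: "k \<le> n"
  shows "\<bar>Q (lincomb k (coeff x) unit_vec) - quad_sum k B x\<bar> \<le> 11 * (real k)\<^sup>2 * e"
  using k
proof (induction k)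
  case 0
  show ?case by (simp add: Q0)
next
  case (Suc k)
  let ?v = "\<lambda>i. coeff x i *\<^sub>R unit_vec i"
  let ?y = "\<lambda>k. \<Sum>i<k. ?v i"
  have y: "?y m \<in> coord_space n" "norm (?y m) \<le> 1" if "m \<le> n" for m
    using that sum_unit_vec_coord_space norm_sum_unit_vec_le[OF x(1), of m] x(2) by auto
  have c1: "\<bar>coeff x i\<bar> \<le> 1" for i using abs_coeff_le_norm[OF x(1), of i] x(2) by simp
  have v: "?v i \<in> coord_space n" "norm (?v i) \<le> 1" if "i < n" for i
    using that c1[of i] by (auto simp: norm_unit_vec intro!: subspace_scale[OF subspace_coord_space] unit_vec_coord_space)
  have kn: "k < n" using Suc.prems by simp
  have e0: "0 \<le> e" using defect[of 0 0 0 0] by (simp add: mem_coord_space_iff Q0)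
  have s: "\<bar>C (?y m) (?v k) - (\<Sum>i<m. C (?v i) (?v k))\<bar> \<le> 10 * e * real m" if "m \<le> k" for m
    using that
  proof (induction m)
    case 0
    show ?case by (simp add: C_def Q0)
  next
    case (Suc m)
    then have m: "m < n" using kn by simp
    have "\<bar>C (?y m + ?v m) (?v k) - C (?y m) (?v k) - C (?v m) (?v k)\<bar> \<le> 10 * e"
      using y[of m] v[OF m] v[OF kn] m by (intro C_add) auto
    then show ?case using Suc by (simp add: algebra_simps)
  qed
  have g: "\<bar>C (?v i) (?v k) - 2 * (coeff x i * coeff x k * B i k)\<bar> \<le> e" if i: "i < k" for i
  proof -
    have i': "i < n" using i kn by simp
    have "C (?v i) (?v k) - 2 * (coeff x i * coeff x k * B i k) =
        Q (?v i + ?v k) - (coeff x i)\<^sup>2 * Q (unit_vec i)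
        - coeff x i * coeff x k * (Q (unit_vec i + unit_vec k) - Q (unit_vec i) - Q (unit_vec k))
        - (coeff x k)\<^sup>2 * Q (unit_vec k)"
      using scale[OF unit_vec_coord_space[OF i'], of "coeff x i"] scale[OF unit_vec_coord_space[OF kn], of "coeff x k"]
      by (simp add: C_def B_def)
    then show ?thesis using defect[OF c1 c1, of "unit_vec i" "unit_vec k" i k] i' kn
      by (simp add: unit_vec_coord_space norm_unit_vec)
  qed
  have "\<bar>(\<Sum>i<k. C (?v i) (?v k)) - (\<Sum>i<k. 2 * (coeff x i * coeff x k * B i k))\<bar> \<le> real k * e"
    unfolding sum_subtractf[symmetric]
    using sum_bounded_above[of "{..<k}" "\<lambda>i. \<bar>C (?v i) (?v k) - 2 * (coeff x i * coeff x k * B i k)\<bar>" e] g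
    by (intro order_trans[OF sum_abs]) auto
  moreover have "quad_sum (Suc k) B x =
     (quad_sum k B x) + (\<Sum>i<k. 2 * (coeff x i * coeff x k * B i k)) + (coeff x k)\<^sup>2 * B k k"
  proof -
    have "(\<Sum>j<k. coeff x k * coeff x j * B k j) = (\<Sum>i<k. coeff x i * coeff x k * B i k)"
      by (intro sum.cong refl) (simp add: B_sym mult.commute)
    then show ?thesis by (simp add: sum.distrib power2_eq_square sum_distrib_left[symmetric])
  qed
  moreover have "Q (?y (Suc k)) = Q (?y k) + (coeff x k)\<^sup>2 * B k k + C (?y k) (?v k)"
    using scale[OF unit_vec_coord_space[OF kn], of "coeff x k"] by (simp add: C_def B_diag[OF kn])
  moreover have "\<bar>Q (?y k) - quad_sum k B x\<bar> \<le> 11 * (real k)\<^sup>2 * e"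
    using Suc by simp
  ultimately have "\<bar>Q (?y (Suc k)) - quad_sum (Suc k) B x\<bar>
      \<le> 11 * (real k)\<^sup>2 * e + 10 * e * real k + real k * e"
    using s[of k] by linarith
  also have "\<dots> \<le> 11 * (real (Suc k))\<^sup>2 * e"
    using e0 by (simp add: power2_eq_square algebra_simps)
  finally show ?case .
qed

lemma approx_quadratic:
  assumes x: "x \<in> coord_space n"
  shows "\<bar>Q x - quad_sum n B x\<bar> \<le> 11 * (real n)\<^sup>2 * e * (norm x)\<^sup>2"
proof (cases "x = 0")
  case True
  then show ?thesis by (simp add: Q0)
next
  case False
  define u where "u = (1 / norm x) *\<^sub>R x"
  have u: "u \<in> coord_space n" "norm u = 1" and xu: "x = norm x *\<^sub>R u"
    using False x by (auto simp: u_def subspace_scale[OF subspace_coord_space])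
  have c: "coeff x i = norm x * coeff u i" for i using False by (simp add: u_def)
  have "Q x = (norm x)\<^sup>2 * Q u" using scale[OF u(1), of "norm x"] xu by simp
  moreover have "quad_sum n B x = (norm x)\<^sup>2 * (quad_sum n B u)"
    unfolding c by (simp add: sum_distrib_left power2_eq_square mult_ac)
  ultimately have "Q x - quad_sum n B x =
      (norm x)\<^sup>2 * (Q u - quad_sum n B u)" by (simp add: right_diff_distrib)
  moreover have "\<bar>Q u - quad_sum n B u\<bar> \<le> 11 * (real n)\<^sup>2 * e"
    using approx_quadratic_unit[OF u(1) _ order_refl] u(2) coord_space_expand[OF u(1)] by simp
  then have "(norm x)\<^sup>2 * \<bar>Q u - quad_sum n B u\<bar> \<le> (norm x)\<^sup>2 * (11 * (real n)\<^sup>2 * e)"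
    by (intro mult_left_mono) auto
  ultimately show ?thesis by (simp add: abs_mult mult_ac)
qed

end

section \<open>Orthonormal bases, completing the square, and the distance to the ball\<close>

lemma orthonormal_basis_exists:
  fixes f :: "(nat \<Rightarrow>\<^sub>0 real) \<Rightarrow> (nat \<Rightarrow>\<^sub>0 real) \<Rightarrow> real"
  assumes lin: "\<And>y. linear (\<lambda>x. f x y)" and sym: "\<And>x y. f x y = f y x"
    and pos: "\<And>x. x \<in> coord_space n \<Longrightarrow> x \<noteq> 0 \<Longrightarrow> 0 < f x x" and k: "k \<le> n"
  shows "\<exists>b. (\<forall>i<k. b i \<in> coord_space k) \<and> (\<forall>i<k. \<forall>j<k. f (b i) (b j) = (if i = j then 1 else 0)) \<and>
    (\<forall>x\<in>coord_space k. x = (\<Sum>i<k. f x (b i) *\<^sub>R b i))"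
  using k
proof (induction k)
  case 0
  show ?case by (auto simp: mem_coord_space_iff intro!: poly_mapping_eqI)
next
  case (Suc k)
  from Suc.IH[OF Suc_leD[OF Suc.prems]] obtain b where
    H: "(\<forall>i<k. b i \<in> coord_space k) \<and> (\<forall>i<k. \<forall>j<k. f (b i) (b j) = (if i = j then 1 else 0)) \<and>
    (\<forall>x\<in>coord_space k. x = (\<Sum>i<k. f x (b i) *\<^sub>R b i))" by (rule exE)
  have b: "b i \<in> coord_space k" if "i < k" for i using H that by blast
  have o: "f (b i) (b j) = (if i = j then 1 else 0)" if "i < k" "j < k" for i j using H that by blast
  have e: "x = (\<Sum>i<k. f x (b i) *\<^sub>R b i)" if "x \<in> coord_space k" for x using H that by blast
  have mono: "coord_space k \<subseteq> coord_space m" if "k \<le> m" for k m using that by (auto simp: coord_space_def)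
  note S = subspace_coord_space
  note lin_simps = linear_add[OF lin] linear_scale[OF lin] linear_diff[OF lin] linear_sum[OF lin]
  define s where "s = (\<Sum>i<k. f (unit_vec k) (b i) *\<^sub>R b i)"
  \<comment> \<open>Gram-Schmidt step: the next unit vector minus its projection. Its last
    coordinate stays 1, hence it is nonzero and positivity applies.\<close>
  define w where "w = unit_vec k - s"
  have s: "s \<in> coord_space k" unfolding s_def by (intro subspace_sum[OF S] subspace_scale[OF S] b) auto
  have w: "w \<in> coord_space (Suc k)" unfolding w_def
    using s mono[of k "Suc k"] by (intro subspace_diff[OF S] unit_vec_coord_space) auto
  have "coeff w k = 1" using s by (simp add: w_def lookup_minus mem_coord_space_iff)
  then have "w \<noteq> 0" by auto
  then have w0: "0 < f w w" using w mono[OF Suc.prems] by (intro pos) auto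
  have fs: "f s (b j) = f (unit_vec k) (b j)" if "j < k" for j
    using that by (simp add: s_def lin_simps o if_distrib cong: if_cong)
  have wb: "f w (b j) = 0" if "j < k" for j using fs[OF that] by (simp add: w_def lin_simps)
  define b' where "b' i = (if i = k then (1 / sqrt (f w w)) *\<^sub>R w else b i)" for i
  have fr: "f x (c *\<^sub>R y) = c * f x y" for x y c using sym[of x "c *\<^sub>R y"] sym[of x y] by (simp add: lin_simps)
  have "b' i \<in> coord_space (Suc k)" if "i < Suc k" for i
    using that w b[of i] mono[of k "Suc k"] by (auto simp: b'_def less_Suc_eq intro!: subspace_scale[OF S])
  moreover have "f (b' i) (b' j) = (if i = j then 1 else 0)" if "i < Suc k" "j < Suc k" for i j
    using that o[of i j] wb[of i] wb[of j] sym[of "b i" w] w0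
    by (auto simp: b'_def less_Suc_eq fr lin_simps)
  moreover have "x = (\<Sum>i<Suc k. f x (b' i) *\<^sub>R b' i)" if x: "x \<in> coord_space (Suc k)" for x
  proof -
    define c where "c = coeff x k"
    define y where "y = x - c *\<^sub>R w"
    have "y \<in> coord_space (Suc k)" using x w unfolding y_def by (intro subspace_diff[OF S] subspace_scale[OF S])
    moreover have "coeff y k = 0" using \<open>coeff w k = 1\<close> by (simp add: y_def lookup_minus c_def)
    ultimately have y: "y \<in> coord_space k" by (auto simp: mem_coord_space_iff) (metis le_SucE le_antisym not_less_eq_eq)
    have "f y w = 0"
    proof -
      have "f y w = (\<Sum>i<k. f y (b i) * f (b i) w)" by (subst e[OF y]) (simp add: lin_simps)
      then show ?thesis using wb sym by simp
    qed
    then have fxw: "f x w = c * f w w" by (simp add: y_def lin_simps)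
    have fxb: "f x (b i) = f y (b i)" if "i < k" for i using wb[OF that] by (simp add: y_def lin_simps)
    have "(\<Sum>i<Suc k. f x (b' i) *\<^sub>R b' i) = (\<Sum>i<k. f x (b i) *\<^sub>R b i) + c *\<^sub>R w"
      using w0 by (simp add: b'_def fr fxw)
    also have "(\<Sum>i<k. f x (b i) *\<^sub>R b i) = y" using e[OF y] fxb by simp
    finally show ?thesis by (simp add: y_def)
  qed
  ultimately show ?case by blast
qed

text \<open>Completing the square in a basis orthonormal for the form: the centre has coordinates
  \<open>g (b i) / 2\<close>, and the maximum \<open>M\<close> is \<open>d\<close> plus the sum of
  their squares.\<close>

lemma quadratic_sublevel_ellipsoid:
  fixes B :: "nat \<Rightarrow> nat \<Rightarrow> real" and l :: "nat \<Rightarrow> real"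
  assumes sym: "\<And>i j. B i j = B j i"
    and pos: "\<And>x. x \<in> coord_space n \<Longrightarrow> x \<noteq> 0 \<Longrightarrow> 0 < (quad_sum n B x)"
  shows "\<exists>M m b. m \<in> coord_space n \<and> (\<forall>i<n. b i \<in> coord_space n) \<and>
     (\<forall>x\<in>coord_space n. \<exists>c. x = m + lincomb n c b) \<and>
     (\<forall>c. d + (\<Sum>i<n. coeff (m + lincomb n c b) i * l i)
        - (\<Sum>i<n. \<Sum>j<n. coeff (m + lincomb n c b) i * coeff (m + lincomb n c b) j * B i j)
        = M - sq_sum n c)"
proof -
  define f where "f x y = (\<Sum>i<n. \<Sum>j<n. coeff x i * coeff y j * B i j)" for x y
  define g where "g x = (\<Sum>i<n. coeff x i * l i)" for x
  have lin: "linear (\<lambda>x. f x y)" for y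
    by (rule linearI) (auto simp: f_def lookup_add algebra_simps sum.distrib sum_distrib_left)
  have ling: "linear g"
    by (rule linearI) (auto simp: g_def lookup_add algebra_simps sum.distrib sum_distrib_left)
  have symf: "f x y = f y x" for x y
    unfolding f_def by (subst sum.swap, intro sum.cong refl) (subst sym, simp)
  have posf: "0 < f x x" if "x \<in> coord_space n" "x \<noteq> 0" for x unfolding f_def by (rule pos[OF that])
  obtain b where
    H: "(\<forall>i<n. b i \<in> coord_space n) \<and> (\<forall>i<n. \<forall>j<n. f (b i) (b j) = (if i = j then 1 else 0)) \<and>
    (\<forall>x\<in>coord_space n. x = (\<Sum>i<n. f x (b i) *\<^sub>R b i))"
    using orthonormal_basis_exists[OF lin symf posf order_refl] by (rule exE)
  have b: "b i \<in> coord_space n" if "i < n" for i using H that by blast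
  have o: "f (b i) (b j) = (if i = j then 1 else 0)" if "i < n" "j < n" for i j using H that by blast
  have e: "x = (\<Sum>i<n. f x (b i) *\<^sub>R b i)" if "x \<in> coord_space n" for x using H that by blast
  note S = subspace_coord_space
  define s where "s a = lincomb n a b" for a :: "nat \<Rightarrow> real"
  have sV: "s a \<in> coord_space n" for a unfolding s_def by (intro subspace_sum[OF S] subspace_scale[OF S] b) auto
  have sadd: "s a + s a' = s (\<lambda>i. a i + a' i)" for a a' by (simp add: s_def sum.distrib scaleR_add_left)
  have fs: "f (s a) y = (\<Sum>i<n. a i * f (b i) y)" for a y
    by (simp add: s_def linear_sum[OF lin] linear_scale[OF lin])
  have "f (s a) (b j) = a j" if "j < n" for a j
    using that by (simp add: fs o if_distrib cong: if_cong)
  then have "f (b j) (s a) = a j" if "j < n" for a j using that by (simp add: symf[of "b j"])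
  then have ff: "f (s a) (s a) = sq_sum n a" for a
    by (subst fs) (simp add: power2_eq_square)
  have gg: "g (s a) = (\<Sum>i<n. a i * g (b i))" for a
    by (simp add: s_def linear_sum[OF ling] linear_scale[OF ling])
  define a0 where "a0 i = g (b i) / 2" for i
  define m where "m = s a0"
  have key: "d + g (m + s c) - f (m + s c) (m + s c) = (d + (\<Sum>i<n. (a0 i)\<^sup>2)) - sq_sum n c" for c
  proof -
    have "g (m + s c) - f (m + s c) (m + s c) = (\<Sum>i<n. (a0 i + c i) * (2 * a0 i) - (a0 i + c i)\<^sup>2)"
      unfolding m_def sadd ff gg by (simp add: a0_def sum_subtractf)
    also have "\<dots> = (\<Sum>i<n. (a0 i)\<^sup>2 - (c i)\<^sup>2)"
      by (intro sum.cong refl) (simp add: power2_eq_square algebra_simps)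
    finally show ?thesis by (simp add: sum_subtractf)
  qed
  have "\<exists>c. x = m + s c" if "x \<in> coord_space n" for x
  proof -
    have "x - m \<in> coord_space n" using that sV by (simp add: m_def subspace_diff[OF S])
    then have "x - m = s (\<lambda>i. f (x - m) (b i))" using e unfolding s_def by blast
    then have "x = m + s (\<lambda>i. f (x - m) (b i))" by (simp add: algebra_simps)
    then show ?thesis by blast
  qed
  then have "m \<in> coord_space n \<and> (\<forall>i<n. b i \<in> coord_space n) \<and>
     (\<forall>x\<in>coord_space n. \<exists>c. x = m + s c) \<and>
     (\<forall>c. d + g (m + s c) - f (m + s c) (m + s c) = (d + (\<Sum>i<n. (a0 i)\<^sup>2)) - sq_sum n c)"
    using key b sV by (auto simp: m_def)
  then show ?thesis unfolding s_def g_def f_def by blast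
qed

lemma banach_mazur_dist_ball_le:
  assumes b: "\<And>i. i < n \<Longrightarrow> b i \<in> coord_space n" and m: "m \<in> coord_space n" and r: "0 < r1" "0 < r2"
    and inner: "\<And>c. (sq_sum n c) \<le> r1\<^sup>2 \<Longrightarrow> m + lincomb n c b \<in> K"
    and outer: "\<And>x. x \<in> K \<Longrightarrow> \<exists>c. x = m + lincomb n c b \<and> sq_sum n c \<le> r2\<^sup>2"
  shows "ball_dist n K \<le> r2 / r1"
  unfolding banach_mazur_dist_def
proof (rule cInf_lower)
  note S = subspace_coord_space
  define s where "s a = lincomb n a b" for a :: "nat \<Rightarrow> real"
  have sV: "s a \<in> coord_space n" for a unfolding s_def by (intro subspace_sum[OF S] subspace_scale[OF S] b) auto
  have sr: "t *\<^sub>R s a = s (\<lambda>i. t * a i)" for t a by (simp add: s_def scaleR_sum_right)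
  have sadd: "s a + s a' = s (\<lambda>i. a i + a' i)" for a a' by (simp add: s_def sum.distrib scaleR_add_left)
  \<comment> \<open>\<open>T\<close> maps the unit ball onto the outer ellipsoid. Scaling by
    \<open>r2 / r1\<close> carries the inner ellipsoid to a translate of the outer one, and
    \<open>z\<close> restores the centre.\<close>
  define T where "T y = m + r2 *\<^sub>R s (coeff y)" for y
  define z where "z = m - (r2 / r1) *\<^sub>R m"
  have aff: "affine_map_between (coord_space n) (coord_space n) T"
    unfolding affine_map_between_def
  proof (intro conjI ballI allI)
    show "T ` coord_space n \<subseteq> coord_space n"
      using m sV by (auto simp: T_def intro!: subspace_add[OF S] subspace_scale[OF S])
    fix x y t
    have "coeff ((1 - t) *\<^sub>R x + t *\<^sub>R y) = (\<lambda>i. (1 - t) * coeff x i + t * coeff y i)"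
      by (rule ext) (simp add: lookup_add)
    then have s: "s (coeff ((1 - t) *\<^sub>R x + t *\<^sub>R y)) = (1 - t) *\<^sub>R s (coeff x) + t *\<^sub>R s (coeff y)"
      by (simp add: sr sadd)
    then show "T ((1 - t) *\<^sub>R x + t *\<^sub>R y) = (1 - t) *\<^sub>R T x + t *\<^sub>R T y"
      unfolding T_def s by (simp add: algebra_simps)
  qed
  have "K \<subseteq> T ` euclidean_unit_ball n"
  proof
    fix x assume "x \<in> K"
    then obtain c where c: "x = m + s c" "sq_sum n c \<le> r2\<^sup>2" using outer unfolding s_def by blast
    define y where "y = (\<Sum>i<n. (c i / r2) *\<^sub>R unit_vec i)"
    have cy: "coeff y i = c i / r2" if "i < n" for i using that by (simp add: y_def coeff_sum_unit_vec)
    have "y \<in> coord_space n" unfolding y_def by (rule sum_unit_vec_coord_space) simp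
    moreover have "(\<Sum>i<n. (coeff y i)\<^sup>2) = sq_sum n c / r2\<^sup>2"
      by (simp add: cy power_divide sum_divide_distrib)
    then have "sqrt (\<Sum>i<n. (coeff y i)\<^sup>2) \<le> 1" using c r by (simp add: divide_le_eq_1)
    ultimately have "y \<in> euclidean_unit_ball n" by (simp add: euclidean_unit_ball_def)
    moreover have "r2 *\<^sub>R s (coeff y) = s c"
      unfolding sr unfolding s_def using r by (intro sum.cong) (auto simp: cy)
    then have "x = T y" by (simp add: T_def c)
    ultimately show "x \<in> T ` euclidean_unit_ball n" by blast
  qed
  moreover have "T ` euclidean_unit_ball n \<subseteq> (\<lambda>x. (r2 / r1) *\<^sub>R x + z) ` K"
  proof
    fix x assume "x \<in> T ` euclidean_unit_ball n"
    then obtain y where y: "x = T y" "(\<Sum>i<n. (coeff y i)\<^sup>2) \<le> 1" by (auto simp: euclidean_unit_ball_def)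
    have "(\<Sum>i<n. (r1 * coeff y i)\<^sup>2) = r1\<^sup>2 * (\<Sum>i<n. (coeff y i)\<^sup>2)"
      by (simp add: power_mult_distrib sum_distrib_left)
    also have "\<dots> \<le> r1\<^sup>2" using y(2) by (simp add: mult_left_le)
    finally have "m + s (\<lambda>i. r1 * coeff y i) \<in> K" unfolding s_def by (rule inner)
    moreover have "x = (r2 / r1) *\<^sub>R (m + s (\<lambda>i. r1 * coeff y i)) + z"
      unfolding y(1) T_def z_def sr[symmetric] using r by (simp add: scaleR_add_right)
    ultimately show "x \<in> (\<lambda>x. (r2 / r1) *\<^sub>R x + z) ` K" by blast
  qed
  moreover have "z \<in> coord_space n" using m by (simp add: z_def subspace_diff[OF S] subspace_scale[OF S])
  ultimately show "r2 / r1 \<in> {r. r > 0 \<and> (\<exists>T z. affine_map_between (coord_space n) (coord_space n) T \<and>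
      z \<in> coord_space n \<and> K \<subseteq> T ` euclidean_unit_ball n \<and>
      T ` euclidean_unit_ball n \<subseteq> (\<lambda>x. r *\<^sub>R x + z) ` K)}"
    using aff r by auto
qed (auto intro!: bdd_belowI[of _ 0])

subsection \<open>Sandwiching by homothetic ellipsoids\<close>

lemma ratio_bound:
  fixes M \<eta> :: real
  assumes "0 \<le> \<eta>" "4 * \<eta> \<le> M" "0 < M"
  shows "sqrt (M + \<eta>) / sqrt (M - 2 * \<eta>) \<le> 1 + 6 * \<eta> / M"
proof -
  have pos: "0 < M - 2 * \<eta>" using assms by linarith
  have "1 \<le> (M + \<eta>) / (M - 2 * \<eta>)" using pos assms by (simp add: le_divide_eq)
  then have "sqrt ((M + \<eta>) / (M - 2 * \<eta>)) \<le> (M + \<eta>) / (M - 2 * \<eta>)"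
    by (intro real_le_lsqrt self_le_power) auto
  also have "\<dots> = 1 + 3 * \<eta> / (M - 2 * \<eta>)" using pos by (simp add: field_simps)
  also have "3 * \<eta> / (M - 2 * \<eta>) \<le> 3 * \<eta> / (M / 2)" using assms pos by (intro divide_left_mono) auto
  finally show ?thesis by (simp add: real_sqrt_divide)
qed

locale near_quadric_sections_coord = near_quadric_sections "coord_space n" K p R h
  for n K p R h +
  assumes n: "1 \<le> n" and nR: "real n \<le> R"
begin

sublocale aq: approx_quadratic n Q "R ^ 104 * h"
proof
  fix a b :: real and u v
  assume "\<bar>a\<bar> \<le> 1" "\<bar>b\<bar> \<le> 1" "u \<in> coord_space n" "norm u \<le> 1" "v \<in> coord_space n" "norm v \<le> 1"
  then show "\<bar>Q (a *\<^sub>R u + b *\<^sub>R v) - a\<^sup>2 * Q u - a * b * (Q (u + v) - Q u - Q v) - b\<^sup>2 * Q v\<bar> \<le> R ^ 104 * h"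
    using Gam_bound[of u v a b] by (simp add: Gam_def)
qed (rule Q_scale)

definition L1 :: "(nat \<Rightarrow>\<^sub>0 real) \<Rightarrow> real" where
  "L1 x = (\<Sum>i<n. coeff x i * L (unit_vec i))"
definition Q1 :: "(nat \<Rightarrow>\<^sub>0 real) \<Rightarrow> real" where
  "Q1 x = quad_sum n aq.B x"
definition F1 :: "(nat \<Rightarrow>\<^sub>0 real) \<Rightarrow> real" where
  "F1 x = del + L1 x - Q1 x"

lemma L1_approx: assumes "x \<in> coord_space n" shows "\<bar>L x - L1 x\<bar> \<le> R ^ 18 * h * norm x"
proof -
  have "\<bar>L x - L1 x\<bar> \<le> real n * (R ^ 17 * h) * norm x"
    unfolding L1_def by (intro approx_linear L_additive L_scale assms)
  also have "\<dots> \<le> R * (R ^ 17 * h) * norm x" using nR R_pos h by (intro mult_right_mono) auto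
  also have "\<dots> = R ^ 18 * h * norm x" using power_add[of R 1 17] by simp
  finally show ?thesis .
qed

lemma Q1_approx: assumes "x \<in> coord_space n" shows "\<bar>Q x - Q1 x\<bar> \<le> R ^ 107 * h * (norm x)\<^sup>2"
proof -
  have "\<bar>Q x - Q1 x\<bar> \<le> 11 * (real n)\<^sup>2 * (R ^ 104 * h) * (norm x)\<^sup>2"
    unfolding Q1_def by (rule aq.approx_quadratic[OF assms])
  also have "\<dots> \<le> 11 * R\<^sup>2 * (R ^ 104 * h) * (norm x)\<^sup>2"
    using nR R_pos h by (intro mult_right_mono mult_left_mono power_mono) auto
  also have "\<dots> = (11 * R ^ 106) * (h * (norm x)\<^sup>2)" using power_add[of R 2 104] by simp
  also have "\<dots> \<le> R ^ 107 * (h * (norm x)\<^sup>2)" using absorb[of 11 1 106] h by (intro mult_right_mono) auto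
  finally show ?thesis by (simp add: mult_ac)
qed

text \<open>The approximation error costs at most half of the lower bound for \<open>Q\<close>, so 4
  becomes 8. This is the positive definiteness that makes the level sets of \<open>F1\<close>
  ellipsoids.\<close>

lemma Q1_lower: assumes x: "x \<in> coord_space n" shows "(norm x)\<^sup>2 \<le> 8 * R ^ 4 * Q1 x"
proof -
  have "8 * R ^ 111 \<le> R ^ 112" using absorb[of 8 1 111] by simp
  then have "h * (8 * R ^ 111) \<le> h * R ^ 112" using h by (intro mult_left_mono) auto
  then have "h * (8 * R ^ 111) \<le> 1" using h_small[of 112] by simp
  then have "h * (8 * R ^ 111) * (norm x)\<^sup>2 \<le> 1 * (norm x)\<^sup>2" by (intro mult_right_mono) auto
  moreover have "4 * R ^ 4 * (Q x - Q1 x) \<le> 4 * R ^ 4 * (R ^ 107 * h * (norm x)\<^sup>2)"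
    using Q1_approx[OF x] R_pos by (intro mult_left_mono) auto
  moreover have "4 * R ^ 4 * (R ^ 107 * h * (norm x)\<^sup>2) = h * (8 * R ^ 111) * (norm x)\<^sup>2 / 2"
    using power_add[of R 4 107] by simp
  moreover have "4 * R ^ 4 * (Q x - Q1 x) = 4 * R ^ 4 * Q x - 4 * R ^ 4 * Q1 x" by (rule right_diff_distrib)
  ultimately show ?thesis using Q_lower[OF x] by linarith
qed

lemma Q1_pos: "x \<in> coord_space n \<Longrightarrow> x \<noteq> 0 \<Longrightarrow> 0 < Q1 x"
  using Q1_lower[of x] R_pos by (smt (verit) mult_nonneg_nonpos norm_eq_zero zero_less_power zero_less_power2)

lemma L1_bound: assumes x: "x \<in> coord_space n" shows "L1 x \<le> 6 * R ^ 3 * norm x"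
proof -
  have "h * R ^ 18 \<le> 1" using h_small[of 18] by simp
  moreover have "1 \<le> R ^ 3" using R_power_mono[of 0 3] by simp
  ultimately have "(R ^ 18 * h) * norm x \<le> R ^ 3 * norm x" by (intro mult_right_mono) (auto simp: mult.commute)
  then show ?thesis using L1_approx[OF x] L_bound[OF x] by linarith
qed

lemma del_le: "del \<le> R\<^sup>2"
proof -
  have "al p * 1 \<le> al p * norm p" "be p * 1 \<le> be p * norm p"
    using norm_p al_be_nonneg[OF p_nz] by (intro mult_left_mono; auto)+
  then have "al p \<le> R" "be p \<le> R" using al_be_le[OF p_nz] by auto
  then show ?thesis unfolding del_def power2_eq_square using al_be_nonneg[OF p_nz] R_pos by (intro mult_mono) auto
qed

lemma F1_diff: assumes x: "x \<in> coord_space n" "norm x \<le> r" shows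
  "\<bar>F1 x - (del + L x - Q x)\<bar> \<le> (R ^ 18 * r + R ^ 107 * r\<^sup>2) * h"
proof -
  have "R ^ 18 * h * norm x \<le> R ^ 18 * h * r" using x h R_pos by (intro mult_left_mono) auto
  moreover have "R ^ 107 * h * (norm x)\<^sup>2 \<le> R ^ 107 * h * r\<^sup>2"
    using x h R_pos by (intro mult_left_mono power_mono) auto
  moreover have "\<bar>F1 x - (del + L x - Q x)\<bar> \<le> \<bar>L x - L1 x\<bar> + \<bar>Q x - Q1 x\<bar>" by (simp add: F1_def)
  ultimately show ?thesis using L1_approx[OF x(1)] Q1_approx[OF x(1)] by (simp add: algebra_simps)
qed

lemma h_square_R: "16 * R\<^sup>2 * h\<^sup>2 \<le> 16 * R\<^sup>2 * h"
  using h_square_le R_pos by (intro mult_left_mono) auto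

lemma F1_inside: assumes "x \<in> K" shows "- (R ^ 126 * h) \<le> F1 x"
proof -
  have x: "x \<in> coord_space n" "norm x \<le> R" using assms KV K_bound by auto
  have "R\<^sup>2 \<le> R ^ 109" "R ^ 19 \<le> R ^ 109" using R_power_mono[of 2 109] R_power_mono[of 19 109] by auto
  moreover have "18 * R ^ 109 \<le> R ^ 126" using absorb[of 18 17 109] by simp
  ultimately have "16 * R\<^sup>2 + (R ^ 19 + R ^ 109) \<le> R ^ 126" by linarith
  then have "(16 * R\<^sup>2 + (R ^ 19 + R ^ 109)) * h \<le> R ^ 126 * h" using h by (intro mult_right_mono) auto
  moreover have "R ^ 18 * R = R ^ 19" "R ^ 107 * R\<^sup>2 = R ^ 109"
    using power_add[of R 18 1] power_add[of R 107 2] by auto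
  ultimately show ?thesis
    using F1_diff[OF x] sandwich_mem[OF assms] h_square_R by (simp add: distrib_right)
qed

text \<open>The errors grow with the norm, so they are used only up to norm \<open>R ^ 9\<close>;
  this radius produces the exponent 126 = 107 + 18 + 1. Beyond it, \<open>Q1\<close> outweighs
  \<open>L1\<close> and \<open>del\<close>, and \<open>F1 x\<close> is not positive anyway.\<close>

lemma F1_outside: assumes x: "x \<in> coord_space n" and F: "R ^ 126 * h < F1 x" shows "x \<in> K"
proof (rule ccontr)
  assume nK: "x \<notin> K"
  show False
  proof (cases "norm x \<le> R ^ 9")
    case True
    have "R\<^sup>2 \<le> R ^ 125" "R ^ 27 \<le> R ^ 125" using R_power_mono[of 2 125] R_power_mono[of 27 125] by auto
    moreover have "18 * R ^ 125 \<le> R ^ 126" using absorb[of 18 1 125] by simp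
    ultimately have "16 * R\<^sup>2 + (R ^ 27 + R ^ 125) \<le> R ^ 126" by linarith
    then have "(16 * R\<^sup>2 + (R ^ 27 + R ^ 125)) * h \<le> R ^ 126 * h" using h by (intro mult_right_mono) auto
    moreover have "R ^ 18 * R ^ 9 = R ^ 27" "R ^ 107 * (R ^ 9)\<^sup>2 = R ^ 125"
      by (simp_all flip: power_add power_mult)
    ultimately show False
      using F1_diff[OF x True] sandwich_not_mem[OF x nK] h_square_R F by (simp add: distrib_right)
  next
    case False
    define r where "r = norm x"
    have r: "R ^ 9 \<le> r" using False by (simp add: r_def)
    have r1: "1 \<le> r" using r R_power_mono[of 0 9] by simp
    have "64 * R ^ 7 \<le> R ^ 9" using absorb[of 64 2 7] by simp
    then have "(64 * R ^ 7) * r \<le> r * r" using r r1 by (intro mult_right_mono) auto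
    also have "\<dots> \<le> 8 * R ^ 4 * Q1 x" using Q1_lower[OF x] by (simp add: r_def power2_eq_square)
    finally have "(8 * R ^ 4) * (8 * R ^ 3 * r) \<le> (8 * R ^ 4) * Q1 x"
      by (simp add: mult_ac power_merge flip: power_add)
    moreover have "0 < 8 * R ^ 4" using R_pos by simp
    ultimately have "8 * R ^ 3 * r \<le> Q1 x" by (simp only: mult_le_cancel_left_pos)
    moreover have "R\<^sup>2 * 1 \<le> R ^ 3 * r" using R_power_mono[of 2 3] r1 R_pos by (intro mult_mono) auto
    moreover have "0 \<le> R ^ 3 * r" using R_pos r1 by simp
    moreover have "0 \<le> R ^ 126 * h" using R_pos h by simp
    ultimately show False using F L1_bound[OF x] del_le unfolding F1_def r_def[symmetric] by linarith
  qed
qed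

text \<open>\<open>F1 p\<close> is the mean of \<open>F1\<close> at \<open>p + u\<close> and
  \<open>p - u\<close>, both in \<open>K\<close>, plus \<open>Q1 u\<close>. The bound keeps the
  maximum of \<open>F1\<close> away from 0, which turns the additive errors into a relative error of
  the radii.\<close>

lemma F1_p: "1 / (16 * R ^ 4) \<le> F1 p"
proof -
  define u where "u = unit_vec 0"
  have u: "u \<in> coord_space n" "norm u = 1" unfolding u_def using n by (intro unit_vec_coord_space norm_unit_vec; simp)+
  have "p + u \<in> K" "p - u \<in> K"
    using u p_V V by (auto intro!: ball_K simp: subspace_add subspace_diff)
  then have "- (R ^ 126 * h) \<le> F1 (p + u)" "- (R ^ 126 * h) \<le> F1 (p - u)" by (auto intro: F1_inside)
  moreover have "L1 (p + u) + L1 (p - u) = 2 * L1 p"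
    unfolding L1_def by (simp add: lookup_add lookup_minus algebra_simps sum.distrib sum_subtractf)
  moreover have "Q1 (p + u) + Q1 (p - u) = 2 * Q1 p + 2 * Q1 u"
    unfolding Q1_def by (simp add: lookup_add lookup_minus algebra_simps sum.distrib sum_subtractf)
  ultimately have 1: "Q1 u - R ^ 126 * h \<le> F1 p" by (simp add: F1_def)
  have "16 * R ^ 130 \<le> R ^ 131" using absorb[of 16 1 130] by simp
  then have "h * (16 * R ^ 130) \<le> h * R ^ 131" using h by (intro mult_left_mono) auto
  then have "(16 * R ^ 4) * (R ^ 126 * h) \<le> 1" using h_small[of 131] by (simp add: mult_ac power_merge)
  moreover have "2 \<le> (16 * R ^ 4) * Q1 u" using Q1_lower[OF u(1)] u(2) by simp
  ultimately have "1 \<le> (16 * R ^ 4) * (Q1 u - R ^ 126 * h)" by (simp add: right_diff_distrib)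
  also have "\<dots> \<le> (16 * R ^ 4) * F1 p" using 1 R_pos by (intro mult_left_mono) auto
  finally show ?thesis using R_pos by (simp add: divide_le_eq mult.commute)
qed

lemma ellipsoid_sandwich:
  "\<exists>m b r1 r2. m \<in> coord_space n \<and> (\<forall>i<n. b i \<in> coord_space n) \<and> 0 < r1 \<and> 0 < r2 \<and>
     (\<forall>c. (sq_sum n c) \<le> r1\<^sup>2 \<longrightarrow> m + lincomb n c b \<in> K) \<and>
     (\<forall>x\<in>K. \<exists>c. x = m + lincomb n c b \<and> sq_sum n c \<le> r2\<^sup>2) \<and>
     r2 / r1 \<le> 1 + R ^ 132 * h"
proof -
  have posB: "0 < (quad_sum n aq.B x)" if "x \<in> coord_space n" "x \<noteq> 0" for x
    using Q1_pos[OF that] by (simp add: Q1_def)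
  have "\<exists>M m b. m \<in> coord_space n \<and> (\<forall>i<n. b i \<in> coord_space n) \<and>
     (\<forall>x\<in>coord_space n. \<exists>c. x = m + lincomb n c b) \<and>
     (\<forall>c. F1 (m + lincomb n c b) = M - sq_sum n c)"
    unfolding F1_def L1_def Q1_def by (intro quadratic_sublevel_ellipsoid aq.B_sym posB)
  then obtain M m b where mb: "m \<in> coord_space n" "\<forall>i<n. b i \<in> coord_space n"
    and sp: "\<forall>x\<in>coord_space n. \<exists>c. x = m + lincomb n c b"
    and F: "\<forall>c. F1 (m + lincomb n c b) = M - sq_sum n c"
    by blast
  define e where "e = R ^ 126 * h"
  have e0: "0 < e" using R_pos h by (simp add: e_def)
  obtain c where "p = m + lincomb n c b" using sp p_V by blast
  then have "F1 p = M - sq_sum n c" using F by blast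
  moreover have "0 \<le> sq_sum n c" by (intro sum_nonneg) auto
  ultimately have M: "1 / (16 * R ^ 4) \<le> M" using F1_p by linarith
  have M0: "0 < M" using M R_pos by (smt (verit) divide_pos_pos zero_less_power)
  have M1: "1 / M \<le> 16 * R ^ 4"
    using M M0 R_pos by (simp add: divide_le_eq mult.commute)
  have eM: "96 * e \<le> M"
  proof -
    have "1536 * R ^ 130 \<le> R ^ 133" using absorb[of 1536 3 130] by simp
    then have "h * (1536 * R ^ 130) \<le> h * R ^ 133" using h by (intro mult_left_mono) auto
    then have "(96 * e) * (16 * R ^ 4) \<le> 1" using h_small[of 133] by (simp add: e_def mult_ac power_merge)
    moreover have "0 < 16 * R ^ 4" using R_pos by simp
    ultimately have "96 * e \<le> 1 / (16 * R ^ 4)" by (simp only: pos_le_divide_eq)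
    then show ?thesis using M by linarith
  qed
  \<comment> \<open>The factor 2 makes \<open>F1\<close> strictly larger than \<open>e\<close> on
    the closed inner ellipsoid, as \<open>F1_outside\<close> demands.\<close>
  define r1 where "r1 = sqrt (M - 2 * e)"
  define r2 where "r2 = sqrt (M + e)"
  have r: "0 < r1" "0 < r2" "r1\<^sup>2 = M - 2 * e" "r2\<^sup>2 = M + e" using e0 eM by (auto simp: r1_def r2_def)
  have "r2 / r1 \<le> 1 + 6 * e / M" unfolding r1_def r2_def using e0 eM M0 by (intro ratio_bound) auto
  also have "6 * e / M = 6 * e * (1 / M)" by simp
  also have "\<dots> \<le> 6 * e * (16 * R ^ 4)" using M1 e0 by (intro mult_left_mono) auto
  also have "\<dots> = (96 * R ^ 130) * h" by (simp add: e_def mult_ac power_merge)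
  also have "\<dots> \<le> R ^ 132 * h" using absorb[of 96 2 130] h by (intro mult_right_mono) auto
  finally have ratio: "r2 / r1 \<le> 1 + R ^ 132 * h" by simp
  have bV: "m + lincomb n c b \<in> coord_space n" for c
    using mb V by (intro subspace_add subspace_sum subspace_scale) auto
  have inner: "m + lincomb n c b \<in> K" if "sq_sum n c \<le> r1\<^sup>2" for c
    using that r(3) e0 F by (intro F1_outside bV) (simp add: e_def[symmetric])
  have outer: "\<exists>c. x = m + lincomb n c b \<and> sq_sum n c \<le> r2\<^sup>2" if x: "x \<in> K" for x
  proof -
    obtain c where c: "x = m + lincomb n c b" using sp KV x by blast
    then have "F1 x = M - sq_sum n c" using F by blast
    then have "sq_sum n c \<le> r2\<^sup>2" using F1_inside[OF x] r(4) by (simp add: e_def)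
    then show ?thesis using c by blast
  qed
  show ?thesis using mb r(1,2) inner outer ratio by blast
qed

end

subsection \<open>Position of the body\<close>

lemma abs_coeff_le_norm': "\<bar>coeff x i\<bar> \<le> norm x"
proof -
  have "x \<in> coord_space (Suc (Max (insert 0 (Poly_Mapping.keys x))))"
    by (auto simp: coord_space_def less_Suc_eq_le)
  then show ?thesis by (rule abs_coeff_le_norm)
qed

lemma bounded_linear_coeff: "bounded_linear (\<lambda>x. coeff x i)"
  by (rule bounded_linear_intro[where K=1]) (auto simp: lookup_add abs_coeff_le_norm')

lemmas continuous_on_coeff [continuous_intros] = bounded_linear.continuous_on[OF bounded_linear_coeff]

text \<open>The ambient type is infinite-dimensional, so closed and bounded does not imply compact.
  The box is built as a continuous image of products with intervals, one coordinate at a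
  time.\<close>

lemma compact_coord_box: "compact {x \<in> coord_space n. \<forall>i. \<bar>coeff x i\<bar> \<le> r}" if r: "0 \<le> r"
proof (induction n)
  case 0
  have "{x \<in> coord_space 0. \<forall>i. \<bar>coeff x i\<bar> \<le> r} \<subseteq> {0}"
    by (auto simp: mem_coord_space_iff intro!: poly_mapping_eqI)
  then show ?case using finite_subset finite_imp_compact by blast
next
  case (Suc n)
  let ?X = "\<lambda>n. {x \<in> coord_space n. \<forall>i. \<bar>coeff x i\<bar> \<le> r}"
  let ?f = "\<lambda>(x, t). x + t *\<^sub>R unit_vec n"
  have "compact (?f ` (?X n \<times> {- r..r}))"
    by (intro compact_continuous_image compact_Times Suc compact_Icc)
      (auto simp: case_prod_unfold intro!: continuous_intros)
  moreover have "?f ` (?X n \<times> {- r..r}) = ?X (Suc n)"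
  proof (intro equalityI subsetI)
    fix y assume "y \<in> ?f ` (?X n \<times> {- r..r})"
    then obtain x t where y: "y = x + t *\<^sub>R unit_vec n" and x: "x \<in> ?X n" and t: "\<bar>t\<bar> \<le> r"
      by (auto simp: abs_le_iff)
    have "coeff y i = (if i = n then t else coeff x i)" for i
      using x by (auto simp: y lookup_add lookup_single when_def mem_coord_space_iff)
    then show "y \<in> ?X (Suc n)" using x t by (auto simp: mem_coord_space_iff)
  next
    fix y assume y: "y \<in> ?X (Suc n)"
    define x where "x = y - coeff y n *\<^sub>R unit_vec n"
    have c: "coeff x i = (if i = n then 0 else coeff y i)" for i
      by (auto simp: x_def lookup_minus lookup_single when_def)
    have "x \<in> ?X n" using y r by (auto simp: mem_coord_space_iff c)
    moreover have "\<bar>coeff y n\<bar> \<le> r" using y by blast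
    then have "coeff y n \<in> {- r..r}" by (simp add: abs_le_iff)
    moreover have "y = ?f (x, coeff y n)" by (simp add: x_def)
    ultimately show "y \<in> ?f ` (?X n \<times> {- r..r})" by blast
  qed
  ultimately show ?case by simp
qed

lemma convex_sum_le_1:
  assumes "convex K" "0 \<in> K" "finite I" "\<And>i. i \<in> I \<Longrightarrow> v i \<in> K" "\<And>i. i \<in> I \<Longrightarrow> 0 \<le> c i" "sum c I \<le> 1"
  shows "(\<Sum>i\<in>I. c i *\<^sub>R v i) \<in> K"
proof (cases "sum c I = 0")
  case True
  then have "\<forall>i\<in>I. c i = 0" using assms by (simp add: sum_nonneg_eq_0_iff)
  then show ?thesis using assms(2) by simp
next
  case False
  define s where "s = sum c I"
  have s: "0 < s" "s \<le> 1" using False assms by (auto simp: s_def order_less_le sum_nonneg)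
  have "(\<Sum>i\<in>I. (c i / s) *\<^sub>R v i) \<in> K"
    using assms s by (intro convex_sum) (auto simp: s_def sum_divide_distrib[symmetric])
  then have "s *\<^sub>R (\<Sum>i\<in>I. (c i / s) *\<^sub>R v i) + (1 - s) *\<^sub>R 0 \<in> K"
    using assms s by (intro convexD) auto
  then show ?thesis using s by (simp add: scaleR_sum_right)
qed

text \<open>The growth of the coefficients in the elimination below: the pivot coefficient is
  bounded by 1 plus \<open>k\<close> earlier ones.\<close>

lemma Suc_power_bound: "1 + real k * real k ^ k \<le> real (Suc k) ^ Suc k"
proof -
  have "real k ^ k \<le> real (Suc k) ^ k" by (intro power_mono) auto
  then have "real k * real k ^ k \<le> real k * real (Suc k) ^ k" by (intro mult_left_mono) auto
  moreover have "1 \<le> real (Suc k) ^ k" by (rule one_le_power) simp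
  ultimately have "1 + real k * real k ^ k \<le> real (Suc k) ^ k + real k * real (Suc k) ^ k" by linarith
  then show ?thesis by (simp add: algebra_simps)
qed

text \<open>Gaussian elimination with pivoting: the pivot vector has the largest last coordinate in \<open>C\<close>.\<close>

lemma pivot_basis_exists:
  assumes "compact C" "C \<subseteq> coord_space n" "coord_space n \<subseteq> span C"
  shows "\<exists>v. (\<forall>i<n. v i \<in> C) \<and> (\<forall>x\<in>coord_space n. \<exists>c. x = lincomb n c v) \<and>
    (\<forall>c. (lincomb n c v) \<in> C \<longrightarrow> (\<forall>i<n. \<bar>c i\<bar> \<le> real n ^ n))"
  using assms
proof (induction n arbitrary: C)
  case 0
  then show ?case by (auto simp: mem_coord_space_iff intro!: poly_mapping_eqI)
next
  case (Suc k)
  have "\<exists>v\<in>C. coeff v k \<noteq> 0"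
  proof (rule ccontr)
    assume "\<not> ?thesis"
    then have "C \<subseteq> {x. coeff x k = 0}" by auto
    moreover have "subspace {x. coeff x k = 0}" by (auto simp: subspace_def lookup_add)
    ultimately have "span C \<subseteq> {x. coeff x k = 0}" by (rule span_minimal)
    then have "coeff (unit_vec k) k = 0" using Suc.prems(3) unit_vec_coord_space[of k "Suc k"] by blast
    then show False by simp
  qed
  then obtain v0 where v0: "v0 \<in> C" "coeff v0 k \<noteq> 0" by blast
  obtain w where w: "w \<in> C" "\<And>x. x \<in> C \<Longrightarrow> \<bar>coeff x k\<bar> \<le> \<bar>coeff w k\<bar>"
  proof -
    have "continuous_on C (\<lambda>x. \<bar>coeff x k\<bar>)" by (intro continuous_intros)
    then show ?thesis using continuous_attains_sup[OF Suc.prems(1), of "\<lambda>x. \<bar>coeff x k\<bar>"] v0 that by blast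
  qed
  have wk: "coeff w k \<noteq> 0" using w(2)[OF v0(1)] v0(2) by auto
  define P where "P x = x - (coeff x k / coeff w k) *\<^sub>R w" for x
  have linP: "linear P"
    by (rule linearI) (auto simp: P_def lookup_add add_divide_distrib algebra_simps)
  have contP: "continuous_on C P" unfolding P_def using wk by (intro continuous_intros) auto
  have Pk: "coeff (P x) k = 0" for x using wk by (simp add: P_def lookup_minus)
  have Pid: "P x = x" if "x \<in> coord_space k" for x using that by (simp add: P_def mem_coord_space_iff)
  have mono: "coord_space k \<subseteq> coord_space (Suc k)" by (auto simp: coord_space_def)
  have "P ` C \<subseteq> coord_space k"
  proof
    fix y assume "y \<in> P ` C"
    then obtain x where x: "x \<in> C" "y = P x" by auto
    then have "y \<in> coord_space (Suc k)" unfolding x(2) P_def using w Suc.prems(2)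
      by (intro subspace_diff subspace_scale subspace_coord_space) auto
    then show "y \<in> coord_space k" using Pk[of x] x(2) unfolding mem_coord_space_iff
      by (metis le_SucE le_antisym not_less_eq_eq)
  qed
  moreover have "coord_space k \<subseteq> span (P ` C)"
  proof
    fix x assume x: "x \<in> coord_space k"
    then have "x \<in> span C" using mono Suc.prems(3) by blast
    then have "P x \<in> P ` span C" by blast
    then show "x \<in> span (P ` C)" using linear_span_image[OF linP, of C] Pid[OF x] by simp
  qed
  moreover have "compact (P ` C)" by (rule compact_continuous_image[OF contP Suc.prems(1)])
  ultimately obtain v' where v': "\<forall>i<k. v' i \<in> P ` C" "\<forall>x\<in>coord_space k. \<exists>c. x = lincomb k c v'"
    "\<forall>c. (lincomb k c v') \<in> P ` C \<longrightarrow> (\<forall>i<k. \<bar>c i\<bar> \<le> real k ^ k)"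
    using Suc.IH[of "P ` C"] by auto
  then have "\<forall>i. \<exists>u. i < k \<longrightarrow> u \<in> C \<and> v' i = P u" by blast
  then obtain u where u: "\<And>i. i < k \<Longrightarrow> u i \<in> C" "\<And>i. i < k \<Longrightarrow> v' i = P (u i)" by metis
  define v where "v i = (if i < k then u i else w)" for i
  have sumP: "P (lincomb k c u) = lincomb k c v'" for c
    by (simp add: linear_sum[OF linP] linear_scale[OF linP] u(2))
  have sumv: "lincomb (Suc k) c v = lincomb k c u + c k *\<^sub>R w" for c
    by (simp add: v_def)
  have Pw: "P w = 0" using wk by (simp add: P_def)
  show ?case
  proof (intro exI[of _ v] conjI allI impI ballI)
    show "v i \<in> C" for i using u w by (auto simp: v_def)
  next
    fix x assume x: "x \<in> coord_space (Suc k)"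
    have "P x \<in> coord_space (Suc k)" unfolding P_def using x w Suc.prems(2)
      by (intro subspace_diff subspace_scale subspace_coord_space) auto
    then have "P x \<in> coord_space k" using Pk[of x] unfolding mem_coord_space_iff
      by (metis le_SucE le_antisym not_less_eq_eq)
    then obtain c where c: "P x = lincomb k c v'" using v' by blast
    define y where "y = x - lincomb k c u"
    have "P y = 0" using c by (simp add: y_def linear_diff[OF linP] sumP)
    then have "y = (coeff y k / coeff w k) *\<^sub>R w" by (simp add: P_def)
    then have "x = (\<Sum>i<Suc k. (if i < k then c i else coeff y k / coeff w k) *\<^sub>R v i)"
      unfolding sumv by (simp add: y_def algebra_simps)
    then show "\<exists>c. x = lincomb (Suc k) c v"
      by (rule exI[of _ "\<lambda>i. if i < k then c i else coeff y k / coeff w k"])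
  next
    fix c i assume x: "lincomb (Suc k) c v \<in> C" and i: "i < Suc k"
    define x where "x = lincomb (Suc k) c v"
    have "P x = lincomb k c v'"
      unfolding x_def sumv by (simp add: linear_add[OF linP] sumP linear_scale[OF linP] Pw)
    moreover have "P x \<in> P ` C" using x by (intro imageI) (simp only: x_def)
    ultimately have ck: "\<bar>c i\<bar> \<le> real k ^ k" if "i < k" for i using v'(3) that by simp
    have "real k ^ k \<le> real (Suc k) ^ k" by (intro power_mono) auto
    also have "\<dots> \<le> real (Suc k) ^ Suc k" by (intro power_increasing) auto
    finally have kk: "real k ^ k \<le> real (Suc k) ^ Suc k" .
    show "\<bar>c i\<bar> \<le> real (Suc k) ^ Suc k"
    proof (cases "i < k")
      case True
      then show ?thesis using ck kk by force
    next
      case False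
      then have [simp]: "i = k" using i by simp
      \<comment> \<open>The last coefficient is read off from coordinate \<open>k\<close>. By the
        choice of the pivot, no coordinate occurring here exceeds
        \<open>\<bar>coeff w k\<bar>\<close>, which can therefore be cancelled.\<close>
      have "coeff x k = (\<Sum>i<k. c i * coeff (u i) k) + c k * coeff w k"
        unfolding x_def sumv by (simp add: lookup_add lookup_sum)
      then have "\<bar>c k * coeff w k\<bar> \<le> \<bar>coeff x k\<bar> + \<bar>\<Sum>i<k. c i * coeff (u i) k\<bar>" by linarith
      also have "\<bar>\<Sum>i<k. c i * coeff (u i) k\<bar> \<le> (\<Sum>i<k. real k ^ k * \<bar>coeff w k\<bar>)"
        using ck w u by (intro order_trans[OF sum_abs] sum_mono) (auto simp: abs_mult intro!: mult_mono)
      also have "\<bar>coeff x k\<bar> \<le> \<bar>coeff w k\<bar>" using w x by (simp add: x_def)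
      finally have "\<bar>c k\<bar> * \<bar>coeff w k\<bar> \<le> (1 + real k * real k ^ k) * \<bar>coeff w k\<bar>"
        by (simp add: abs_mult algebra_simps)
      then have "\<bar>c k\<bar> \<le> 1 + real k * real k ^ k" using wk by simp
      then show ?thesis using Suc_power_bound[of k] by simp
    qed
  qed
qed

text \<open>\<open>S\<close> sends the unit vectors to the pivot vectors divided by
  \<open>2 * n\<close>. Points of the \<open>l\<^sup>1\<close> unit ball around the all-ones vector
  have nonnegative coordinates with sum at most \<open>n + 1 \<le> 2 * n\<close>, so their images
  are convex combinations of 0 and pivot vectors. Preimages of \<open>K\<close> have coordinates at
  most \<open>2 * n * n ^ n\<close>, and summing \<open>n\<close> of them gives the radius.\<close>

lemma good_position:
  assumes n: "2 \<le> n" and K: "compact K" "convex K" "K \<subseteq> coord_space n" "0 \<in> K" "coord_space n \<subseteq> span K"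
  shows "\<exists>S. linear S \<and> S ` coord_space n = coord_space n \<and>
     compact {y \<in> coord_space n. S y \<in> K} \<and>
     (\<forall>x\<in>coord_space n. norm (x - (\<Sum>i<n. unit_vec i)) \<le> 1 \<longrightarrow> S x \<in> K) \<and>
     (\<forall>y\<in>coord_space n. S y \<in> K \<longrightarrow> norm y \<le> 2 * real n ^ (n + 2))"
proof -
  obtain v where v: "\<And>i. i < n \<Longrightarrow> v i \<in> K" "\<And>x. x \<in> coord_space n \<Longrightarrow> \<exists>c. x = lincomb n c v"
    "\<And>c i. (lincomb n c v) \<in> K \<Longrightarrow> i < n \<Longrightarrow> \<bar>c i\<bar> \<le> real n ^ n"
    using pivot_basis_exists[OF K(1,3,5)] by blast
  define S where "S y = (\<Sum>i<n. (coeff y i / (2 * real n)) *\<^sub>R v i)" for y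
  have linS: "linear S"
    by (rule linearI) (auto simp: S_def lookup_add add_divide_distrib scaleR_add_left sum.distrib scaleR_sum_right)
  have vV: "v i \<in> coord_space n" if "i < n" for i using v(1)[OF that] K(3) by blast
  have "S ` coord_space n = coord_space n"
  proof (intro equalityI subsetI)
    fix x assume "x \<in> S ` coord_space n"
    then show "x \<in> coord_space n" using vV
      by (auto simp: S_def intro!: subspace_sum[OF subspace_coord_space] subspace_scale[OF subspace_coord_space])
  next
    fix x assume "x \<in> coord_space n"
    then obtain c where c: "x = lincomb n c v" using v(2) by blast
    define y where "y = (\<Sum>i<n. (2 * real n * c i) *\<^sub>R unit_vec i)"
    have "y \<in> coord_space n" unfolding y_def by (rule sum_unit_vec_coord_space) simp
    moreover have "x = S y" using n by (simp add: S_def c y_def coeff_sum_unit_vec)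
    ultimately show "x \<in> S ` coord_space n" by blast
  qed
  moreover have bound: "\<bar>coeff y i\<bar> \<le> 2 * real n * real n ^ n" if y: "y \<in> coord_space n" "S y \<in> K" for y i
  proof (cases "i < n")
    case True
    have "\<bar>coeff y i / (2 * real n)\<bar> \<le> real n ^ n" using v(3)[OF _ True, of "\<lambda>i. coeff y i / (2 * real n)"] y(2) by (simp only: S_def)
    then show ?thesis using n by (simp add: abs_divide divide_le_eq mult_ac)
  qed (use y in \<open>simp add: mem_coord_space_iff\<close>)
  have "norm y \<le> 2 * real n ^ (n + 2)" if y: "y \<in> coord_space n" "S y \<in> K" for y
  proof -
    have "norm y \<le> (\<Sum>i<n. 2 * real n * real n ^ n)"
      unfolding norm_coord_space[OF y(1)] by (intro sum_mono bound[OF y])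
    then show ?thesis by (simp add: mult_ac)
  qed
  moreover have "compact {y \<in> coord_space n. S y \<in> K}"
  proof -
    have "closed (S -` K)" unfolding S_def
      using n by (intro closed_vimage compact_imp_closed K continuous_intros) auto
    then have "compact ({x \<in> coord_space n. \<forall>i. \<bar>coeff x i\<bar> \<le> 2 * real n * real n ^ n} \<inter> S -` K)"
      by (intro compact_Int_closed compact_coord_box) auto
    moreover have "{x \<in> coord_space n. \<forall>i. \<bar>coeff x i\<bar> \<le> 2 * real n * real n ^ n} \<inter> S -` K = {y \<in> coord_space n. S y \<in> K}"
      using bound by auto
    ultimately show ?thesis by simp
  qed
  moreover have "S x \<in> K" if x: "x \<in> coord_space n" and p: "norm (x - (\<Sum>i<n. unit_vec i)) \<le> 1" for x
  proof -
    let ?p = "\<Sum>i<n. unit_vec i"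
    have cp: "coeff ?p i = (if i < n then 1 else 0)" for i
      using coeff_sum_unit_vec[of "\<lambda>_. 1" n i] by simp
    have pV: "?p \<in> coord_space n" using sum_unit_vec_coord_space[of n n "\<lambda>_. 1"] by simp
    have xp: "x - ?p \<in> coord_space n" using x pV by (intro subspace_diff[OF subspace_coord_space])
    have s: "(\<Sum>i<n. \<bar>coeff x i - 1\<bar>) \<le> 1"
      using p unfolding norm_coord_space[OF xp] by (simp add: lookup_minus cp)
    have ge: "0 \<le> coeff x i" if "i < n" for i
      using member_le_sum[of i "{..<n}" "\<lambda>i. \<bar>coeff x i - 1\<bar>"] s that by auto
    have "(\<Sum>i<n. coeff x i) \<le> (\<Sum>i<n. 1 + \<bar>coeff x i - 1\<bar>)" by (intro sum_mono) auto
    also have "\<dots> \<le> real n + 1" using s by (simp add: sum.distrib)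
    also have "\<dots> \<le> 2 * real n" using n by simp
    finally have "(\<Sum>i<n. coeff x i / (2 * real n)) \<le> 1" using n by (simp add: sum_divide_distrib[symmetric])
    then show ?thesis unfolding S_def using ge v(1) n K by (intro convex_sum_le_1) auto
  qed
  ultimately show ?thesis using linS by blast
qed

subsection \<open>Planar sections from the Banach--Mazur distance\<close>

text \<open>The ball of radius \<open>1 + \<epsilon>\<close> around \<open>(1 + \<epsilon>) m + z\<close> contains the unit ball around \<open>m\<close>, so
  the two centres differ by at most \<open>\<epsilon>\<close>.\<close>

lemma concentric_ball_inside:
  fixes X :: "'a::real_normed_vector set"
  assumes e: "0 < \<epsilon>" and X: "X \<subseteq> cball m 1" "cball m 1 \<subseteq> (\<lambda>x. (1 + \<epsilon>) *\<^sub>R x + z) ` X"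
  shows "cball m (1 - 2 * \<epsilon>) \<subseteq> X"
proof
  define w where "w = z + \<epsilon> *\<^sub>R m"
  have w: "norm w \<le> \<epsilon>"
  proof (cases "w = 0")
    case False
    \<comment> \<open>The boundary point of the ball in the direction opposite to \<open>w\<close>.
      Its preimage under the homothety is at distance \<open>(norm w + 1) / (1 + \<epsilon>)\<close>
      from \<open>m\<close>, and this may not exceed 1.\<close>
    define v where "v = m - (1 / norm w) *\<^sub>R w"
    have "v \<in> cball m 1" using False by (simp add: v_def dist_norm)
    then obtain x where x: "x \<in> X" "v = (1 + \<epsilon>) *\<^sub>R x + z" using X(2) by blast
    have "norm (x - m) \<le> 1" using X(1) x(1) by (auto simp: dist_norm norm_minus_commute)
    then have "(1 + \<epsilon>) * norm (x - m) \<le> (1 + \<epsilon>) * 1" using e by (intro mult_left_mono) auto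
    moreover have "(1 + \<epsilon>) *\<^sub>R (x - m) = - ((1 + 1 / norm w) *\<^sub>R w)"
    proof -
      have "(1 + \<epsilon>) *\<^sub>R (x - m) = v - z - (1 + \<epsilon>) *\<^sub>R m" by (simp add: x(2) algebra_simps)
      also have "\<dots> = - ((1 + 1 / norm w) *\<^sub>R w)" by (simp add: v_def w_def algebra_simps)
      finally show ?thesis .
    qed
    then have "norm ((1 + \<epsilon>) *\<^sub>R (x - m)) = norm ((1 + 1 / norm w) *\<^sub>R w)" by (simp only: norm_minus_cancel)
    then have "(1 + \<epsilon>) * norm (x - m) = (1 + 1 / norm w) * norm w" using e by simp
    moreover have "(1 + 1 / norm w) * norm w = norm w + 1" using False by (simp add: field_simps)
    ultimately have "norm w + 1 \<le> (1 + \<epsilon>) * 1" by (simp only:)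
    then show ?thesis by simp
  qed (use e in auto)
  fix y assume y: "y \<in> cball m (1 - 2 * \<epsilon>)"
  define v where "v = (1 + \<epsilon>) *\<^sub>R (y - m) + w"
  have "norm (y - m) \<le> 1 - 2 * \<epsilon>" using y by (simp add: dist_norm norm_minus_commute)
  then have "(1 + \<epsilon>) * norm (y - m) \<le> (1 + \<epsilon>) * (1 - 2 * \<epsilon>)" using e by (intro mult_left_mono) auto
  also have "\<dots> = 1 - \<epsilon> - 2 * \<epsilon> * \<epsilon>" by (simp add: algebra_simps)
  also have "\<dots> \<le> 1 - \<epsilon>" using e by simp
  finally have "norm v \<le> 1" unfolding v_def
    using norm_triangle_ineq[of "(1 + \<epsilon>) *\<^sub>R (y - m)" w] w e by simp
  then have "m + v \<in> cball m 1" by (simp add: dist_norm)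
  then obtain x where x: "x \<in> X" "m + v = (1 + \<epsilon>) *\<^sub>R x + z" using X(2) by blast
  have "(1 + \<epsilon>) *\<^sub>R x = (1 + \<epsilon>) *\<^sub>R y"
  proof -
    have "(1 + \<epsilon>) *\<^sub>R x = m + v - z" by (simp add: x(2))
    also have "\<dots> = (1 + \<epsilon>) *\<^sub>R y" by (simp add: v_def w_def algebra_simps)
    finally show ?thesis .
  qed
  then have "x = y" using e by simp
  then show "y \<in> X" using x by simp
qed

text \<open>The dual basis, with functionals defined on the whole type, because
  \<open>near_quadric\<close> asks for a globally linear \<open>l\<close> and a global quadratic
  form.\<close>

lemma plane_basis_functionals:
  fixes E :: "'a::real_vector set"
  assumes E: "subspace E" "dim E = 2" and f: "f0 \<in> E" "f1 \<in> E" "E \<subseteq> span {f0, f1}"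
  shows "\<exists>c0 c1. linear c0 \<and> linear c1 \<and> c0 f0 = (1::real) \<and> c0 f1 = 0 \<and> c1 f0 = 0 \<and> c1 f1 = (1::real) \<and>
    (\<forall>z\<in>E. z = c0 z *\<^sub>R f0 + c1 z *\<^sub>R f1)"
proof -
  have single: False if "E \<subseteq> span {w}" for w
    using dim_le_card[OF that] E(2) by simp
  have n1: "f1 \<noteq> 0" using single[of f0] f(3) by (auto simp: insert_commute[of f0])
  have n0: "f0 \<notin> span {f1}"
  proof
    assume "f0 \<in> span {f1}"
    then have "span {f0, f1} = span {f1}" by (rule span_redundant)
    then show False using single f(3) by simp
  qed
  then have ne: "f0 \<noteq> f1" using span_base[of f1 "{f1}"] by auto
  have ind: "independent {f0, f1}" using n0 n1 ne by (simp add: independent_insert)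
  obtain c0 where c0: "linear c0" "c0 f0 = (1::real)" "c0 f1 = 0"
    using linear_independent_extend[OF ind, of "\<lambda>x. if x = f0 then 1 else 0"] ne by auto
  obtain c1 where c1: "linear c1" "c1 f0 = 0" "c1 f1 = (1::real)"
    using linear_independent_extend[OF ind, of "\<lambda>x. if x = f1 then 1 else 0"] ne by auto
  have "z = c0 z *\<^sub>R f0 + c1 z *\<^sub>R f1" if "z \<in> E" for z
  proof -
    have "z \<in> span {f0, f1}" using that f by blast
    then obtain k where "z - k *\<^sub>R f0 \<in> span {f1}" by (auto simp: span_breakdown_eq)
    then obtain l where "z - k *\<^sub>R f0 = l *\<^sub>R f1" by (auto simp: span_singleton)
    then have z: "z = k *\<^sub>R f0 + l *\<^sub>R f1" by (simp add: algebra_simps)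
    have "c0 z = k" "c1 z = l" using c0 c1 by (auto simp: z linear_add linear_scale)
    then show ?thesis using z by simp
  qed
  then show ?thesis using c0 c1 by blast
qed

lemma affine_coord_2:
  assumes T: "affine_map_between (coord_space 2) E T" and y: "y \<in> coord_space 2"
  shows "T y = T 0 + coeff y 0 *\<^sub>R (T (unit_vec 0) - T 0) + coeff y 1 *\<^sub>R (T (unit_vec 1) - T 0)"
proof -
  note S = subspace_coord_space[of 2]
  have aff: "T ((1 - t) *\<^sub>R x + t *\<^sub>R y) = (1 - t) *\<^sub>R T x + t *\<^sub>R T y"
    if "x \<in> coord_space 2" "y \<in> coord_space 2" for x y t
    using T that by (auto simp: affine_map_between_def)
  have z: "(0 :: nat \<Rightarrow>\<^sub>0 real) \<in> coord_space 2" using S by (rule subspace_0)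
  have sc: "T (t *\<^sub>R x) = T 0 + t *\<^sub>R (T x - T 0)" if "x \<in> coord_space 2" for t x
    using aff[OF z that, of t] by (simp add: algebra_simps)
  have u: "unit_vec 0 \<in> coord_space 2" "unit_vec 1 \<in> coord_space 2" by (auto intro!: unit_vec_coord_space[where n=2, of 0, simplified] unit_vec_coord_space)
  \<comment> \<open>Affinity is given for two-point combinations only, so \<open>y\<close> is
    written as the midpoint of two doubled axis vectors.\<close>
  let ?a = "(2 * coeff y 0) *\<^sub>R unit_vec 0" and ?b = "(2 * coeff y 1) *\<^sub>R unit_vec 1"
  have "y = (1 - 1 / 2) *\<^sub>R ?a + (1 / 2) *\<^sub>R ?b"
    using coord_space_expand[OF y] by (simp add: numeral_2_eq_2)
  then have "T y = (1 - 1 / 2) *\<^sub>R T ?a + (1 / 2) *\<^sub>R T ?b"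
    using aff[of ?a ?b "1 / 2"] u S by (simp add: subspace_scale)
  then show ?thesis unfolding sc[OF u(1)] sc[OF u(2)] by (simp add: algebra_simps flip: scaleR_add_left)
qed

abbreviation (input) disc :: "(nat \<Rightarrow>\<^sub>0 real) set" where "disc \<equiv> euclidean_unit_ball 2"

lemma affine_plane_map:
  assumes "subspace E" "f0 \<in> E" "f1 \<in> E"
  shows "affine_map_between (coord_space 2) E (\<lambda>y. coeff y 0 *\<^sub>R f0 + coeff y 1 *\<^sub>R f1)"
  unfolding affine_map_between_def using assms
  by (auto simp: subspace_add subspace_scale lookup_add scaleR_add_left scaleR_add_right)

lemma mem_disc_iff:
  "y \<in> disc \<longleftrightarrow> y \<in> coord_space 2 \<and> (coeff y 0)\<^sup>2 + (coeff y 1)\<^sup>2 \<le> 1"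
  by (auto simp: euclidean_unit_ball_def numeral_2_eq_2)

lemma unit_ball_2_point:
  assumes "s\<^sup>2 + t\<^sup>2 \<le> 1"
  shows "\<exists>y\<in>disc. coeff y 0 = s \<and> coeff y 1 = t"
proof -
  define y where "y = (\<Sum>i<2. (if i = 0 then s else t) *\<^sub>R unit_vec i)"
  have "y \<in> coord_space 2" unfolding y_def by (rule sum_unit_vec_coord_space) simp
  moreover have "coeff y 0 = s" "coeff y 1 = t" by (auto simp: y_def coeff_sum_unit_vec)
  ultimately show ?thesis using assms by (auto simp: mem_disc_iff)
qed

lemma small_multiple_exists:
  fixes x :: "'a::real_normed_vector"
  assumes "0 < d" shows "\<exists>t>0. norm (t *\<^sub>R x) \<le> d"
proof (intro exI conjI)
  have n: "0 < norm x + 1" by (simp add: add_nonneg_pos)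
  then show "0 < d / (norm x + 1)" using assms by simp
  have "d * norm x \<le> d * (norm x + 1)" using assms by (intro mult_left_mono) auto
  then show "norm ((d / (norm x + 1)) *\<^sub>R x) \<le> d" using n assms by (simp add: divide_le_eq)
qed

text \<open>The distance hypothesis concerns genuine planes, whereas \<open>x\<close> and
  \<open>y\<close> may be dependent or 0. Hence an independent subset is enlarged to two elements of
  a basis.\<close>

lemma plane_containing_exists:
  assumes n: "2 \<le> n" and xy: "x \<in> coord_space n" "y \<in> coord_space n"
  shows "\<exists>E. subspace E \<and> E \<subseteq> coord_space n \<and> dim E = 2 \<and> x \<in> E \<and> y \<in> E"
proof -
  obtain A where A: "A \<subseteq> {x, y}" "independent A" "{x, y} \<subseteq> span A"
    using maximal_independent_subset[of "{x, y}"] by blast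
  have "A \<subseteq> coord_space n" using A xy by auto
  then obtain B where B: "A \<subseteq> B" "B \<subseteq> coord_space n" "independent B" "coord_space n \<subseteq> span B"
    using maximal_independent_subset_extend[of A "coord_space n"] A(2) by blast
  have "card B = n" using basis_card_eq_dim[OF B(2,4,3)] by (simp add: dim_coord_space)
  then have fB: "finite B" "2 \<le> card B" using n card.infinite by (fastforce, simp)
  have "card A \<le> card {x, y}" using A by (intro card_mono) auto
  also have "\<dots> \<le> 2" by (simp add: card_insert_if)
  finally have "card A \<le> 2" .
  then obtain C where C: "A \<subseteq> C" "C \<subseteq> B" "card C = 2"
    using exists_subset_between[OF _ fB(2) B(1) fB(1)] by blast
  have "independent C" using B(3) C(2) by (rule independent_mono)
  then have "dim (span C) = 2" using C(3) dim_eq_card_independent[of C] by (simp add: dim_span)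
  moreover have "span C \<subseteq> coord_space n"
    using C B by (intro span_minimal subspace_coord_space) auto
  moreover have "{x, y} \<subseteq> span C" using A(3) span_mono[OF C(1)] by blast
  ultimately show ?thesis by (intro exI[of _ "span C"]) auto
qed

context
  fixes K :: "(nat \<Rightarrow>\<^sub>0 real) set" and n :: nat and b d :: real
  assumes bd: "\<And>x. x \<in> K \<Longrightarrow> norm x \<le> b" and b: "0 < b"
    and int: "\<And>x. x \<in> coord_space n \<Longrightarrow> norm x \<le> d \<Longrightarrow> x \<in> K" and d: "0 < d"
begin

text \<open>\<open>Inf\<close> of the empty set is unspecified, so the following is needed to extract anything from a bound on
  the distance.\<close>

lemma banach_mazur_set_nonempty:
  assumes E: "subspace E" "E \<subseteq> coord_space n" "dim E = 2"
  shows "\<exists>r>0. \<exists>T z. affine_map_between (coord_space 2) E T \<and> z \<in> E \<and>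
     K \<inter> E \<subseteq> T ` disc \<and> T ` disc \<subseteq> (\<lambda>x. r *\<^sub>R x + z) ` (K \<inter> E)"
proof -
  obtain B where B: "B \<subseteq> E" "E \<subseteq> span B" "card B = 2"
    using basis_exists[of E] E(3) by metis
  obtain f0 f1 where f: "B = {f0, f1}" using B(3) by (meson card_2_iff)
  have fE: "f0 \<in> E" "f1 \<in> E" "E \<subseteq> span {f0, f1}" using B f by auto
  obtain c0 c1 where lin: "linear c0" "linear c1" and c: "c0 f0 = (1::real)" "c0 f1 = 0" "c1 f0 = 0" "c1 f1 = (1::real)"
    and rep: "\<And>z. z \<in> E \<Longrightarrow> z = c0 z *\<^sub>R f0 + c1 z *\<^sub>R f1"
    using plane_basis_functionals[OF E(1,3) fE] by blast
  define g where "g z = Re z *\<^sub>R f0 + Im z *\<^sub>R f1" for z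
  have cg: "c0 (g z) = Re z" "c1 (g z) = Im z" for z
    using c lin by (auto simp: g_def linear_add linear_scale)
  have gE: "g z \<in> E" for z using fE E(1) by (simp add: g_def subspace_add subspace_scale)
  have grep: "w = g (Complex (c0 w) (c1 w))" if "w \<in> E" for w using rep[OF that] by (simp add: g_def)
  have gsc: "g (r *\<^sub>R z) = r *\<^sub>R g z" for r z by (simp add: g_def scaleR_add_right)
  have contg: "continuous_on (sphere 0 1) (\<lambda>z. norm (g z))" unfolding g_def by (intro continuous_intros)
  have ne: "sphere (0::complex) 1 \<noteq> {}" by simp
  obtain z0 where z0: "z0 \<in> sphere 0 1" "\<forall>z\<in>sphere 0 1. norm (g z0) \<le> norm (g z)"
    using continuous_attains_inf[OF compact_sphere ne contg] by blast
  \<comment> \<open>The least norm on the image of the unit circle. It is the constant of norm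
    equivalence on \<open>E\<close>, and stretching by \<open>b / k\<close> makes the image of the
    disc swallow \<open>K \<inter> E\<close>.\<close>
  define k where "k = norm (g z0)"
  have "g z0 \<noteq> 0"
  proof
    assume "g z0 = 0"
    then have "Re z0 = 0" "Im z0 = 0" using cg[of z0] lin by (auto simp: linear_0)
    then have "z0 = 0" by (simp add: complex_eq_iff)
    then show False using z0(1) by simp
  qed
  then have k: "0 < k" by (simp add: k_def)
  have lower: "k * cmod z \<le> norm (g z)" for z
  proof (cases "z = 0")
    case False
    have "k \<le> norm (g ((1 / cmod z) *\<^sub>R z))" unfolding k_def using z0(2) False by simp
    then show ?thesis using False by (simp add: gsc field_simps)
  qed simp
  define T where "T y = coeff y 0 *\<^sub>R ((b / k) *\<^sub>R f0) + coeff y 1 *\<^sub>R ((b / k) *\<^sub>R f1)" for y :: "nat \<Rightarrow>\<^sub>0 real"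
  have T: "affine_map_between (coord_space 2) E T"
    unfolding T_def using fE E(1) by (intro affine_plane_map) (auto simp: subspace_scale)
  have Tg: "T y = (b / k) *\<^sub>R g (Complex (coeff y 0) (coeff y 1))" for y
    by (simp add: T_def g_def scaleR_add_right mult.commute)
  have 1: "K \<inter> E \<subseteq> T ` disc"
  proof
    fix w assume w: "w \<in> K \<inter> E"
    define u where "u = (k / b) *\<^sub>R Complex (c0 w) (c1 w)"
    have "k * cmod (Complex (c0 w) (c1 w)) \<le> norm w" using lower[of "Complex (c0 w) (c1 w)"] grep[of w] w by simp
    then have "cmod u \<le> 1" using bd[of w] w b k by (simp add: u_def divide_le_eq_1)
    then have "(cmod u)\<^sup>2 \<le> 1" by (simp add: power_le_one)
    then have "(Re u)\<^sup>2 + (Im u)\<^sup>2 \<le> 1" by (simp add: cmod_power2)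
    then obtain y where y: "y \<in> disc" "coeff y 0 = Re u" "coeff y 1 = Im u"
      using unit_ball_2_point by blast
    have "T y = (b / k) *\<^sub>R g u" by (simp only: Tg y complex_surj)
    also have "\<dots> = g (Complex (c0 w) (c1 w))" using b k by (simp add: u_def gsc)
    also have "\<dots> = w" using grep w by simp
    finally show "w \<in> T ` disc" using y(1) by blast
  qed
  define N where "N = (b / k) * (norm f0 + norm f1)"
  have N: "0 \<le> N" using b k by (simp add: N_def)
  define r where "r = N / d + 1"
  have r: "0 < r" using N d by (simp add: r_def add_nonneg_pos)
  have 2: "T ` disc \<subseteq> (\<lambda>x. r *\<^sub>R x + 0) ` (K \<inter> E)"
  proof
    fix x assume "x \<in> T ` disc"
    then obtain y where y: "x = T y" "y \<in> disc" by blast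
    have xE: "x \<in> E" using T y by (auto simp: affine_map_between_def mem_disc_iff)
    have "(coeff y 0)\<^sup>2 + (coeff y 1)\<^sup>2 \<le> 1" using y(2) by (simp add: mem_disc_iff)
    moreover have "0 \<le> (coeff y 0)\<^sup>2" "0 \<le> (coeff y 1)\<^sup>2" by auto
    ultimately have "(coeff y 0)\<^sup>2 \<le> 1" "(coeff y 1)\<^sup>2 \<le> 1" by linarith+
    then have yb: "\<bar>coeff y 0\<bar> \<le> 1" "\<bar>coeff y 1\<bar> \<le> 1" by (simp_all only: abs_square_le_1)
    have "\<bar>coeff y 0\<bar> * norm ((b / k) *\<^sub>R f0) \<le> 1 * norm ((b / k) *\<^sub>R f0)"
      "\<bar>coeff y 1\<bar> * norm ((b / k) *\<^sub>R f1) \<le> 1 * norm ((b / k) *\<^sub>R f1)"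
      by (rule mult_right_mono[OF yb(1) norm_ge_zero], rule mult_right_mono[OF yb(2) norm_ge_zero])
    moreover have "norm x \<le> \<bar>coeff y 0\<bar> * norm ((b / k) *\<^sub>R f0) + \<bar>coeff y 1\<bar> * norm ((b / k) *\<^sub>R f1)"
      unfolding y(1) T_def by (rule order_trans[OF norm_triangle_ineq]) (simp only: norm_scaleR order_refl)
    ultimately have "norm x \<le> 1 * norm ((b / k) *\<^sub>R f0) + 1 * norm ((b / k) *\<^sub>R f1)" by linarith
    also have "\<dots> = N" using b k by (simp add: N_def algebra_simps)
    finally have "norm x \<le> N" .
    moreover have "r * d = N + d" using d by (simp add: r_def distrib_right)
    ultimately have "norm x \<le> r * d" using d by linarith
    then have "norm ((1 / r) *\<^sub>R x) \<le> d" using r by (simp add: divide_le_eq mult.commute)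
    then have "(1 / r) *\<^sub>R x \<in> K \<inter> E" using xE E by (auto intro!: int simp: subspace_scale)
    moreover have "x = r *\<^sub>R ((1 / r) *\<^sub>R x) + 0" using r by simp
    ultimately show "x \<in> (\<lambda>x. r *\<^sub>R x + 0) ` (K \<inter> E)" by blast
  qed
  show ?thesis using r T 1 2 subspace_0[OF E(1)] by blast
qed

text \<open>A distance below \<open>1 + \<epsilon>\<close> gives an actual affine image of the disc
  around the section. In complex coordinates \<open>Z\<close> that make this image a unit disc, the
  quadratic function is one minus the squared distance to its centre, and
  \<open>concentric_ball_inside\<close> with
  \<open>(1 - 2 * \<epsilon>)\<^sup>2 \<ge> 1 - 4 * \<epsilon>\<close> gives the inner
  inclusion.\<close>

lemma plane_section:
  assumes E: "subspace E" "E \<subseteq> coord_space n" "dim E = 2" and K: "convex K" "K \<subseteq> coord_space n"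
    and e: "0 < \<epsilon>" "\<epsilon> \<le> 1 / 2"
    and bm: "banach_mazur_dist E (K \<inter> E) (coord_space 2) (disc) < 1 + \<epsilon>"
  shows "\<exists>k l q m. linear l \<and> quadratic_form q \<and> m \<in> E \<and>
     (\<forall>z\<in>E. (z \<in> K \<longrightarrow> 0 \<le> k + l z - q z) \<and> (4 * \<epsilon> \<le> k + l z - q z \<longrightarrow> z \<in> K)) \<and>
     (\<forall>z\<in>E. k + l (m + z) - q (m + z) = 1 - q z) \<and> (\<forall>z\<in>E. 0 \<le> q z)"
proof -
  let ?S = "{r. r > 0 \<and> (\<exists>T z. affine_map_between (coord_space 2) E T \<and> z \<in> E \<and>
     K \<inter> E \<subseteq> T ` disc \<and> T ` disc \<subseteq> (\<lambda>x. r *\<^sub>R x + z) ` (K \<inter> E))}"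
  have "?S \<noteq> {}" using banach_mazur_set_nonempty[OF E] by blast
  then have "\<exists>r\<in>?S. r < 1 + \<epsilon>" using bm unfolding banach_mazur_dist_def by (rule cInf_lessD)
  then obtain r T z where r: "0 < r" "r < 1 + \<epsilon>" and T: "affine_map_between (coord_space 2) E T" and z: "z \<in> E"
    and KT: "K \<inter> E \<subseteq> T ` disc"
    and TK: "T ` disc \<subseteq> (\<lambda>x. r *\<^sub>R x + z) ` (K \<inter> E)" by blast
  define f0 where "f0 = T (unit_vec 0) - T 0"
  define f1 where "f1 = T (unit_vec 1) - T 0"
  have Ty: "T y = T 0 + coeff y 0 *\<^sub>R f0 + coeff y 1 *\<^sub>R f1" if "y \<in> coord_space 2" for y
    unfolding f0_def f1_def by (rule affine_coord_2[OF T that])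
  have TE: "T y \<in> E" if "y \<in> coord_space 2" for y using T that by (auto simp: affine_map_between_def)
  have u: "unit_vec 0 \<in> coord_space 2" "unit_vec 1 \<in> coord_space 2" "(0 :: nat \<Rightarrow>\<^sub>0 real) \<in> coord_space 2"
    by (rule unit_vec_coord_space, simp)+ (simp add: mem_coord_space_iff)
  have fE: "f0 \<in> E" "f1 \<in> E" using TE u E(1) by (auto simp: f0_def f1_def subspace_diff)
  \<comment> \<open>\<open>T\<close> is only known to be affine. Its linear part is onto
    \<open>E\<close> because the image of the disc contains all small vectors of
    \<open>E\<close>.\<close>
  have spanE: "E \<subseteq> span {f0, f1}"
  proof
    fix w assume w: "w \<in> E"
    obtain t where t: "0 < t" "norm (t *\<^sub>R w) \<le> d" using small_multiple_exists[OF d] by blast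
    then have "t *\<^sub>R w \<in> K \<inter> E" using w E by (auto intro!: int simp: subspace_scale simp del: norm_scaleR)
    moreover have "0 \<in> K \<inter> E" using d E by (auto intro!: int simp: subspace_0)
    ultimately have "t *\<^sub>R w \<in> T ` disc" "0 \<in> T ` disc" using KT by blast+
    then obtain y y' where y: "t *\<^sub>R w = T y" "0 = T y'" and "y \<in> disc" "y' \<in> disc"
      by blast
    then have "y \<in> coord_space 2" "y' \<in> coord_space 2" by (auto simp: mem_disc_iff)
    have "t *\<^sub>R w = T y - T y'" using y by simp
    also have "\<dots> = (coeff y 0 - coeff y' 0) *\<^sub>R f0 + (coeff y 1 - coeff y' 1) *\<^sub>R f1"
      using Ty \<open>y \<in> coord_space 2\<close> \<open>y' \<in> coord_space 2\<close> by (simp add: algebra_simps)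
    also have "\<dots> \<in> span {f0, f1}" by (intro span_add span_scale span_base) auto
    finally have "(1 / t) *\<^sub>R (t *\<^sub>R w) \<in> span {f0, f1}" by (rule span_scale)
    then show "w \<in> span {f0, f1}" using t(1) by simp
  qed
  obtain c0 c1 where lin: "linear c0" "linear c1" and c: "c0 f0 = (1::real)" "c0 f1 = 0" "c1 f0 = 0" "c1 f1 = (1::real)"
    and rep: "\<And>z. z \<in> E \<Longrightarrow> z = c0 z *\<^sub>R f0 + c1 z *\<^sub>R f1"
    using plane_basis_functionals[OF E(1,3) fE spanE] by blast
  define Z where "Z w = Complex (c0 w) (c1 w)" for w
  have Zadd: "Z (v + w) = Z v + Z w" and Zscale: "Z (s *\<^sub>R v) = s *\<^sub>R Z v" for v w s
    using lin by (auto simp: Z_def linear_add linear_scale complex_eq_iff)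
  have Zinj: "v = w" if "v \<in> E" "w \<in> E" "Z v = Z w" for v w
    using rep[OF that(1)] rep[OF that(2)] that(3) by (simp add: Z_def)
  define m where "m = T 0"
  have mE: "m \<in> E" using TE u by (simp add: m_def)
  have ZT: "Z (T y) = Z m + Complex (coeff y 0) (coeff y 1)" if "y \<in> coord_space 2" for y
    using c lin by (simp add: Ty[OF that] Z_def m_def complex_eq_iff linear_add linear_scale)
  have ball: "Z ` T ` disc = cball (Z m) 1"
  proof (intro equalityI subsetI)
    fix x assume "x \<in> Z ` T ` disc"
    then obtain y where y: "y \<in> disc" "x = Z (T y)" by blast
    have "x = Z m + Complex (coeff y 0) (coeff y 1)" using y by (simp add: ZT mem_disc_iff)
    moreover have "cmod (Complex (coeff y 0) (coeff y 1)) \<le> 1"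
      using y by (simp add: complex_norm mem_disc_iff)
    ultimately show "x \<in> cball (Z m) 1" by (simp add: dist_norm)
  next
    fix x assume "x \<in> cball (Z m) 1"
    then have "(cmod (x - Z m))\<^sup>2 \<le> 1" by (simp add: dist_norm norm_minus_commute power_le_one)
    then have "(Re (x - Z m))\<^sup>2 + (Im (x - Z m))\<^sup>2 \<le> 1" by (simp add: cmod_power2)
    then obtain y where y: "y \<in> disc" "coeff y 0 = Re (x - Z m)" "coeff y 1 = Im (x - Z m)"
      using unit_ball_2_point by blast
    then have "Complex (coeff y 0) (coeff y 1) = x - Z m" by (simp only: complex_surj)
    then have "x = Z (T y)" using ZT[of y] y(1) by (simp add: mem_disc_iff)
    then show "x \<in> Z ` T ` disc" using y(1) by blast
  qed
  have zK: "0 \<in> K" using d by (auto intro!: int simp: mem_coord_space_iff)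
  have X1: "Z ` (K \<inter> E) \<subseteq> cball (Z m) 1" using image_mono[OF KT, of Z] unfolding ball .
  have X2: "cball (Z m) 1 \<subseteq> (\<lambda>x. (1 + \<epsilon>) *\<^sub>R x + Z z) ` Z ` (K \<inter> E)"
  proof
    fix x assume "x \<in> cball (Z m) 1"
    then have "x \<in> Z ` (\<lambda>x. r *\<^sub>R x + z) ` (K \<inter> E)" using image_mono[OF TK, of Z] unfolding ball by (rule rev_subsetD)
    then obtain w where w: "w \<in> K \<inter> E" "x = Z (r *\<^sub>R w + z)" by (elim imageE) simp
    \<comment> \<open>The factor \<open>r\<close> obtained from the infimum is raised to exactly
      \<open>1 + \<epsilon>\<close> by shrinking \<open>w\<close> towards 0, which stays in
      \<open>K\<close>.\<close>
    define s where "s = r / (1 + \<epsilon>)"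
    have s: "0 < s" "s \<le> 1" "(1 + \<epsilon>) * s = r" using r e by (auto simp: s_def)
    have "s *\<^sub>R w + (1 - s) *\<^sub>R 0 \<in> K" using w zK s by (intro convexD[OF K(1)]) auto
    then have "s *\<^sub>R w \<in> K \<inter> E" using w E by (simp add: subspace_scale)
    moreover have "x = (1 + \<epsilon>) *\<^sub>R Z (s *\<^sub>R w) + Z z" using s(3) by (simp add: w Zadd Zscale)
    ultimately show "x \<in> (\<lambda>x. (1 + \<epsilon>) *\<^sub>R x + Z z) ` Z ` (K \<inter> E)" by blast
  qed
  have X3: "cball (Z m) (1 - 2 * \<epsilon>) \<subseteq> Z ` (K \<inter> E)" by (rule concentric_ball_inside[OF e(1) X1 X2])
  define k where "k = 1 - (c0 m)\<^sup>2 - (c1 m)\<^sup>2"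
  define l where "l w = 2 * c0 m * c0 w + 2 * c1 m * c1 w" for w
  define q where "q w = (c0 w)\<^sup>2 + (c1 w)\<^sup>2" for w
  have linl: "linear l" using lin by (intro linearI) (auto simp: l_def linear_add linear_scale algebra_simps)
  have quadq: "quadratic_form q"
    unfolding quadratic_form_def q_def using lin by (auto simp: linear_add linear_scale power2_eq_square algebra_simps)
  have Phi: "k + l w - q w = 1 - (cmod (Z w - Z m))\<^sup>2" for w
  proof -
    have "(cmod (Z w - Z m))\<^sup>2 = (c0 w - c0 m)\<^sup>2 + (c1 w - c1 m)\<^sup>2" by (simp add: Z_def cmod_power2)
    then show ?thesis by (simp add: k_def l_def q_def power2_eq_square algebra_simps)
  qed
  have "(z \<in> K \<longrightarrow> 0 \<le> k + l z - q z) \<and> (4 * \<epsilon> \<le> k + l z - q z \<longrightarrow> z \<in> K)" if zE: "z \<in> E" for z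
  proof (intro conjI impI)
    assume "z \<in> K"
    then have "cmod (Z z - Z m) \<le> 1" using X1 zE by (auto simp: dist_norm norm_minus_commute)
    then show "0 \<le> k + l z - q z" unfolding Phi by (simp add: power_le_one)
  next
    assume "4 * \<epsilon> \<le> k + l z - q z"
    then have "(cmod (Z z - Z m))\<^sup>2 \<le> 1 - 4 * \<epsilon>" unfolding Phi by simp
    also have "\<dots> \<le> (1 - 2 * \<epsilon>)\<^sup>2" by (simp add: power2_eq_square algebra_simps)
    finally have sq: "(cmod (Z z - Z m))\<^sup>2 \<le> (1 - 2 * \<epsilon>)\<^sup>2" .
    have "cmod (Z z - Z m) \<le> 1 - 2 * \<epsilon>" using power2_le_imp_le[OF sq] e by simp
    then have "Z z \<in> cball (Z m) (1 - 2 * \<epsilon>)" by (simp add: dist_norm norm_minus_commute)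
    then have "Z z \<in> Z ` (K \<inter> E)" using X3 by (rule rev_subsetD)
    then obtain w where "w \<in> K \<inter> E" "Z z = Z w" by (rule imageE)
    then show "z \<in> K" using Zinj[OF zE, of w] by simp
  qed
  moreover have "k + l (m + w) - q (m + w) = 1 - q w" for w
    using lin by (simp add: k_def l_def q_def linear_add power2_eq_square algebra_simps)
  ultimately show ?thesis using linl quadq mE
    by (intro exI[of _ k] exI[of _ l] exI[of _ q] exI[of _ m]) (auto simp: q_def)
qed

text \<open>The section by a genuine plane containing \<open>S x\<close> and \<open>S y\<close> is
  pulled back along \<open>S\<close>. The clause on the semi-axes comes from the radius bound on the
  pulled back body, applied to two points symmetric about a preimage of the centre.\<close>

lemma near_quadric_pullback:
  assumes n: "2 \<le> n" and K: "convex K" "K \<subseteq> coord_space n"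
    and h: "0 < h" "h\<^sup>2 \<le> 1 / 16"
    and bm: "\<And>E. subspace E \<Longrightarrow> E \<subseteq> coord_space n \<Longrightarrow> dim E = 2 \<Longrightarrow>
          banach_mazur_dist E (K \<inter> E) (coord_space 2) (disc) < 1 + h\<^sup>2"
    and S: "linear S" "S ` coord_space n = coord_space n"
    and R: "\<And>y. y \<in> coord_space n \<Longrightarrow> S y \<in> K \<Longrightarrow> norm y \<le> R"
    and xy: "x \<in> coord_space n" "y \<in> coord_space n"
  shows "\<exists>k l q. near_quadric {y \<in> coord_space n. S y \<in> K} R h (span {x, y}) k l q"
proof -
  let ?K = "{y \<in> coord_space n. S y \<in> K}"
  have "S x \<in> coord_space n" "S y \<in> coord_space n" using S xy by auto
  then obtain E where E: "subspace E" "E \<subseteq> coord_space n" "dim E = 2" and SE: "S x \<in> E" "S y \<in> E"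
    using plane_containing_exists[OF n] by metis
  have h2: "0 < h\<^sup>2" "h\<^sup>2 \<le> 1 / 2" using h by auto
  have "\<exists>k l q m. linear l \<and> quadratic_form q \<and> m \<in> E \<and>
     (\<forall>z\<in>E. (z \<in> K \<longrightarrow> 0 \<le> k + l z - q z) \<and> (4 * h\<^sup>2 \<le> k + l z - q z \<longrightarrow> z \<in> K)) \<and>
     (\<forall>z\<in>E. k + l (m + z) - q (m + z) = 1 - q z) \<and> (\<forall>z\<in>E. 0 \<le> q z)"
    by (rule plane_section[OF E K h2 bm[OF E]])
  then obtain k l q m where lq: "linear l" "quadratic_form q" and m: "m \<in> E"
    and P: "\<forall>z\<in>E. (z \<in> K \<longrightarrow> 0 \<le> k + l z - q z) \<and> (4 * h\<^sup>2 \<le> k + l z - q z \<longrightarrow> z \<in> K)"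
    and C: "\<forall>z\<in>E. k + l (m + z) - q (m + z) = 1 - q z" and q0: "\<forall>z\<in>E. 0 \<le> q z"
    by (elim exE conjE)
  have span_V: "z \<in> coord_space n" if "z \<in> span {x, y}" for z
    using that span_minimal[of "{x, y}" "coord_space n"] xy subspace_coord_space by auto
  have span_E: "S z \<in> E" if "z \<in> span {x, y}" for z
  proof -
    have "S z \<in> span (S ` {x, y})" using that linear_span_image[OF S(1), of "{x, y}"] by blast
    then show ?thesis using span_minimal[of "S ` {x, y}" E] SE E(1) by auto
  qed
  have le1: "k + l z - q z \<le> 1" if "z \<in> E" for z
  proof -
    have "z - m \<in> E" using that m E(1) by (simp add: subspace_diff)
    then show ?thesis using C[rule_format, of "z - m"] q0[rule_format, of "z - m"] by simp
  qed
  have "m \<in> S ` coord_space n" using m E(2) S(2) by auto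
  then obtain m' where m': "m' \<in> coord_space n" "m = S m'" by blast
  have lower: "(norm z)\<^sup>2 \<le> 4 * R\<^sup>2 * q (S z)" if z: "z \<in> span {x, y}" for z
  proof -
    have zV: "z \<in> coord_space n" and SzE: "S z \<in> E" using span_V span_E z by auto
    \<comment> \<open>Where \<open>q\<close> is at most 3/4 the function is at least 1/4, and 1/4 is
      at least \<open>4 * h\<^sup>2\<close>. So both points \<open>m' + s *\<^sub>R z\<close> and
      \<open>m' - s *\<^sub>R z\<close> are in the body, and their distance is at most
      \<open>2 * R\<close>.\<close>
    have half: "s * norm z \<le> R" if s: "s\<^sup>2 * q (S z) \<le> 3 / 4" "0 \<le> s" for s
    proof -
      have "norm (m' + t *\<^sub>R z) \<le> R" if t: "t\<^sup>2 = s\<^sup>2" for t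
      proof (rule R)
        show "m' + t *\<^sub>R z \<in> coord_space n" using m' zV
          by (intro subspace_add[OF subspace_coord_space] subspace_scale[OF subspace_coord_space])
        have tE: "t *\<^sub>R S z \<in> E" using SzE E(1) by (simp add: subspace_scale)
        have "q (t *\<^sub>R S z) \<le> 3 / 4" using s t lq by (simp add: quadratic_form_scale)
        then have "4 * h\<^sup>2 \<le> k + l (m + t *\<^sub>R S z) - q (m + t *\<^sub>R S z)" using C tE h by simp
        moreover have "m + t *\<^sub>R S z \<in> E" using m tE E(1) by (simp add: subspace_add)
        ultimately have "m + t *\<^sub>R S z \<in> K" using P by blast
        then show "S (m' + t *\<^sub>R z) \<in> K" using S(1) m' by (simp add: linear_add linear_scale)
      qed
      from this[of s] this[of "- s"] have "norm (m' + s *\<^sub>R z) \<le> R" "norm (m' + (- s) *\<^sub>R z) \<le> R" by simp_all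
      then have "norm ((m' + s *\<^sub>R z) - (m' + (- s) *\<^sub>R z)) \<le> R + R"
        by (intro order_trans[OF norm_triangle_ineq4] add_mono)
      moreover have "(m' + s *\<^sub>R z) - (m' + (- s) *\<^sub>R z) = (2 * s) *\<^sub>R z"
        by (simp add: algebra_simps flip: scaleR_add_left)
      ultimately show ?thesis using s by simp
    qed
    show ?thesis
    proof (cases "q (S z) = 0")
      case True
      \<comment> \<open>A null direction of \<open>q\<close> would make every \<open>s\<close>
        admissible and the body unbounded along \<open>z\<close>.\<close>
      have "norm z = 0"
      proof (rule ccontr)
        assume nz: "norm z \<noteq> 0"
        have "0 \<le> R" using half[of 0] True by simp
        then have "(R + 1) / norm z * norm z \<le> R" using True by (intro half) auto
        then show False using nz by simp
      qed
      then show ?thesis using True by simp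
    next
      case False
      then have qp: "0 < q (S z)" using q0 SzE by force
      define s where "s = 1 / (2 * sqrt (q (S z)))"
      have "s\<^sup>2 * q (S z) = 1 / 4" using qp by (simp add: s_def power_divide power_mult_distrib)
      then have "s * norm z \<le> R" using qp by (intro half) (auto simp: s_def)
      then have "norm z \<le> R * (2 * sqrt (q (S z)))" using qp by (simp add: s_def divide_le_eq)
      then have "(norm z)\<^sup>2 \<le> (R * (2 * sqrt (q (S z))))\<^sup>2" by (intro power_mono) auto
      then show ?thesis using qp by (simp add: power_mult_distrib mult_ac)
    qed
  qed
  have "near_quadric ?K R h (span {x, y}) k (l \<circ> S) (q \<circ> S)"
    unfolding near_quadric_def o_def
  proof (intro conjI ballI impI)
    show "linear (\<lambda>x. l (S x))" using linear_compose[OF S(1) lq(1)] by (simp add: o_def)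
    show "quadratic_form (\<lambda>x. q (S x))" unfolding quadratic_form_def
      by (simp add: linear_add[OF S(1)] linear_scale[OF S(1)] quadratic_formD[OF lq(2)])
    fix z assume z: "z \<in> span {x, y}"
    note zz = span_V[OF z] span_E[OF z]
    show "0 \<le> k + l (S z) - q (S z)" if "z \<in> ?K" using that zz P by simp
    show "z \<in> ?K" if "4 * h\<^sup>2 \<le> k + l (S z) - q (S z)" using that zz P by simp
    show "k + l (S z) - q (S z) \<le> 1" using le1 zz by simp
    show "(norm z)\<^sup>2 \<le> 4 * R\<^sup>2 * q (S z)" using lower[OF z] .
  qed
  then show ?thesis by blast
qed

end

section \<open>The constant, and assembly of the estimate\<close>

lemma dimension_constant_exists:
  "\<exists>c>0. \<forall>n\<ge>2. (2 * real n ^ (n + 2)) ^ 143 < c * real n ^ (2 * n\<^sup>2)"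
proof -
  \<comment> \<open>From 600 on, 143 (n + 3) <= 1200 n <= 2 n^2, so the power of \<open>n\<close>
    alone is enough. The finitely many smaller dimensions are covered by the huge constant
    \<open>c\<close>.\<close>
  define N :: nat where "N = 600"
  define c where "c = real N ^ (143 * (N + 3))"
  have "1 \<le> c" unfolding c_def by (intro one_le_power) (simp add: N_def)
  have "(2 * real n ^ (n + 2)) ^ 143 < 2 * c * real n ^ (2 * n\<^sup>2)" if n: "2 \<le> n" for n
  proof -
    have n1: "1 \<le> real n" using n by simp
    have "2 * real n ^ (n + 2) \<le> real n * real n ^ (n + 2)" using n by (intro mult_right_mono) auto
    then have "(2 * real n ^ (n + 2)) ^ 143 \<le> (real n ^ (n + 3)) ^ 143"
      by (intro power_mono) (simp_all add: numeral_3_eq_3)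
    also have "\<dots> = real n ^ (143 * (n + 3))" by (simp add: power_mult[symmetric] mult.commute)
    also have "\<dots> \<le> c * real n ^ (2 * n\<^sup>2)"
    proof (cases "N \<le> n")
      case True
      have "143 * (n + 3) \<le> 2 * (600 * n)" using True by (simp add: N_def)
      also have "\<dots> \<le> 2 * n\<^sup>2" using True by (simp add: N_def power2_eq_square)
      finally have "real n ^ (143 * (n + 3)) \<le> 1 * real n ^ (2 * n\<^sup>2)" using n1 by (simp add: power_increasing)
      also have "\<dots> \<le> c * real n ^ (2 * n\<^sup>2)" using \<open>1 \<le> c\<close> by (intro mult_right_mono) auto
      finally show ?thesis .
    next
      case False
      have "real n ^ (143 * (n + 3)) \<le> real n ^ (143 * (N + 3))" using False n1 by (intro power_increasing) auto
      also have "\<dots> \<le> c" unfolding c_def using False by (intro power_mono) auto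
      also have "\<dots> = c * 1" by simp
      also have "\<dots> \<le> c * real n ^ (2 * n\<^sup>2)" using n1 \<open>1 \<le> c\<close> by (intro mult_left_mono one_le_power) auto
      finally show ?thesis .
    qed
    also have "\<dots> < 2 * c * real n ^ (2 * n\<^sup>2)" using \<open>1 \<le> c\<close> n1 by simp
    finally show ?thesis .
  qed
  then show ?thesis using \<open>1 \<le> c\<close> by (intro exI[of _ "2 * c"]) auto
qed

lemma banach_mazur_dist_position:
  assumes S: "linear S" "S ` coord_space n = coord_space n"
    and b: "\<And>i. i < n \<Longrightarrow> b i \<in> coord_space n" and m: "m \<in> coord_space n" and r: "0 < r1" "0 < r2"
    and K: "K \<subseteq> coord_space n"
    and inner: "\<And>c. (sq_sum n c) \<le> r1\<^sup>2 \<Longrightarrow> S (m + lincomb n c b) \<in> K"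
    and outer: "\<And>x. x \<in> coord_space n \<Longrightarrow> S x \<in> K \<Longrightarrow> \<exists>c. x = m + lincomb n c b \<and> sq_sum n c \<le> r2\<^sup>2"
  shows "ball_dist n K \<le> r2 / r1"
proof (rule banach_mazur_dist_ball_le[where m = "S m" and b = "\<lambda>i. S (b i)"])
  have e: "S (m + lincomb n c b) = S m + (\<Sum>i<n. c i *\<^sub>R S (b i))" for c
    by (simp add: linear_add[OF S(1)] linear_sum[OF S(1)] linear_scale[OF S(1)])
  show "S (b i) \<in> coord_space n" if "i < n" for i using b[OF that] S(2) by blast
  show "S m \<in> coord_space n" using m S(2) by blast
  show "S m + (\<Sum>i<n. c i *\<^sub>R S (b i)) \<in> K" if "sq_sum n c \<le> r1\<^sup>2" for c
    using inner[OF that] unfolding e .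
  show "\<exists>c. x = S m + (\<Sum>i<n. c i *\<^sub>R S (b i)) \<and> sq_sum n c \<le> r2\<^sup>2" if x: "x \<in> K" for x
  proof -
    have "x \<in> S ` coord_space n" using x K S(2) by blast
    then obtain y where y: "y \<in> coord_space n" "x = S y" by blast
    then obtain c where c: "y = m + lincomb n c b" "sq_sum n c \<le> r2\<^sup>2" using outer[of y] x by blast
    have "x = S m + (\<Sum>i<n. c i *\<^sub>R S (b i))" unfolding y(2) c(1) by (rule e)
    then show ?thesis using c(2) by blast
  qed
qed (use r in auto)

text \<open>The Euclidean ball of radius \<open>1 / n\<close> lies in the \<open>l\<^sup>1\<close>
  unit ball around \<open>p\<close>, and conversely the \<open>l\<^sup>1\<close> norm dominates the
  Euclidean one, so a Euclidean ball of radius \<open>2 * R\<close> around \<open>p\<close> contains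
  the body.\<close>

lemma banach_mazur_dist_crude:
  assumes n: "1 \<le> n" and S: "linear S" "S ` coord_space n = coord_space n" and K: "K \<subseteq> coord_space n"
    and inner: "\<And>x. x \<in> coord_space n \<Longrightarrow> norm (x - p) \<le> 1 \<Longrightarrow> S x \<in> K"
    and outer: "\<And>y. y \<in> coord_space n \<Longrightarrow> S y \<in> K \<Longrightarrow> norm y \<le> R" and p: "p \<in> coord_space n" and R: "0 < R"
  shows "ball_dist n K \<le> 2 * real n * R"
proof -
  note V = subspace_coord_space[of n]
  have "ball_dist n K \<le> (2 * R) / (1 / real n)"
  proof (rule banach_mazur_dist_position[OF S unit_vec_coord_space p _ _ K])
    fix c :: "nat \<Rightarrow> real" assume c: "sq_sum n c \<le> (1 / real n)\<^sup>2"
    let ?s = "\<Sum>i<n. c i *\<^sub>R unit_vec i"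
    have sV: "?s \<in> coord_space n" by (rule sum_unit_vec_coord_space) simp
    have "\<bar>c i\<bar> \<le> 1 / real n" if "i < n" for i
    proof -
      have "(c i)\<^sup>2 \<le> (1 / real n)\<^sup>2" using member_le_sum[of i "{..<n}" "\<lambda>i. (c i)\<^sup>2"] that c by auto
      then show ?thesis by (metis abs_le_square_iff abs_of_nonneg divide_nonneg_nonneg of_nat_0_le_iff zero_le_one)
    qed
    then have "(\<Sum>i<n. \<bar>c i\<bar>) \<le> (\<Sum>i<n. 1 / real n)" by (intro sum_mono) auto
    then have "norm ?s \<le> 1" unfolding norm_coord_space[OF sV] coeff_sum_unit_vec using n by simp
    then show "S (p + ?s) \<in> K" using p sV V by (intro inner) (auto simp: subspace_add)
  next
    fix x assume x: "x \<in> coord_space n" "S x \<in> K"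
    have y: "x - p \<in> coord_space n" using x p V by (simp add: subspace_diff)
    have "S p \<in> K" using p by (intro inner) auto
    then have "norm (x - p) \<le> R + R" using outer[OF x] outer[OF p] by (intro order_trans[OF norm_triangle_ineq4] add_mono)
    then have s: "(\<Sum>i<n. \<bar>coeff (x - p) i\<bar>) \<le> 2 * R" by (simp add: norm_coord_space[OF y])
    have "(\<Sum>i<n. (coeff (x - p) i)\<^sup>2) \<le> (\<Sum>i<n. \<bar>coeff (x - p) i\<bar> * (2 * R))"
    proof (rule sum_mono)
      fix i assume i: "i \<in> {..<n}"
      have "\<bar>coeff (x - p) i\<bar> \<le> 2 * R" using member_le_sum[of i "{..<n}" "\<lambda>i. \<bar>coeff (x - p) i\<bar>"] i s by auto
      then have "\<bar>coeff (x - p) i\<bar> * \<bar>coeff (x - p) i\<bar> \<le> \<bar>coeff (x - p) i\<bar> * (2 * R)" by (intro mult_left_mono) auto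
      then show "(coeff (x - p) i)\<^sup>2 \<le> \<bar>coeff (x - p) i\<bar> * (2 * R)" by (simp add: power2_eq_square)
    qed
    also have "\<dots> = (\<Sum>i<n. \<bar>coeff (x - p) i\<bar>) * (2 * R)" by (simp add: sum_distrib_right)
    also have "\<dots> \<le> (2 * R) * (2 * R)" using s R by (intro mult_right_mono) auto
    finally have "(\<Sum>i<n. (coeff (x - p) i)\<^sup>2) \<le> (2 * R)\<^sup>2" by (simp add: power2_eq_square)
    moreover have "x = p + (\<Sum>i<n. coeff (x - p) i *\<^sub>R unit_vec i)" using coord_space_expand[OF y] by simp
    ultimately show "\<exists>c. x = p + lincomb n c unit_vec \<and> sq_sum n c \<le> (2 * R)\<^sup>2" by blast
  qed (use n R in auto)
  then show ?thesis using n by (simp add: mult_ac)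
qed

lemma banach_mazur_dist_quantitative:
  fixes K :: "(nat \<Rightarrow>\<^sub>0 real) set"
  assumes n: "2 \<le> n" and e: "0 < \<epsilon>" and K: "convex_body_in (coord_space n) K"
    and int: "0 \<in> (top_of_set (coord_space n)) interior_of K"
    and bm: "\<And>E. subspace E \<Longrightarrow> E \<subseteq> coord_space n \<Longrightarrow> dim E = 2 \<Longrightarrow>
          banach_mazur_dist E (K \<inter> E) (coord_space 2) (disc) < 1 + \<epsilon>"
  shows "ball_dist n K
     \<le> 1 + (2 * real n ^ (n + 2)) ^ 143 * sqrt \<epsilon>"
proof -
  note V = subspace_coord_space[of n]
  let ?K = "\<lambda>S. {y \<in> coord_space n. S y \<in> K}"
  have Kb: "K \<subseteq> coord_space n" "compact K" "convex K" using K by (auto simp: convex_body_in_def)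
  obtain U where U: "open U" "0 \<in> U" "coord_space n \<inter> U \<subseteq> K"
    using int unfolding interior_of_def openin_open by auto
  obtain d where d: "0 < d" "cball 0 d \<subseteq> U" using U(1,2) open_contains_cball by blast
  have inK: "x \<in> K" if "x \<in> coord_space n" "norm x \<le> d" for x
    using that d U(3) by (auto simp: subset_iff dist_norm)
  obtain b where b: "0 < b" "\<And>x. x \<in> K \<Longrightarrow> norm x \<le> b"
    using compact_imp_bounded[OF Kb(2)] bounded_pos by blast
  have zK: "0 \<in> K" using d V by (intro inK) (auto simp: subspace_0)
  have span: "coord_space n \<subseteq> span K"
  proof
    fix x assume x: "x \<in> coord_space n"
    obtain t where t: "0 < t" "norm (t *\<^sub>R x) \<le> d" using small_multiple_exists[OF d(1)] by blast
    then have "t *\<^sub>R x \<in> K" using x V by (intro inK) (simp_all only: subspace_scale)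
    then have "(1 / t) *\<^sub>R (t *\<^sub>R x) \<in> span K" by (intro span_scale span_base)
    then show "x \<in> span K" using t(1) by simp
  qed
  define R where "R = 2 * real n ^ (n + 2)"
  define p where "p = (\<Sum>i<n. unit_vec i)"
  define h where "h = sqrt \<epsilon>"
  have h: "0 < h" "h\<^sup>2 = \<epsilon>" using e by (auto simp: h_def)
  obtain S where S: "linear S" "S ` coord_space n = coord_space n"
    and cK: "compact (?K S)"
    and inner: "\<And>x. x \<in> coord_space n \<Longrightarrow> norm (x - p) \<le> 1 \<Longrightarrow> S x \<in> K"
    and outer: "\<And>y. y \<in> coord_space n \<Longrightarrow> S y \<in> K \<Longrightarrow> norm y \<le> R"
    using good_position[OF n Kb(2,3,1) zK span] unfolding R_def p_def by blast
  have pV: "p \<in> coord_space n" using sum_unit_vec_coord_space[of n n "\<lambda>_. 1"] by (simp add: p_def)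
  have "coeff p i = (if i < n then 1 else 0)" for i
    using coeff_sum_unit_vec[of "\<lambda>_. 1" n i] by (simp add: p_def)
  then have np: "norm p = real n" by (simp add: norm_coord_space[OF pV])
  have "(2::real) ^ 4 \<le> real n ^ 4" using n by (intro power_mono) auto
  also have "\<dots> \<le> real n ^ (n + 2)" using n by (intro power_increasing) auto
  finally have R32: "32 \<le> R" by (simp add: R_def)
  have "real n ^ 1 \<le> real n ^ (n + 2)" using n by (intro power_increasing) auto
  then have nR: "real n \<le> R" by (simp add: R_def)
  have Rpow: "R ^ i \<le> R ^ j" if "i \<le> j" for i j using R32 that by (intro power_increasing) auto
  have "ball_dist n K \<le> 1 + R ^ 143 * h"
  \<comment> \<open>Only for small \<open>h\<close> do the planar sections determine an ellipsoid.
    Otherwise the claimed bound exceeds \<open>R ^ 3\<close>, and the position of the body alone is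
    enough.\<close>
  proof (cases "h * R ^ 140 \<le> 1")
    case True
    have "32 ^ 1 \<le> R ^ 1" using R32 by simp
    then have "32 \<le> R ^ 140" using Rpow[of 1 140] by simp
    then have "h * 32 \<le> h * R ^ 140" using h by (intro mult_left_mono) auto
    then have "h \<le> 1 / 4" using True by simp
    then have "h\<^sup>2 \<le> (1 / 4)\<^sup>2" using h by (intro power_mono) auto
    then have h16: "h\<^sup>2 \<le> 1 / 16" by (simp add: power2_eq_square)
    interpret near_quadric_sections_coord n "?K S" p R h
    proof unfold_locales
      show "subspace (coord_space n)" by (rule V)
      show "compact (?K S)" by (rule cK)
      have "(?K S) = coord_space n \<inter> S -` K" by auto
      then show "convex (?K S)"
        using V S(1) Kb(3) by (simp add: convex_Int subspace_imp_convex convex_linear_vimage)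
      show "0 \<in> (?K S)" using zK V S(1) by (simp add: subspace_0 linear_0)
      show "1 \<le> norm p" using np n by simp
      show "\<exists>k l q. near_quadric (?K S) R h (span {x, y}) k l q"
        if "x \<in> coord_space n" "y \<in> coord_space n" for x y
        using near_quadric_pullback[OF b(2,1) inK d(1) n Kb(3,1) h(1) h16 _ S outer that] bm h(2) by simp
    qed (use pV inner outer R32 h True nR n in auto)
    obtain m b r1 r2 where *: "m \<in> coord_space n" "\<forall>i<n. b i \<in> coord_space n" "0 < r1" "0 < r2"
      "\<forall>c. (sq_sum n c) \<le> r1\<^sup>2 \<longrightarrow> m + lincomb n c b \<in> (?K S)"
      "\<forall>x\<in>(?K S). \<exists>c. x = m + lincomb n c b \<and> sq_sum n c \<le> r2\<^sup>2"
      "r2 / r1 \<le> 1 + R ^ 132 * h"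
      using ellipsoid_sandwich by (elim exE conjE)
    have "ball_dist n K \<le> r2 / r1"
      using * by (intro banach_mazur_dist_position[OF S _ *(1,3,4) Kb(1), of b]) auto
    moreover have "R ^ 132 * h \<le> R ^ 143 * h" using Rpow[of 132 143] h by (intro mult_right_mono) auto
    ultimately show ?thesis using *(7) by linarith
  next
    case False
    have "ball_dist n K \<le> 2 * real n * R"
      using n R32 by (intro banach_mazur_dist_crude[OF _ S Kb(1) inner outer pV]) auto
    also have "\<dots> \<le> R * R * R" using nR R32 by (intro mult_mono) auto
    also have "\<dots> = R ^ 3 * 1" by (simp add: power3_eq_cube)
    also have "\<dots> \<le> R ^ 3 * (h * R ^ 140)" using False R32 by (intro mult_left_mono) auto
    also have "\<dots> = R ^ 143 * h" using power_add[of R 3 140] by simp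
    finally show ?thesis by simp
  qed
  then show ?thesis by (simp add: R_def h_def)
qed

theorem theorem1p13:
  shows "\<exists>c::real. c > 0 \<and>
    (\<forall>(n::nat) (\<epsilon>::real) (K :: (nat \<Rightarrow>\<^sub>0 real) set).
       n \<ge> 2 \<longrightarrow> \<epsilon> > 0 \<longrightarrow>
       convex_body_in (coord_space n) K \<longrightarrow>
       0 \<in> (top_of_set (coord_space n)) interior_of K \<longrightarrow>
       (\<forall>E. subspace E \<longrightarrow> E \<subseteq> coord_space n \<longrightarrow> dim E = 2 \<longrightarrow>
          banach_mazur_dist E (K \<inter> E) (coord_space 2) (euclidean_unit_ball 2) < 1 + \<epsilon>) \<longrightarrow>
       banach_mazur_dist (coord_space n) K (coord_space n) (euclidean_unit_ball n)
         < 1 + c * real n ^ (2 * n\<^sup>2) * sqrt \<epsilon>)"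
proof -
  obtain c where c: "c > 0" "\<And>n. 2 \<le> n \<Longrightarrow> (2 * real n ^ (n + 2)) ^ 143 < c * real n ^ (2 * n\<^sup>2)"
    using dimension_constant_exists by blast
  show ?thesis
  proof (intro exI[of _ c] conjI allI impI)
    fix n :: nat and \<epsilon> :: real and K :: "(nat \<Rightarrow>\<^sub>0 real) set"
    assume n: "2 \<le> n" and e: "0 < \<epsilon>" and K: "convex_body_in (coord_space n) K"
      "0 \<in> (top_of_set (coord_space n)) interior_of K"
      and bm: "\<forall>E. subspace E \<longrightarrow> E \<subseteq> coord_space n \<longrightarrow> dim E = 2 \<longrightarrow>
          banach_mazur_dist E (K \<inter> E) (coord_space 2) (euclidean_unit_ball 2) < 1 + \<epsilon>"
    have "ball_dist n K
       \<le> 1 + (2 * real n ^ (n + 2)) ^ 143 * sqrt \<epsilon>"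
      using bm by (intro banach_mazur_dist_quantitative n e K) auto
    also have "\<dots> < 1 + c * real n ^ (2 * n\<^sup>2) * sqrt \<epsilon>"
      using c(2)[OF n] e by (intro add_strict_left_mono mult_strict_right_mono) auto
    finally show "ball_dist n K
         < 1 + c * real n ^ (2 * n\<^sup>2) * sqrt \<epsilon>" .
  qed (rule c(1))
qed

end
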